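(* Assume that the toric variety with moment polytope $\Delta$ is unstable. Then there exists a convex minimizer $u\in L^\infty(\bar\Delta)$ (normalized by $\int_\Delta u\,d\mu=0$) of the functional $$W(u)=\frac{\mathcal L_a(u)}{\|u\|}$$ over the functions $u\in\mathcal C_1\cap L^2(\Delta)$ with $\|u\|\ne0$. This $u$ gives a filtration (namely the filtration $\chi_u$ of the homogeneous coordinate ring), and $u$ is unique up to scaling.
   Context: $(M,L)$ is a polarized toric variety of dimension $n$ with moment polytope $\Delta=\{\xi\in(\mathbb R^n)^*: l_i(\xi)>0,\ i=1,\dots,d\}$ (open, bounded, Delzant, with $l_i(\xi)=\langle\xi,a_i\rangle-\lambda_i$, $a_i$ the primitive integral inward normal of the $i$-th facet). $d\mu$ is Lebesgue measure on $\Delta$; on the facet $\{l_i=0\}$, $d\sigma$ is $|a_i|^{-1}$ times the $(n-1)$-dimensional Lebesgue measure. Put $$a=\frac{Vol(\partial\Delta,d\sigma)}{Vol(\Delta,d\mu)},\qquad \mathcal L_a(u)=\int_{\partial\Delta}u\,d\sigma-a\int_\Delta u\,d\mu,\qquad \|u\|^2=\int_\Delta u^2d\mu-\frac{\left(\int_\Delta u\,d\mu\right)^2}{Vol(\Delta,d\mu)} .$$ $\Delta^*$ is the union of $\Delta$ and the interiors of its codimension-one faces, and $\mathcal C_1$ is the set of continuous convex functions on $\Delta^*$ that are integrable on $\partial\Delta$. Unstable means (for constant scalar curvature) that there is a rational piecewise-linear convex function $u$ on $\bar\Delta$ (a maximum of finitely many affine functions with rational coefficients) with $\mathcal L_a(u)<0$.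 $\mathcal L_a$, $\|\cdot\|$ and hence $W$ are unchanged when a constant is added to $u$. Filtrations: let $R_k=H^0(M,L^k)$ and $R=\bigoplus_{k\ge0}R_k$. A filtration of $R$ is a chain $\mathbb C=F_0R\subset F_1R\subset\cdots\subset R$ with $(F_iR)(F_jR)\subset F_{i+j}R$, $F_iR=\bigoplus_{k\ge0}(F_iR\cap R_k)$ and $R=\bigcup_{i\ge0}F_iR$. $R_k$ has a basis of sections $s_\alpha$ indexed by $\alpha\in\bar\Delta\cap\frac1k\mathbb Z^n$. A (finite-valued) convex function $u:\bar\Delta\to\mathbb R$, after adding a constant to make it positive, defines the filtration $\chi_u$ by letting $F_iR\cap R_k$ be spanned by those $s_\alpha$ with $k\,u(\alpha)\le i$. *)

theory Defs
  imports "HOL-Analysis.Analysis" "HOL-Library.Poly_Mapping"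
begin

section \<open>Delzant polytopes\<close>

text \<open>
  A polytope is given by its number of facets \<open>d\<close>, the integral inward normals \<open>a i\<close> and the
  constants \<open>lam i\<close>, for \<open>1 \<le> i \<le> d\<close>.  The dual space of \<open>\<real>\<^sup>n\<close> is identified with
  \<^typ>\<open>real ^ 'n\<close> through the standard pairing, which is the inner product.
\<close>

definition real_vec :: "int ^ 'n \<Rightarrow> real ^ 'n"
  where "real_vec m = (\<chi> j. real_of_int (m $ j))"

definition lfun :: "(nat \<Rightarrow> int ^ 'n) \<Rightarrow> (nat \<Rightarrow> int) \<Rightarrow> nat \<Rightarrow> real ^ 'n \<Rightarrow> real"
  where "lfun a lam i x = x \<bullet> real_vec (a i) - real_of_int (lam i)"

definition polyt :: "nat \<Rightarrow> (nat \<Rightarrow> int ^ 'n) \<Rightarrow> (nat \<Rightarrow> int) \<Rightarrow> (real ^ 'n) set"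
  where "polyt d a lam = {x. \<forall>i\<in>{1..d}. 0 < lfun a lam i x}"

definition facet :: "nat \<Rightarrow> (nat \<Rightarrow> int ^ 'n) \<Rightarrow> (nat \<Rightarrow> int) \<Rightarrow> nat \<Rightarrow> (real ^ 'n) set"
  where "facet d a lam i = closure (polyt d a lam) \<inter> {x. lfun a lam i x = 0}"

definition primitive_vec :: "int ^ 'n \<Rightarrow> bool"
  where "primitive_vec m \<longleftrightarrow> (GCD j. m $ j) = 1"

definition lattice_basis :: "nat set \<Rightarrow> (nat \<Rightarrow> int ^ 'n) \<Rightarrow> bool"
  where "lattice_basis I a \<longleftrightarrow>
    (\<forall>c. (\<Sum>i\<in>I. c i *s a i) = 0 \<longrightarrow> (\<forall>i\<in>I. c i = 0)) \<and>
    (\<forall>z. \<exists>c. z = (\<Sum>i\<in>I. c i *s a i))"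

text \<open>
  The constants \<open>lam i\<close> are integers because the polytope comes from a line bundle: it is a
  lattice polytope.
\<close>

definition delzant_polytope :: "nat \<Rightarrow> (nat \<Rightarrow> int ^ 'n) \<Rightarrow> (nat \<Rightarrow> int) \<Rightarrow> bool"
  where "delzant_polytope d a lam \<longleftrightarrow>
    polyt d a lam \<noteq> {} \<and> bounded (polyt d a lam) \<and>
    (\<forall>i\<in>{1..d}. primitive_vec (a i) \<and> facet d a lam i facet_of closure (polyt d a lam)) \<and>
    (\<forall>v. v extreme_point_of closure (polyt d a lam) \<longrightarrow>
      card {i\<in>{1..d}. v \<in> facet d a lam i} = CARD('n) \<and>
      lattice_basis {i\<in>{1..d}. v \<in> facet d a lam i} a)"

definition polyt_star :: "nat \<Rightarrow> (nat \<Rightarrow> int ^ 'n) \<Rightarrow> (nat \<Rightarrow> int) \<Rightarrow> (real ^ 'n) set"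
  where "polyt_star d a lam =
    polyt d a lam \<union> (\<Union>i\<in>{1..d}. rel_interior (facet d a lam i))"


section \<open>The boundary measure and the functional\<close>

text \<open>
  The \<open>(n - 1)\<close>-dimensional Lebesgue measure on the hyperplane \<open>{x. x \<bullet> v = c}\<close>: product Lebesgue
  measure in the coordinates of an orthonormal basis of its direction space, with the point
  \<open>(c / (v \<bullet> v)) v\<close> of the hyperplane as origin.  It does not depend on the basis, and for
  \<open>n = 1\<close> it is the unit mass at that point.
\<close>

definition hyperplane_basis :: "real ^ 'n \<Rightarrow> (real ^ 'n) set"
  where "hyperplane_basis v =
    (SOME B. pairwise orthogonal B \<and> (\<forall>b\<in>B. norm b = 1) \<and> span B = {x. x \<bullet> v = 0})"

definition hyperplane_lebesgue :: "real ^ 'n \<Rightarrow> real \<Rightarrow> (real ^ 'n) measure"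
  where "hyperplane_lebesgue v c =
    distr (Pi\<^sub>M (hyperplane_basis v) (\<lambda>_. lborel :: real measure)) borel
      (\<lambda>t. (c / (v \<bullet> v)) *\<^sub>R v + (\<Sum>b\<in>hyperplane_basis v. t b *\<^sub>R b))"

definition facet_measure ::
    "(nat \<Rightarrow> int ^ 'n) \<Rightarrow> (nat \<Rightarrow> int) \<Rightarrow> nat \<Rightarrow> (real ^ 'n) measure"
  where "facet_measure a lam i =
    scale_measure (ennreal (1 / norm (real_vec (a i))))
      (hyperplane_lebesgue (real_vec (a i)) (real_of_int (lam i)))"

text \<open>
  Integrals over the boundary are taken facet by facet over the relative interiors of the facets.
  What is left out is a null set, and functions on \<^const>\<open>polyt_star\<close> are not defined there.
\<close>

definition boundary_integrable ::
    "nat \<Rightarrow> (nat \<Rightarrow> int ^ 'n) \<Rightarrow> (nat \<Rightarrow> int) \<Rightarrow> (real ^ 'n \<Rightarrow> real) \<Rightarrow> bool"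
  where "boundary_integrable d a lam u \<longleftrightarrow>
    (\<forall>i\<in>{1..d}. set_integrable (facet_measure a lam i) (rel_interior (facet d a lam i)) u)"

definition boundary_integral ::
    "nat \<Rightarrow> (nat \<Rightarrow> int ^ 'n) \<Rightarrow> (nat \<Rightarrow> int) \<Rightarrow> (real ^ 'n \<Rightarrow> real) \<Rightarrow> real"
  where "boundary_integral d a lam u =
    (\<Sum>i\<in>{1..d}. LINT x:rel_interior (facet d a lam i)|facet_measure a lam i. u x)"

definition boundary_volume :: "nat \<Rightarrow> (nat \<Rightarrow> int ^ 'n) \<Rightarrow> (nat \<Rightarrow> int) \<Rightarrow> real"
  where "boundary_volume d a lam =
    (\<Sum>i\<in>{1..d}. measure (facet_measure a lam i) (facet d a lam i))"

definition polyt_volume :: "nat \<Rightarrow> (nat \<Rightarrow> int ^ 'n) \<Rightarrow> (nat \<Rightarrow> int) \<Rightarrow> real"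
  where "polyt_volume d a lam = measure lborel (polyt d a lam)"

definition polyt_integral ::
    "nat \<Rightarrow> (nat \<Rightarrow> int ^ 'n) \<Rightarrow> (nat \<Rightarrow> int) \<Rightarrow> (real ^ 'n \<Rightarrow> real) \<Rightarrow> real"
  where "polyt_integral d a lam u = (LINT x:polyt d a lam|lborel. u x)"

definition L_fun ::
    "nat \<Rightarrow> (nat \<Rightarrow> int ^ 'n) \<Rightarrow> (nat \<Rightarrow> int) \<Rightarrow> (real ^ 'n \<Rightarrow> real) \<Rightarrow> real"
  where "L_fun d a lam u =
    boundary_integral d a lam u
      - boundary_volume d a lam / polyt_volume d a lam * polyt_integral d a lam u"

definition polyt_norm ::
    "nat \<Rightarrow> (nat \<Rightarrow> int ^ 'n) \<Rightarrow> (nat \<Rightarrow> int) \<Rightarrow> (real ^ 'n \<Rightarrow> real) \<Rightarrow> real"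
  where "polyt_norm d a lam u =
    sqrt (polyt_integral d a lam (\<lambda>x. (u x)\<^sup>2)
      - (polyt_integral d a lam u)\<^sup>2 / polyt_volume d a lam)"

definition W_fun ::
    "nat \<Rightarrow> (nat \<Rightarrow> int ^ 'n) \<Rightarrow> (nat \<Rightarrow> int) \<Rightarrow> (real ^ 'n \<Rightarrow> real) \<Rightarrow> real"
  where "W_fun d a lam u = L_fun d a lam u / polyt_norm d a lam u"

definition C1_functions ::
    "nat \<Rightarrow> (nat \<Rightarrow> int ^ 'n) \<Rightarrow> (nat \<Rightarrow> int) \<Rightarrow> (real ^ 'n \<Rightarrow> real) set"
  where "C1_functions d a lam =
    {u. continuous_on (polyt_star d a lam) u \<and> convex_on (polyt_star d a lam) u \<and>
        boundary_integrable d a lam u}"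

definition L2_functions ::
    "nat \<Rightarrow> (nat \<Rightarrow> int ^ 'n) \<Rightarrow> (nat \<Rightarrow> int) \<Rightarrow> (real ^ 'n \<Rightarrow> real) set"
  where "L2_functions d a lam =
    {u. set_borel_measurable lborel (polyt d a lam) u \<and>
        set_integrable lborel (polyt d a lam) (\<lambda>x. (u x)\<^sup>2)}"

definition W_admissible ::
    "nat \<Rightarrow> (nat \<Rightarrow> int ^ 'n) \<Rightarrow> (nat \<Rightarrow> int) \<Rightarrow> (real ^ 'n \<Rightarrow> real) set"
  where "W_admissible d a lam =
    {u \<in> C1_functions d a lam \<inter> L2_functions d a lam. polyt_norm d a lam u \<noteq> 0}"

definition W_minimizer ::
    "nat \<Rightarrow> (nat \<Rightarrow> int ^ 'n) \<Rightarrow> (nat \<Rightarrow> int) \<Rightarrow> (real ^ 'n \<Rightarrow> real) \<Rightarrow> bool"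
  where "W_minimizer d a lam u \<longleftrightarrow>
    u \<in> W_admissible d a lam \<and> (\<forall>v\<in>W_admissible d a lam. W_fun d a lam u \<le> W_fun d a lam v)"

definition rational_pl_convex_on :: "(real ^ 'n) set \<Rightarrow> (real ^ 'n \<Rightarrow> real) \<Rightarrow> bool"
  where "rational_pl_convex_on S u \<longleftrightarrow>
    (\<exists>A :: ((real ^ 'n) \<times> real) set. finite A \<and> A \<noteq> {} \<and>
      (\<forall>(p, q)\<in>A. (\<forall>j. p $ j \<in> \<rat>) \<and> q \<in> \<rat>) \<and>
      (\<forall>x\<in>S. u x = Max ((\<lambda>(p, q). p \<bullet> x + q) ` A)))"

definition unstable :: "nat \<Rightarrow> (nat \<Rightarrow> int ^ 'n) \<Rightarrow> (nat \<Rightarrow> int) \<Rightarrow> bool"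
  where "unstable d a lam \<longleftrightarrow>
    (\<exists>u. rational_pl_convex_on (closure (polyt d a lam)) u \<and> L_fun d a lam u < 0)"


section \<open>The homogeneous coordinate ring and its filtrations\<close>

text \<open>
  The section \<open>s\<^sub>\<alpha>\<close> of \<open>L\<^sup>k\<close>, for a point \<open>\<alpha>\<close> of the closed polytope with \<open>k \<alpha>\<close> integral, restricts
  to the character \<open>k \<alpha>\<close> on the open torus orbit.  So the homogeneous coordinate ring is the
  algebra of the semigroup of pairs \<open>(k, k \<alpha>)\<close>, realised inside the algebra of
  \<open>\<nat> \<times> \<int>\<^sup>n\<close>, whose multiplication is the convolution product.
\<close>

type_synonym 'n section_ring = "(nat \<times> (int ^ 'n)) \<Rightarrow>\<^sub>0 complex"

definition scalar_mult :: "complex \<Rightarrow> 'n::finite section_ring \<Rightarrow> 'n section_ring"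
  where "scalar_mult c f = Poly_Mapping.single 0 c * f"

global_interpretation section_space: vector_space
    "scalar_mult :: complex \<Rightarrow> 'n::finite section_ring \<Rightarrow> 'n section_ring"
  by unfold_locales
    (simp_all add: scalar_mult_def algebra_simps single_add mult_single flip: mult.assoc)

definition monom_section :: "nat \<Rightarrow> int ^ 'n \<Rightarrow> 'n::finite section_ring"
  where "monom_section k m = Poly_Mapping.single (k, m) 1"

text \<open>The integral points \<open>k \<alpha>\<close>; for \<open>k = 0\<close> only \<open>0\<close>, since the degree zero part is \<open>\<complex>\<close>.\<close>

definition lattice_points ::
    "nat \<Rightarrow> (nat \<Rightarrow> int ^ 'n) \<Rightarrow> (nat \<Rightarrow> int) \<Rightarrow> nat \<Rightarrow> (int ^ 'n) set"
  where "lattice_points d a lam k =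
    {m. \<exists>\<alpha>\<in>closure (polyt d a lam). real_vec m = real k *\<^sub>R \<alpha>}"

definition graded_part ::
    "nat \<Rightarrow> (nat \<Rightarrow> int ^ 'n) \<Rightarrow> (nat \<Rightarrow> int) \<Rightarrow> nat \<Rightarrow> 'n::finite section_ring set"
  where "graded_part d a lam k =
    section_space.span (monom_section k ` lattice_points d a lam k)"

definition coord_ring ::
    "nat \<Rightarrow> (nat \<Rightarrow> int ^ 'n) \<Rightarrow> (nat \<Rightarrow> int) \<Rightarrow> 'n::finite section_ring set"
  where "coord_ring d a lam = section_space.span (\<Union>k. graded_part d a lam k)"

text \<open>
  The sum of the graded parts is direct in the ambient ring, so \<open>F i\<close> is the direct sum of its
  intersections with them iff these intersections span it.
\<close>

definition ring_filtration ::
    "nat \<Rightarrow> (nat \<Rightarrow> int ^ 'n) \<Rightarrow> (nat \<Rightarrow> int) \<Rightarrow> (nat \<Rightarrow> 'n::finite section_ring set) \<Rightarrow> bool"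
  where "ring_filtration d a lam F \<longleftrightarrow>
    (\<forall>i. section_space.subspace (F i) \<and> F i \<subseteq> F (Suc i) \<and> F i \<subseteq> coord_ring d a lam) \<and>
    F 0 = range (\<lambda>c. scalar_mult c 1) \<and>
    (\<forall>i j. \<forall>f\<in>F i. \<forall>g\<in>F j. f * g \<in> F (i + j)) \<and>
    (\<forall>i. F i = section_space.span (\<Union>k. F i \<inter> graded_part d a lam k)) \<and>
    coord_ring d a lam = (\<Union>i. F i)"

text \<open>
  For \<open>k = 0\<close> the condition on \<open>u\<close> reads \<open>0 \<le> i\<close>, so every step contains the degree zero part.
\<close>

definition chi_filtration ::
    "nat \<Rightarrow> (nat \<Rightarrow> int ^ 'n) \<Rightarrow> (nat \<Rightarrow> int) \<Rightarrow> (real ^ 'n \<Rightarrow> real) \<Rightarrow> nat \<Rightarrow>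
      'n::finite section_ring set"
  where "chi_filtration d a lam u i =
    section_space.span
      {monom_section k m | k m. m \<in> lattice_points d a lam k \<and>
        real k * u ((1 / real k) *\<^sub>R real_vec m) \<le> real i}"

end

theory Submission
  imports Defs "HOL-Complex_Analysis.Great_Picard"
begin

text \<open>
  Write \<open>\<Delta>\<close> for the open polytope, \<open>\<Delta>s\<close> for its union with the open facets, \<open>L\<close> for the linear
  functional and \<open>Q u = \<parallel>u\<parallel>\<^sup>2\<close>.  Both are unchanged when a constant is added to \<open>u\<close>.  For \<open>L u < 0\<close>,
  the minimum over \<open>s > 0\<close> of \<open>L (s u) + Q (s u) / 2\<close> is \<open>- (W u)\<^sup>2 / 2\<close>; hence a minimizer of \<open>W\<close> is,
  up to scaling, a minimizer of the energy \<open>L u + Q u / 2\<close>, which is negative somewhere because the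
  polytope is unstable.  The energy is strictly convex modulo constants, and this gives
  uniqueness (\<open>energy_minimizer_imp_W\<close>).

  For existence and boundedness at once, a function \<open>u\<close> is replaced by a truncation
  \<open>w = trunc p j u \<le> u\<close>: the infimum over \<open>s \<ge> 1\<close> of \<open>s (u + j) - j\<close>, dilated by the factor \<open>s\<close> about an
  interior point \<open>p\<close>.  It is a finite convex function on all of space, bounded on bounded sets in
  terms of a lower bound of \<open>u\<close>, the values of \<open>u\<close> near \<open>p\<close>, and \<open>j\<close>.  On a ray from \<open>p\<close> it agrees with \<open>u\<close> up to some point and is linear
  beyond it, so \<open>u - w\<close> increases towards the boundary (\<open>trunc_diff_mono\<close>), and for large \<open>j\<close> it
  vanishes outside a layer of relative thickness \<open>\<delta>\<close> at the boundary (\<open>trunc_inner\<close>).  The integral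
  of such a function over \<open>\<Delta>\<close> is at most \<open>C \<delta>\<close> times its integral over the boundary
  (\<open>boundary_layer_estimate\<close>).  So for small \<open>\<delta>\<close> the gain in the boundary term of \<open>L\<close> outweighs the
  loss in the interior terms, and truncation does not increase the energy.

  A convex function of mean zero and nonpositive energy satisfies uniform bounds, from below on
  \<open>\<Delta>s\<close> and from above on compact parts of \<open>\<Delta>\<close>; therefore one pair \<open>\<delta>, j\<close> works for all of them
  (\<open>uniform_truncation\<close>).  So there is a minimizing sequence of convex functions that are uniformly
  bounded on a neighbourhood of the closure of \<open>\<Delta>\<close>, hence uniformly Lipschitz there.  By the
  theorem of Arzela and Ascoli a subsequence converges uniformly, to a minimizer that is continuous
  on the closed polytope (\<open>exists_energy_minimizer\<close>).

  The filtration axioms follow from convexity, which makes the filtration multiplicative, and from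
  positivity, which makes its first step trivial (\<open>ring_filtration_chi\<close>).
\<close>

section \<open>Lebesgue measure on hyperplanes\<close>

lemma nn_integral_PiM_affine:
  fixes c :: "'i \<Rightarrow> real" and \<tau> :: real
  assumes "finite I" and \<tau>: "\<tau> \<noteq> 0"
    and "F \<in> borel_measurable (Pi\<^sub>M I (\<lambda>_. lborel))"
  shows "(\<integral>\<^sup>+f. F f \<partial>Pi\<^sub>M I (\<lambda>_. lborel)) =
    ennreal (\<bar>\<tau>\<bar> ^ card I) * (\<integral>\<^sup>+f. F (\<lambda>i\<in>I. c i + \<tau> * f i) \<partial>Pi\<^sub>M I (\<lambda>_. lborel))"
  using assms(1,3)
proof (induction I arbitrary: F)
  case empty
  have "(\<integral>\<^sup>+f. F f \<partial>Pi\<^sub>M {} (\<lambda>_. lborel))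
      = (\<integral>\<^sup>+f. F (\<lambda>i\<in>{}. c i + \<tau> * f i) \<partial>Pi\<^sub>M {} (\<lambda>_. lborel))"
    by (rule nn_integral_cong) (simp add: space_PiM restrict_def)
  then show ?case
    by (simp only: card.empty power_0 ennreal_1 mult_1_left)
next
  case (insert i I)
  interpret product_sigma_finite "\<lambda>_::'i. lborel :: real measure" by standard
  note [measurable] = insert.prems
  have G: "(\<lambda>x. \<integral>\<^sup>+y. F (x(i := y)) \<partial>lborel) \<in> borel_measurable (Pi\<^sub>M I (\<lambda>_. lborel))"
    by measurable
  have R: "(\<lambda>f. \<lambda>j\<in>insert i I. c j + \<tau> * f j)
      \<in> Pi\<^sub>M (insert i I) (\<lambda>_. lborel) \<rightarrow>\<^sub>M Pi\<^sub>M (insert i I) (\<lambda>_. lborel)"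
    by (intro measurable_restrict) (simp add: measurable_lborel1)
  have upd: "(\<lambda>j\<in>insert i I. c j + \<tau> * (x(i := y)) j)
      = (\<lambda>j\<in>I. c j + \<tau> * x j)(i := c i + \<tau> * y)" for x y
    using \<open>i \<notin> I\<close> by (auto simp: fun_eq_iff)
  have "(\<integral>\<^sup>+f. F f \<partial>Pi\<^sub>M (insert i I) (\<lambda>_. lborel))
      = (\<integral>\<^sup>+x. \<integral>\<^sup>+y. F (x(i := y)) \<partial>lborel \<partial>Pi\<^sub>M I (\<lambda>_. lborel))"
    using insert by (intro product_nn_integral_insert) auto
  also have "\<dots> = ennreal (\<bar>\<tau>\<bar> ^ card I) *
      (\<integral>\<^sup>+x. \<integral>\<^sup>+y. F ((\<lambda>j\<in>I. c j + \<tau> * x j)(i := y)) \<partial>lborel \<partial>Pi\<^sub>M I (\<lambda>_. lborel))"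
    by (rule insert.IH[OF G])
  also have "(\<integral>\<^sup>+x. \<integral>\<^sup>+y. F ((\<lambda>j\<in>I. c j + \<tau> * x j)(i := y)) \<partial>lborel \<partial>Pi\<^sub>M I (\<lambda>_. lborel))
      = (\<integral>\<^sup>+x. ennreal \<bar>\<tau>\<bar> *
          (\<integral>\<^sup>+y. F (\<lambda>j\<in>insert i I. c j + \<tau> * (x(i := y)) j) \<partial>lborel) \<partial>Pi\<^sub>M I (\<lambda>_. lborel))"
  proof (rule nn_integral_cong)
    fix x
    have "(\<lambda>j\<in>I. c j + \<tau> * x j) \<in> space (Pi\<^sub>M I (\<lambda>_. lborel :: real measure))"
      by (simp add: space_PiM)
    then have [measurable]: "(\<lambda>y. F ((\<lambda>j\<in>I. c j + \<tau> * x j)(i := y))) \<in> borel_measurable borel"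
      by measurable
    show "(\<integral>\<^sup>+y. F ((\<lambda>j\<in>I. c j + \<tau> * x j)(i := y)) \<partial>lborel) = ennreal \<bar>\<tau>\<bar> *
          (\<integral>\<^sup>+y. F (\<lambda>j\<in>insert i I. c j + \<tau> * (x(i := y)) j) \<partial>lborel)"
      unfolding upd by (rule nn_integral_real_affine) (use \<tau> in auto)
  qed
  also have "\<dots> = ennreal \<bar>\<tau>\<bar> * (\<integral>\<^sup>+x. \<integral>\<^sup>+y.
      F (\<lambda>j\<in>insert i I. c j + \<tau> * (x(i := y)) j) \<partial>lborel \<partial>Pi\<^sub>M I (\<lambda>_. lborel))"
    using measurable_compose[OF R insert.prems] by (intro nn_integral_cmult) measurable
  also have "(\<integral>\<^sup>+x. \<integral>\<^sup>+y. F (\<lambda>j\<in>insert i I. c j + \<tau> * (x(i := y)) j) \<partial>lborel \<partial>Pi\<^sub>M I (\<lambda>_. lborel))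
      = (\<integral>\<^sup>+f. F (\<lambda>j\<in>insert i I. c j + \<tau> * f j) \<partial>Pi\<^sub>M (insert i I) (\<lambda>_. lborel))"
    using insert measurable_compose[OF R insert.prems]
    by (intro product_nn_integral_insert[symmetric]) auto
  finally show ?case
    by (simp only: card_insert_disjoint[OF insert.hyps] power_Suc ennreal_mult' abs_ge_zero mult_ac)
qed

lemma hyperplane_basis:
  fixes v :: "real ^ 'n"
  shows "pairwise orthogonal (hyperplane_basis v)"
    and "\<And>b. b \<in> hyperplane_basis v \<Longrightarrow> norm b = 1"
    and "span (hyperplane_basis v) = {x. x \<bullet> v = 0}"
    and "finite (hyperplane_basis v)"
proof -
  have "subspace {x. x \<bullet> v = 0}"
    by (auto simp: subspace_def inner_add_left)
  then obtain B where "pairwise orthogonal B" "\<And>x. x \<in> B \<Longrightarrow> norm x = 1"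
      "span B = {x. x \<bullet> v = 0}"
    by (rule orthonormal_basis_subspace) blast
  then have "\<exists>B. pairwise orthogonal B \<and> (\<forall>b\<in>B. norm b = 1) \<and> span B = {x. x \<bullet> v = 0}"
    by blast
  from someI_ex[OF this, folded hyperplane_basis_def]
  show 1: "pairwise orthogonal (hyperplane_basis v)"
    and 2: "\<And>b. b \<in> hyperplane_basis v \<Longrightarrow> norm b = 1"
    and 3: "span (hyperplane_basis v) = {x. x \<bullet> v = 0}"
    by blast+
  show "finite (hyperplane_basis v)"
    using pairwise_orthogonal_imp_finite[OF 1] .
qed

lemma hyperplane_basis_inner:
  fixes v :: "real ^ 'n"
  assumes "b \<in> hyperplane_basis v"
  shows "b \<bullet> v = 0" and "b' \<in> hyperplane_basis v \<Longrightarrow> b' \<bullet> b = (if b' = b then 1 else 0)"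
proof -
  show "b \<bullet> v = 0"
    using span_base[OF assms] by (simp add: hyperplane_basis(3))
  show "b' \<bullet> b = (if b' = b then 1 else 0)" if "b' \<in> hyperplane_basis v"
    using hyperplane_basis(1)[of v] hyperplane_basis(2)[OF assms] assms that
    by (auto simp: pairwise_def orthogonal_def norm_eq_1)
qed

text \<open>The parametrisation of the hyperplane \<open>{x. x \<bullet> v = c}\<close> by orthonormal coordinates.\<close>

definition hyperplane_point :: "real ^ 'n \<Rightarrow> real \<Rightarrow> (real ^ 'n \<Rightarrow> real) \<Rightarrow> real ^ 'n"
  where "hyperplane_point v c t =
    (c / (v \<bullet> v)) *\<^sub>R v + (\<Sum>b\<in>hyperplane_basis v. t b *\<^sub>R b)"

lemma hyperplane_point_inner:
  assumes "v \<noteq> 0"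
  shows "hyperplane_point v c t \<bullet> v = c"
    and "b \<in> hyperplane_basis v \<Longrightarrow> hyperplane_point v c t \<bullet> b = t b"
proof -
  show "hyperplane_point v c t \<bullet> v = c"
    using assms by (simp add: hyperplane_point_def inner_add_left inner_sum_left hyperplane_basis_inner)
  assume b: "b \<in> hyperplane_basis v"
  have "v \<bullet> b = 0" using hyperplane_basis_inner(1)[OF b] by (simp add: inner_commute)
  moreover have "(\<Sum>b'\<in>hyperplane_basis v. t b' * (b' \<bullet> b)) = (\<Sum>b'\<in>hyperplane_basis v. if b' = b then t b' else 0)"
    by (rule sum.cong) (auto simp: hyperplane_basis_inner(2)[OF b])
  ultimately show "hyperplane_point v c t \<bullet> b = t b"
    using b hyperplane_basis(4)[of v]
    by (simp add: hyperplane_point_def inner_add_left inner_sum_left)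
qed

lemma hyperplane_point_expansion:
  fixes v :: "real ^ 'n"
  assumes "v \<noteq> 0"
  shows "hyperplane_point v (x \<bullet> v) (\<lambda>b. x \<bullet> b) = x"
proof -
  let ?y = "hyperplane_point v (x \<bullet> v) (\<lambda>b. x \<bullet> b) - x"
  have 0: "?y \<bullet> v = 0" and 1: "b \<in> hyperplane_basis v \<Longrightarrow> ?y \<bullet> b = 0" for b
    using hyperplane_point_inner[OF assms, where c = "x \<bullet> v" and t = "\<lambda>b. x \<bullet> b"]
    by (simp_all add: inner_diff_left)
  have "?y \<in> span (hyperplane_basis v)" using 0 by (simp add: hyperplane_basis(3))
  then have "orthogonal ?y ?y"
    by (rule orthogonal_to_span) (simp add: 1 orthogonal_def)
  then show ?thesis by (simp add: orthogonal_self)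
qed

lemma hyperplane_point_affine:
  assumes "v \<noteq> 0"
  shows "hyperplane_point v (q \<bullet> v + \<tau> * c) (\<lambda>b\<in>hyperplane_basis v. q \<bullet> b + \<tau> * t b)
    = q + \<tau> *\<^sub>R hyperplane_point v c t"
proof -
  have "hyperplane_point v (q \<bullet> v + \<tau> * c) (\<lambda>b\<in>hyperplane_basis v. q \<bullet> b + \<tau> * t b)
    = hyperplane_point v (q \<bullet> v) (\<lambda>b. q \<bullet> b) + \<tau> *\<^sub>R hyperplane_point v c t"
    by (simp add: hyperplane_point_def scaleR_add_left scaleR_add_right add_divide_distrib
        sum.distrib scaleR_right.sum)
  then show ?thesis by (simp add: hyperplane_point_expansion[OF assms])
qed

lemma hyperplane_point_measurable:
  fixes v :: "real ^ 'n"
  assumes "hyperplane_basis v \<subseteq> I" and c: "c \<in> borel_measurable (Pi\<^sub>M I (\<lambda>_. lborel))"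
  shows "(\<lambda>t. hyperplane_point v (c t) t) \<in> Pi\<^sub>M I (\<lambda>_. lborel :: real measure) \<rightarrow>\<^sub>M borel"
proof -
  have "(\<lambda>t. t b) \<in> borel_measurable (Pi\<^sub>M I (\<lambda>_. lborel :: real measure))"
    if "b \<in> hyperplane_basis v" for b
    using measurable_component_singleton[of b I "\<lambda>_. lborel :: real measure"] that assms by auto
  then show ?thesis
    unfolding hyperplane_point_def using c
    by (intro borel_measurable_add borel_measurable_scaleR borel_measurable_sum) auto
qed

lemma hyperplane_lebesgue_eq:
  "hyperplane_lebesgue v c = distr (Pi\<^sub>M (hyperplane_basis v) (\<lambda>_. lborel)) borel (hyperplane_point v c)"
  by (simp add: hyperplane_lebesgue_def hyperplane_point_def[abs_def])

lemma sets_hyperplane_lebesgue [simp, measurable_cong]: "sets (hyperplane_lebesgue v c) = sets borel"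
  and space_hyperplane_lebesgue [simp]: "space (hyperplane_lebesgue v c) = UNIV"
  by (simp_all add: hyperplane_lebesgue_def)

lemma nn_integral_hyperplane_lebesgue:
  assumes "F \<in> borel_measurable borel"
  shows "(\<integral>\<^sup>+x. F x \<partial>hyperplane_lebesgue v c)
    = (\<integral>\<^sup>+t. F (hyperplane_point v c t) \<partial>Pi\<^sub>M (hyperplane_basis v) (\<lambda>_. lborel))"
  unfolding hyperplane_lebesgue_eq
  by (intro nn_integral_distr hyperplane_point_measurable) (use assms in auto)

lemma nn_integral_hyperplane_affine:
  fixes v q :: "real ^ 'n"
  assumes "v \<noteq> 0" "\<tau> \<noteq> 0" and F: "F \<in> borel_measurable borel"
  shows "(\<integral>\<^sup>+x. F x \<partial>hyperplane_lebesgue v (q \<bullet> v + \<tau> * c)) =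
    ennreal (\<bar>\<tau>\<bar> ^ card (hyperplane_basis v)) * (\<integral>\<^sup>+x. F (q + \<tau> *\<^sub>R x) \<partial>hyperplane_lebesgue v c)"
proof -
  let ?B = "hyperplane_basis v"
  let ?P = "Pi\<^sub>M ?B (\<lambda>_. lborel :: real measure)"
  have "(\<integral>\<^sup>+x. F x \<partial>hyperplane_lebesgue v (q \<bullet> v + \<tau> * c))
    = (\<integral>\<^sup>+t. F (hyperplane_point v (q \<bullet> v + \<tau> * c) t) \<partial>?P)"
    by (rule nn_integral_hyperplane_lebesgue[OF F])
  also have "\<dots> = ennreal (\<bar>\<tau>\<bar> ^ card ?B) *
      (\<integral>\<^sup>+t. F (hyperplane_point v (q \<bullet> v + \<tau> * c) (\<lambda>b\<in>?B. q \<bullet> b + \<tau> * t b)) \<partial>?P)"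
    by (intro nn_integral_PiM_affine measurable_compose[OF _ F] hyperplane_point_measurable)
      (use assms in \<open>auto simp: hyperplane_basis\<close>)
  also have "\<dots> = ennreal (\<bar>\<tau>\<bar> ^ card ?B) * (\<integral>\<^sup>+t. F (q + \<tau> *\<^sub>R hyperplane_point v c t) \<partial>?P)"
    by (simp add: hyperplane_point_affine[OF assms(1)])
  also have "(\<integral>\<^sup>+t. F (q + \<tau> *\<^sub>R hyperplane_point v c t) \<partial>?P)
      = (\<integral>\<^sup>+x. F (q + \<tau> *\<^sub>R x) \<partial>hyperplane_lebesgue v c)"
    by (intro nn_integral_hyperplane_lebesgue[symmetric] measurable_compose[OF _ F]) auto
  finally show ?thesis .
qed

lemma emeasure_hyperplane_lebesgue_bounded:
  fixes v :: "real ^ 'n"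
  assumes "v \<noteq> 0" "bounded A" "A \<in> sets borel"
  shows "emeasure (hyperplane_lebesgue v c) A < \<infinity>"
proof -
  let ?B = "hyperplane_basis v"
  let ?P = "Pi\<^sub>M ?B (\<lambda>_. lborel :: real measure)"
  interpret product_sigma_finite "\<lambda>_::real ^ 'n. lborel :: real measure" by standard
  obtain R where R: "\<And>x. x \<in> A \<Longrightarrow> norm x \<le> R" using assms(2) by (auto simp: bounded_iff)
  have sub: "hyperplane_point v c -` A \<inter> space ?P \<subseteq> Pi\<^sub>E ?B (\<lambda>_. {-R..R})"
  proof
    fix t assume t: "t \<in> hyperplane_point v c -` A \<inter> space ?P"
    have "t b \<in> {-R..R}" if "b \<in> ?B" for b
    proof -
      have "\<bar>t b\<bar> \<le> norm (hyperplane_point v c t) * norm b"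
        using Cauchy_Schwarz_ineq2[of "hyperplane_point v c t" b]
        by (simp add: hyperplane_point_inner[OF assms(1)] that)
      also have "\<dots> \<le> R" using t R that by (simp add: hyperplane_basis(2))
      finally show ?thesis by auto
    qed
    then show "t \<in> Pi\<^sub>E ?B (\<lambda>_. {-R..R})" using t by (auto simp: space_PiM PiE_def)
  qed
  have "emeasure (hyperplane_lebesgue v c) A = emeasure ?P (hyperplane_point v c -` A \<inter> space ?P)"
    unfolding hyperplane_lebesgue_eq
    by (intro emeasure_distr hyperplane_point_measurable) (use assms in auto)
  also have "\<dots> \<le> emeasure ?P (Pi\<^sub>E ?B (\<lambda>_. {-R..R}))"
    using sub by (intro emeasure_mono sets_PiM_I_finite) (auto simp: hyperplane_basis)
  also have "\<dots> = (\<Prod>b\<in>?B. emeasure lborel {-R..R})"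
    by (intro emeasure_PiM) (auto simp: hyperplane_basis)
  also have "\<dots> < \<infinity>"
    by (cases "-R \<le> R") (simp_all add: ennreal_power power_0_left less_top[symmetric])
  finally show ?thesis .
qed

text \<open>
  Integration over the parallel hyperplanes \<open>x \<bullet> v = s\<close> defines a translation invariant
  measure, so it agrees with Lebesgue measure up to a constant.  The value of the constant, and
  the reverse inequality, play no role.
\<close>

lemma nn_integral_lborel_le_slices:
  fixes v :: "real ^ 'n"
  assumes "v \<noteq> 0"
  obtains K :: real where "K > 0"
    "\<And>F :: real ^ 'n \<Rightarrow> ennreal. F \<in> borel_measurable borel \<Longrightarrow>
      (\<integral>\<^sup>+x. F x \<partial>lborel) \<le> ennreal K * (\<integral>\<^sup>+s. \<integral>\<^sup>+x. F x \<partial>hyperplane_lebesgue v s \<partial>lborel)"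
proof -
  let ?B = "hyperplane_basis v"
  let ?E = "insert v ?B"
  define N where "N = Pi\<^sub>M ?E (\<lambda>_. lborel :: real measure)"
  define \<Phi> where "\<Phi> t = hyperplane_point v (t v) t" for t :: "real ^ 'n \<Rightarrow> real"
  interpret product_sigma_finite "\<lambda>_::real ^ 'n. lborel :: real measure" by standard
  interpret N: finite_product_sigma_finite "\<lambda>_::real ^ 'n. lborel :: real measure" ?E
    by standard (simp add: hyperplane_basis)
  interpret sigma_finite_measure N unfolding N_def by (rule sigma_finite) (simp add: hyperplane_basis)
  interpret NL: pair_sigma_finite N "lborel :: (real ^ 'n) measure" ..
  have fin: "finite ?B" by (rule hyperplane_basis)
  have vB: "v \<notin> ?B" using hyperplane_basis_inner(1)[of v v] assms by auto
  have \<Phi>[measurable]: "\<Phi> \<in> N \<rightarrow>\<^sub>M borel"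
    unfolding \<Phi>_def N_def
    by (intro hyperplane_point_measurable) (auto intro!: measurable_compose[OF measurable_component_singleton])
  have slices: "(\<integral>\<^sup>+\<omega>. F (\<Phi> \<omega>) \<partial>N) = (\<integral>\<^sup>+s. \<integral>\<^sup>+x. F x \<partial>hyperplane_lebesgue v s \<partial>lborel)"
    if F[measurable]: "F \<in> borel_measurable borel" for F
  proof -
    have *: "\<Phi> (x(v := y)) = hyperplane_point v y x" for x y
      unfolding \<Phi>_def hyperplane_point_def using vB
      by (auto intro!: sum.cong)
    have "(\<integral>\<^sup>+\<omega>. F (\<Phi> \<omega>) \<partial>N) = (\<integral>\<^sup>+s. \<integral>\<^sup>+x. F (\<Phi> (x(v := s))) \<partial>Pi\<^sub>M ?B (\<lambda>_. lborel) \<partial>lborel)"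
      using \<Phi> unfolding N_def
      by (intro product_nn_integral_insert_rev fin vB measurable_compose[OF _ F])
    then show ?thesis by (simp add: nn_integral_hyperplane_lebesgue[OF F] *)
  qed
  have shift: "(\<integral>\<^sup>+\<omega>. F (\<Phi> \<omega>) \<partial>N) = (\<integral>\<^sup>+\<omega>. F (\<Phi> \<omega> - y) \<partial>N)"
    if F[measurable]: "F \<in> borel_measurable borel" for F y
  proof -
    have *: "\<Phi> (\<lambda>i\<in>?E. - y \<bullet> i + 1 * t i) = \<Phi> t - y" for t
    proof -
      have "\<Phi> (\<lambda>i\<in>?E. - y \<bullet> i + 1 * t i)
          = hyperplane_point v (- y \<bullet> v + 1 * t v) (\<lambda>b\<in>?B. - y \<bullet> b + 1 * t b)"
        unfolding \<Phi>_def hyperplane_point_def by (auto intro!: sum.cong)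
      also have "\<dots> = \<Phi> t - y"
        by (subst hyperplane_point_affine[OF assms]) (simp add: \<Phi>_def)
      finally show ?thesis .
    qed
    have "(\<integral>\<^sup>+\<omega>. F (\<Phi> \<omega>) \<partial>N) = ennreal (\<bar>1\<bar> ^ card ?E) * (\<integral>\<^sup>+\<omega>. F (\<Phi> (\<lambda>i\<in>?E. - y \<bullet> i + 1 * \<omega> i)) \<partial>N)"
      unfolding N_def
      by (intro nn_integral_PiM_affine measurable_compose[OF _ F] \<Phi>[unfolded N_def]) (auto simp: fin)
    then show ?thesis unfolding * by simp
  qed
  define Q :: "(real ^ 'n) set" where "Q = cbox 0 One"
  have Q[measurable]: "Q \<in> sets borel" by (simp add: Q_def)
  have Q1: "emeasure lborel Q = 1"
    unfolding Q_def by (subst emeasure_lborel_cbox) auto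
  define K where "K = (\<integral>\<^sup>+\<omega>. indicator Q (\<Phi> \<omega>) \<partial>N)"
  \<comment> \<open>Uniqueness of invariant measures: in the double integral of \<open>F (\<Phi> \<omega>) * indicator Q y\<close>, first
    \<open>y\<close> and then \<open>\<Phi> \<omega>\<close> is translated by the other variable.\<close>
  have main: "(\<integral>\<^sup>+\<omega>. F (\<Phi> \<omega>) \<partial>N) = K * (\<integral>\<^sup>+x. F x \<partial>lborel)"
    if F[measurable]: "F \<in> borel_measurable borel" for F
  proof -
    have t1: "(\<integral>\<^sup>+y. G y \<partial>lborel) = (\<integral>\<^sup>+y. G (y + x) \<partial>lborel)"
      if [measurable]: "G \<in> borel_measurable borel" for G :: "real ^ 'n \<Rightarrow> ennreal" and x
      by (subst lborel_distr_plus[of x, symmetric]) (simp add: nn_integral_distr add.commute)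
    have t2: "(\<integral>\<^sup>+y. F (x - y) \<partial>lborel) = (\<integral>\<^sup>+y. F y \<partial>lborel)" for x
      by (subst (2) lborel_affine[of "-1" x]) (auto simp: nn_integral_distr nn_integral_density)
    have "(\<integral>\<^sup>+\<omega>. F (\<Phi> \<omega>) \<partial>N) = (\<integral>\<^sup>+\<omega>. F (\<Phi> \<omega>) * (\<integral>\<^sup>+y. indicator Q y \<partial>lborel) \<partial>N)"
      by (simp add: Q1)
    also have "\<dots> = (\<integral>\<^sup>+\<omega>. \<integral>\<^sup>+y. F (\<Phi> \<omega>) * indicator Q (y + \<Phi> \<omega>) \<partial>lborel \<partial>N)"
    proof (rule nn_integral_cong)
      fix \<omega>
      show "F (\<Phi> \<omega>) * (\<integral>\<^sup>+y. indicator Q y \<partial>lborel)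
          = (\<integral>\<^sup>+y. F (\<Phi> \<omega>) * indicator Q (y + \<Phi> \<omega>) \<partial>lborel)"
        by (subst t1[of "indicator Q" "\<Phi> \<omega>"]) (auto simp: nn_integral_cmult)
    qed
    also have "\<dots> = (\<integral>\<^sup>+y. \<integral>\<^sup>+\<omega>. F (\<Phi> \<omega>) * indicator Q (y + \<Phi> \<omega>) \<partial>N \<partial>lborel)"
      by (rule NL.Fubini'[symmetric]) measurable
    also have "\<dots> = (\<integral>\<^sup>+y. \<integral>\<^sup>+\<omega>. F (\<Phi> \<omega> - y) * indicator Q (\<Phi> \<omega>) \<partial>N \<partial>lborel)"
    proof (rule nn_integral_cong)
      fix y :: "real ^ 'n"
      have "(\<lambda>x. F x * indicator Q (y + x)) \<in> borel_measurable borel" by measurable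
      from shift[OF this, of y]
      show "(\<integral>\<^sup>+\<omega>. F (\<Phi> \<omega>) * indicator Q (y + \<Phi> \<omega>) \<partial>N)
          = (\<integral>\<^sup>+\<omega>. F (\<Phi> \<omega> - y) * indicator Q (\<Phi> \<omega>) \<partial>N)" by simp
    qed
    also have "\<dots> = (\<integral>\<^sup>+\<omega>. \<integral>\<^sup>+y. F (\<Phi> \<omega> - y) * indicator Q (\<Phi> \<omega>) \<partial>lborel \<partial>N)"
      by (rule NL.Fubini') measurable
    also have "\<dots> = (\<integral>\<^sup>+\<omega>. (\<integral>\<^sup>+y. F y \<partial>lborel) * indicator Q (\<Phi> \<omega>) \<partial>N)"
      by (simp add: nn_integral_multc t2)
    also have "\<dots> = K * (\<integral>\<^sup>+x. F x \<partial>lborel)"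
      by (simp add: nn_integral_cmult K_def mult.commute)
    finally show ?thesis .
  qed
  have "K \<noteq> 0"
  proof
    assume "K = 0"
    then have "emeasure N (space N) = 0" using main[of "\<lambda>_. 1"] by simp
    moreover have "emeasure N (space N) = (\<Prod>b\<in>?E. emeasure lborel (UNIV :: real set))"
      unfolding N_def space_PiM by (subst emeasure_PiM) (auto simp: fin)
    ultimately show False by (auto simp: fin)
  qed
  \<comment> \<open>Taking the minimum with \<open>1\<close> makes it unnecessary to show that \<open>K\<close> is finite.\<close>
  define k where "k = enn2real (min K 1)"
  have k: "ennreal k = min K 1" unfolding k_def
    by (rule ennreal_enn2real) (simp add: min_less_iff_disj)
  have "k > 0" using k \<open>K \<noteq> 0\<close> by (metis ennreal_eq_0_iff linorder_not_le min_def zero_neq_one)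
  show thesis
  proof
    show "1 / k > 0" using \<open>k > 0\<close> by simp
    fix F :: "real ^ 'n \<Rightarrow> ennreal" assume F: "F \<in> borel_measurable borel"
    have "(\<integral>\<^sup>+x. F x \<partial>lborel) = ennreal (1 / k) * ennreal k * (\<integral>\<^sup>+x. F x \<partial>lborel)"
      using \<open>k > 0\<close> by (simp flip: ennreal_mult')
    also have "\<dots> \<le> ennreal (1 / k) * (K * (\<integral>\<^sup>+x. F x \<partial>lborel))"
      unfolding k mult.assoc by (intro mult_left_mono mult_right_mono) auto
    finally show "(\<integral>\<^sup>+x. F x \<partial>lborel)
        \<le> ennreal (1 / k) * (\<integral>\<^sup>+s. \<integral>\<^sup>+x. F x \<partial>hyperplane_lebesgue v s \<partial>lborel)"
      by (simp add: main[OF F, symmetric] slices[OF F])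
  qed
qed

section \<open>Geometry of the polytope\<close>

lemma lfun_combine:
  assumes "\<alpha> + \<beta> = 1"
  shows "lfun a lam i (\<alpha> *\<^sub>R x + \<beta> *\<^sub>R y) = \<alpha> * lfun a lam i x + \<beta> * lfun a lam i y"
proof -
  have "(\<alpha> + \<beta>) * real_of_int (lam i) = real_of_int (lam i)" using assms by simp
  then show ?thesis by (simp add: lfun_def inner_add_left algebra_simps)
qed

lemma continuous_on_lfun: "continuous_on S (lfun a lam i)"
  unfolding lfun_def[abs_def] by (intro continuous_intros)

lemma lfun_measurable [measurable]: "lfun a lam i \<in> borel_measurable borel"
  by (rule borel_measurable_continuous_onI[OF continuous_on_lfun])

lemma borel_rel_interior:
  fixes S :: "'a :: euclidean_space set"
  shows "rel_interior S \<in> sets borel"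
proof -
  have "openin (top_of_set (affine hull S)) (rel_interior S)" by (rule openin_rel_interior)
  then obtain T where "open T" "rel_interior S = affine hull S \<inter> T"
    by (auto simp: openin_open)
  then show ?thesis
    using closed_affine_hull[of S] by (auto intro!: sets.Int borel_closed)
qed

text \<open>
  A bounded, full-dimensional polytope given by inequalities with integral coefficients, each of
  which defines a facet.
\<close>

locale lattice_polytope =
  fixes d :: nat and a :: "nat \<Rightarrow> int ^ 'n" and lam :: "nat \<Rightarrow> int"
  assumes nonempty: "polyt d a lam \<noteq> {}"
    and bounded_polyt: "bounded (polyt d a lam)"
    and normal_nonzero: "\<And>i. i \<in> {1..d} \<Longrightarrow> real_vec (a i) \<noteq> 0"
    and facet_of_closure:
      "\<And>i. i \<in> {1..d} \<Longrightarrow> facet d a lam i facet_of closure (polyt d a lam)"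
begin

abbreviation \<Delta> where "\<Delta> \<equiv> polyt d a lam"
abbreviation \<Delta>s where "\<Delta>s \<equiv> polyt_star d a lam"
abbreviation l where "l i \<equiv> lfun a lam i"
abbreviation fct where "fct i \<equiv> facet d a lam i"
abbreviation rfct where "rfct i \<equiv> rel_interior (facet d a lam i)"
abbreviation \<sigma> where "\<sigma> i \<equiv> facet_measure a lam i"

lemma polytD: "x \<in> \<Delta> \<Longrightarrow> i \<in> {1..d} \<Longrightarrow> 0 < l i x"
  by (simp add: polyt_def)

lemma open_polyt: "open \<Delta>"
proof -
  have "\<Delta> = (\<Inter>i\<in>{1..d}. {x. 0 < l i x})" by (auto simp: polyt_def)
  also have "open \<dots>"
    by (intro open_INT ballI open_Collect_less continuous_on_lfun continuous_intros) auto
  finally show ?thesis .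
qed

lemma convex_polyt: "convex \<Delta>"
proof -
  have "\<Delta> = (\<Inter>i\<in>{1..d}. {x. real_vec (a i) \<bullet> x > real_of_int (lam i)})"
    by (auto simp: polyt_def lfun_def inner_commute)
  also have "convex \<dots>" by (intro convex_INT convex_halfspace_gt)
  finally show ?thesis .
qed

lemma closure_nonneg: "x \<in> closure \<Delta> \<Longrightarrow> i \<in> {1..d} \<Longrightarrow> 0 \<le> l i x"
proof -
  assume x: "x \<in> closure \<Delta>" and i: "i \<in> {1..d}"
  have "closed {x. 0 \<le> l i x}"
    by (intro closed_Collect_le continuous_on_lfun continuous_intros)
  moreover have "\<Delta> \<subseteq> {x. 0 \<le> l i x}" using i by (auto simp: polyt_def less_imp_le)
  ultimately have "closure \<Delta> \<subseteq> {x. 0 \<le> l i x}" by (rule closure_minimal[rotated])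
  then show ?thesis using x by auto
qed

lemma combine_in_polyt:
  assumes "p \<in> \<Delta>" "z \<in> closure \<Delta>" "0 < \<alpha>" "0 \<le> \<beta>" "\<alpha> + \<beta> = 1"
  shows "\<alpha> *\<^sub>R p + \<beta> *\<^sub>R z \<in> \<Delta>"
proof -
  have "0 < l i (\<alpha> *\<^sub>R p + \<beta> *\<^sub>R z)" if i: "i \<in> {1..d}" for i
    unfolding lfun_combine[OF assms(5)]
    using polytD[OF assms(1) i] closure_nonneg[OF assms(2) i] assms(3,4)
    by (intro add_pos_nonneg mult_pos_pos mult_nonneg_nonneg)
  then show ?thesis by (simp add: polyt_def)
qed

lemma compact_closure_polyt: "compact (closure \<Delta>)"
  using bounded_polyt by (simp add: compact_closure)

lemma convex_closure_polyt: "convex (closure \<Delta>)"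
  by (rule convex_closure[OF convex_polyt])

lemma facet_subset: "fct i \<subseteq> closure \<Delta>"
  and facet_level: "z \<in> fct i \<Longrightarrow> l i z = 0"
  by (auto simp: facet_def)

lemma rfct_subset: "rfct i \<subseteq> fct i"
  by (rule rel_interior_subset)

lemma closed_facet: "closed (fct i)"
  unfolding facet_def
  by (intro closed_Int closed_closure closed_Collect_eq continuous_on_lfun continuous_intros)

lemma bounded_facet: "bounded (fct i)"
  using bounded_subset[OF compact_imp_bounded[OF compact_closure_polyt] facet_subset] .

lemma facet_props:
  assumes "i \<in> {1..d}"
  shows "fct i face_of closure \<Delta>" "fct i \<noteq> {}" "aff_dim (fct i) = aff_dim (closure \<Delta>) - 1"
    "convex (fct i)" "rfct i \<noteq> {}"
proof -
  show *: "fct i face_of closure \<Delta>" "fct i \<noteq> {}" "aff_dim (fct i) = aff_dim (closure \<Delta>) - 1"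
    using facet_of_closure[OF assms] by (auto simp: facet_of_def)
  show c: "convex (fct i)" using *(1) by (rule face_of_imp_convex)
  show "rfct i \<noteq> {}" using rel_interior_eq_empty[OF c] *(2) by simp
qed

lemma polyt_subset_star: "\<Delta> \<subseteq> \<Delta>s"
  and rfct_subset_star: "i \<in> {1..d} \<Longrightarrow> rfct i \<subseteq> \<Delta>s"
  by (auto simp: polyt_star_def)

lemma rfct_in_star: "i \<in> {1..d} \<Longrightarrow> x \<in> rfct i \<Longrightarrow> x \<in> \<Delta>s"
  using rfct_subset_star by blast

lemma star_subset_closure: "\<Delta>s \<subseteq> closure \<Delta>"
  unfolding polyt_star_def using closure_subset[of \<Delta>] facet_subset rfct_subset by blast

lemma borel_sets [measurable]:
  "\<Delta> \<in> sets borel" "fct i \<in> sets borel" "rfct i \<in> sets borel" "\<Delta>s \<in> sets borel"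
proof -
  show 1: "\<Delta> \<in> sets borel" "fct i \<in> sets borel" "rfct i \<in> sets borel" for i
    using open_polyt closed_facet by (simp_all add: borel_open borel_closed borel_rel_interior)
  show "\<Delta>s \<in> sets borel"
    unfolding polyt_star_def by (intro sets.Un sets.finite_UN 1) auto
qed

text \<open>A point in the relative interior of a facet lies on no other facet.\<close>

lemma facet_unique:
  assumes i: "i \<in> {1..d}" and k: "k \<in> {1..d}" and x: "x \<in> rfct i" "l k x = 0"
  shows "fct i = fct k"
proof (rule ccontr)
  assume ne: "fct i \<noteq> fct k"
  have "x \<in> closure \<Delta>" using x(1) rfct_subset[of i] facet_subset[of i] by blast
  then have "x \<in> fct k" using x(2) by (simp add: facet_def)
  then have "fct i \<subseteq> fct k"
    using x(1) by (intro subset_of_face_of[OF facet_props(1)[OF k] facet_subset]) blast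
  then have "fct i face_of fct k"
    by (rule face_of_subset[OF facet_props(1)[OF i] _ facet_subset])
  from face_of_aff_dim_lt[OF facet_props(4)[OF k] this ne]
  show False using facet_props(3)[OF i] facet_props(3)[OF k] by simp
qed

lemma convex_star: "convex \<Delta>s"
proof (rule convexI)
  fix x y and u v :: real
  assume x: "x \<in> \<Delta>s" and y: "y \<in> \<Delta>s" and uv: "0 \<le> u" "0 \<le> v" "u + v = 1"
  show "u *\<^sub>R x + v *\<^sub>R y \<in> \<Delta>s"
  proof (cases "u = 0 \<or> v = 0")
    case True
    then show ?thesis using x y uv by auto
  next
    case False
    with uv have pos: "0 < u" "0 < v" by auto
    let ?z = "u *\<^sub>R x + v *\<^sub>R y"
    have cl: "x \<in> closure \<Delta>" "y \<in> closure \<Delta>" using x y star_subset_closure by auto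
    show ?thesis
    proof (cases "?z \<in> \<Delta>")
      case True
      then show ?thesis using polyt_subset_star by auto
    next
      case False
      then obtain k where k: "k \<in> {1..d}" "l k ?z \<le> 0" by (auto simp: polyt_def not_less)
      have "0 \<le> l k x" "0 \<le> l k y" using closure_nonneg k(1) cl by auto
      then have "0 \<le> u * l k x" "0 \<le> v * l k y" using pos by auto
      moreover have "u * l k x + v * l k y \<le> 0" using k(2) lfun_combine[OF uv(3)] by metis
      ultimately have "u * l k x = 0" "v * l k y = 0" by linarith+
      then have 0: "l k x = 0" "l k y = 0" using pos by simp_all
      then have "x \<notin> \<Delta>" "y \<notin> \<Delta>"
        using polytD[OF _ k(1), of x] polytD[OF _ k(1), of y] by auto
      then obtain i j where ij: "i \<in> {1..d}" "x \<in> rfct i" "j \<in> {1..d}" "y \<in> rfct j"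
        using x y by (auto simp: polyt_star_def)
      have "fct i = fct k" "fct j = fct k"
        by (rule facet_unique[OF ij(1) k(1) ij(2) 0(1)], rule facet_unique[OF ij(3) k(1) ij(4) 0(2)])
      then have "x \<in> rfct k" "y \<in> rfct k" using ij by auto
      then have "?z \<in> rfct k"
        using uv by (intro convexD[OF convex_rel_interior[OF facet_props(4)[OF k(1)]]])
      then show ?thesis by (rule subsetD[OF rfct_subset_star[OF k(1)]])
    qed
  qed
qed

lemma exists_boundary_point:
  assumes p: "p \<in> \<Delta>" and x: "x \<in> \<Delta>" "x \<noteq> p"
  obtains i z \<tau> where "i \<in> {1..d}" "z \<in> fct i" "0 < \<tau>" "\<tau> < 1" "x = (1 - \<tau>) *\<^sub>R p + \<tau> *\<^sub>R z"
proof -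
  have "p \<in> interior \<Delta>" using p open_polyt by (simp add: interior_open)
  then obtain D where D: "0 < D" "p + D *\<^sub>R (x - p) \<in> frontier \<Delta>"
    using ray_to_frontier[OF bounded_polyt, of p "x - p"] x(2) by (metis right_minus_eq)
  define z where "z = p + D *\<^sub>R (x - p)"
  have z: "z \<in> closure \<Delta>" "z \<notin> \<Delta>"
    using D open_polyt by (auto simp: z_def frontier_def interior_open)
  have "1 < D"
  proof (rule ccontr)
    assume "\<not> 1 < D"
    then have "(1 - D) *\<^sub>R p + D *\<^sub>R x \<in> \<Delta>"
      using D(1) by (intro convexD_alt[OF convex_polyt p x(1)]) auto
    moreover have "(1 - D) *\<^sub>R p + D *\<^sub>R x = z" by (simp add: z_def algebra_simps)
    ultimately show False using z by simp
  qed
  from z(2) obtain i where i: "i \<in> {1..d}" "l i z \<le> 0" by (auto simp: polyt_def not_less)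
  then have "z \<in> fct i" using closure_nonneg[OF z(1) i(1)] z by (auto simp: facet_def)
  moreover have "x = (1 - 1 / D) *\<^sub>R p + (1 / D) *\<^sub>R z"
    using \<open>1 < D\<close> by (simp add: z_def scaleR_add_right scaleR_diff_left scaleR_diff_right)
  ultimately show ?thesis
    using i(1) \<open>1 < D\<close> by (intro that[of i z "1 / D"]) simp_all
qed

section \<open>The boundary measure\<close>

lemma sets_facet_measure [simp, measurable_cong]: "sets (\<sigma> i) = sets borel"
  and space_facet_measure [simp]: "space (\<sigma> i) = UNIV"
  by (simp_all add: facet_measure_def space_scale_measure)

lemma nn_integral_facet_measure:
  assumes "F \<in> borel_measurable borel"
  shows "(\<integral>\<^sup>+x. F x \<partial>\<sigma> i) = ennreal (1 / norm (real_vec (a i))) *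
    (\<integral>\<^sup>+x. F x \<partial>hyperplane_lebesgue (real_vec (a i)) (real_of_int (lam i)))"
  unfolding facet_measure_def
proof (rule nn_integral_scale_measure)
  show "F \<in> borel_measurable (hyperplane_lebesgue (real_vec (a i)) (real_of_int (lam i)))"
    using assms by (subst measurable_cong_sets[OF sets_hyperplane_lebesgue refl])
qed

lemma emeasure_facet_finite:
  assumes "i \<in> {1..d}"
  shows "emeasure (\<sigma> i) (fct i) < \<infinity>"
proof -
  have "emeasure (hyperplane_lebesgue (real_vec (a i)) (real_of_int (lam i))) (fct i) < \<infinity>"
    by (rule emeasure_hyperplane_lebesgue_bounded[OF normal_nonzero[OF assms] bounded_facet borel_sets(2)])
  then show ?thesis
    unfolding facet_measure_def emeasure_scale_measure by (simp add: ennreal_mult_less_top)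
qed

lemma AE_hyperplane_level:
  assumes "v \<noteq> 0"
  shows "AE x in hyperplane_lebesgue v c. x \<bullet> v = c"
  unfolding hyperplane_lebesgue_eq
proof (subst AE_distr_iff)
  show "hyperplane_point v c \<in> Pi\<^sub>M (hyperplane_basis v) (\<lambda>_. lborel) \<rightarrow>\<^sub>M borel"
    by (rule hyperplane_point_measurable) simp_all
  have "closed {x. x \<bullet> v = c}" by (intro closed_Collect_eq continuous_intros)
  then show "{x \<in> space borel. x \<bullet> v = c} \<in> sets borel" by (simp add: borel_closed)
qed (simp add: hyperplane_point_inner[OF assms])

text \<open>
  Shrinking a facet towards a point of its relative interior maps it into the relative interior,
  so the latter carries all of the mass.
\<close>

lemma null_relative_boundary:
  assumes i: "i \<in> {1..d}"
  shows "emeasure (hyperplane_lebesgue (real_vec (a i)) (real_of_int (lam i))) (fct i - rfct i) = 0"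
proof -
  let ?v = "real_vec (a i)" and ?c = "real_of_int (lam i)"
  let ?H = "hyperplane_lebesgue ?v ?c"
  let ?k = "card (hyperplane_basis ?v)"
  note v = normal_nonzero[OF i]
  obtain q where q: "q \<in> rfct i" using facet_props(5)[OF i] by auto
  have "l i q = 0" using q rfct_subset facet_level by blast
  then have qv: "q \<bullet> ?v = ?c" by (simp add: lfun_def)
  have fin: "emeasure ?H (fct i) < \<infinity>"
    by (rule emeasure_hyperplane_lebesgue_bounded[OF v bounded_facet borel_sets(2)])
  have fin': "emeasure ?H (rfct i) < \<infinity>"
    by (rule le_less_trans[OF emeasure_mono fin]) (auto simp: rfct_subset)
  have scale: "\<tau> ^ ?k * measure ?H (fct i) \<le> measure ?H (rfct i)" if \<tau>: "0 < \<tau>" "\<tau> < 1" for \<tau>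
  proof -
    have "(1 - \<tau>) *\<^sub>R q + \<tau> *\<^sub>R x \<in> rfct i" if "x \<in> fct i" for x
      using rel_interior_convex_shrink[OF facet_props(4)[OF i] q that, of "1 - \<tau>"] \<tau>
      by (simp add: algebra_simps)
    then have le: "indicator (fct i) x \<le> (indicator (rfct i) ((1 - \<tau>) *\<^sub>R q + \<tau> *\<^sub>R x) :: ennreal)" for x
      by (auto simp: indicator_def)
    have "ennreal (\<tau> ^ ?k) * emeasure ?H (fct i) = ennreal (\<bar>\<tau>\<bar> ^ ?k) * (\<integral>\<^sup>+x. indicator (fct i) x \<partial>?H)"
      using \<tau> by simp
    also have "\<dots> \<le> ennreal (\<bar>\<tau>\<bar> ^ ?k) *
        (\<integral>\<^sup>+x. indicator (rfct i) ((1 - \<tau>) *\<^sub>R q + \<tau> *\<^sub>R x) \<partial>?H)"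
      by (intro mult_left_mono nn_integral_mono le) simp
    also have "\<dots> = (\<integral>\<^sup>+x. indicator (rfct i) x
        \<partial>hyperplane_lebesgue ?v (((1 - \<tau>) *\<^sub>R q) \<bullet> ?v + \<tau> * ?c))"
      using v \<tau> by (intro nn_integral_hyperplane_affine[symmetric]) auto
    also have "((1 - \<tau>) *\<^sub>R q) \<bullet> ?v + \<tau> * ?c = ?c" by (simp add: qv algebra_simps)
    finally have "ennreal (\<tau> ^ ?k) * emeasure ?H (fct i) \<le> emeasure ?H (rfct i)" by simp
    then show ?thesis using fin fin' \<tau>
      by (simp add: emeasure_eq_ennreal_measure less_top[symmetric] flip: ennreal_mult)
  qed
  have "((\<lambda>\<tau>. \<tau> ^ ?k * measure ?H (fct i)) \<longlongrightarrow> 1 ^ ?k * measure ?H (fct i)) (at_left 1)"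
    by (intro tendsto_intros)
  then have "1 ^ ?k * measure ?H (fct i) \<le> measure ?H (rfct i)"
  proof (rule tendsto_upperbound)
    show "\<forall>\<^sub>F \<tau> in at_left 1. \<tau> ^ ?k * measure ?H (fct i) \<le> measure ?H (rfct i)"
      using eventually_at_left_real[of 0 "1::real"] by (auto elim!: eventually_mono intro: scale)
  qed simp
  then have "emeasure ?H (fct i) \<le> emeasure ?H (rfct i)"
    using fin fin' by (simp add: emeasure_eq_ennreal_measure less_top[symmetric])
  moreover have "emeasure ?H (fct i - rfct i) = emeasure ?H (fct i) - emeasure ?H (rfct i)"
    using fin' rfct_subset by (intro emeasure_Diff) (auto simp: less_top)
  ultimately show ?thesis using fin by (simp add: diff_eq_0_iff_ennreal)
qed

lemma measure_rfct: "i \<in> {1..d} \<Longrightarrow> measure (\<sigma> i) (rfct i) = measure (\<sigma> i) (fct i)"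
proof -
  assume i: "i \<in> {1..d}"
  have "emeasure (\<sigma> i) (fct i - rfct i) = 0"
    using null_relative_boundary[OF i] by (simp add: facet_measure_def)
  then have "emeasure (\<sigma> i) (fct i) = emeasure (\<sigma> i) (rfct i)"
    using emeasure_Diff_null_set[of "fct i - rfct i" "\<sigma> i" "fct i"] rfct_subset[of i]
    by (auto simp: null_sets_def double_diff)
  then show ?thesis by (simp add: measure_def)
qed

text \<open>
  The Borel functions that vanish outside a layer of relative thickness \<open>\<delta>\<close> at the boundary, and whose
  value at a boundary point bounds the values on the segment from \<open>p\<close> to it.
\<close>

definition layer_function :: "real ^ 'n \<Rightarrow> real \<Rightarrow> (real ^ 'n \<Rightarrow> ennreal) \<Rightarrow> bool"
  where "layer_function p \<delta> g \<longleftrightarrow> g \<in> borel_measurable borel \<and>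
    (\<forall>i\<in>{1..d}. \<forall>z\<in>rfct i. \<forall>\<tau>. 0 < \<tau> \<longrightarrow> \<tau> < 1 \<longrightarrow>
      g ((1 - \<tau>) *\<^sub>R p + \<tau> *\<^sub>R z) \<le> (if 1 - \<delta> < \<tau> then g z else 0))"

text \<open>The cone over each facet is sliced by hyperplanes parallel to the facet.\<close>

lemma boundary_layer_estimate:
  assumes p: "p \<in> \<Delta>"
  obtains C :: real where "C > 0"
    "\<And>\<delta> g. 0 < \<delta> \<Longrightarrow> \<delta> \<le> 1 \<Longrightarrow> layer_function p \<delta> g \<Longrightarrow>
      (\<integral>\<^sup>+x\<in>\<Delta>. g x \<partial>lborel) \<le> ennreal (C * \<delta>) * (\<Sum>i\<in>{1..d}. \<integral>\<^sup>+z\<in>rfct i. g z \<partial>\<sigma> i)"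
proof -
  let ?v = "\<lambda>i. real_vec (a i)" and ?c = "\<lambda>i. real_of_int (lam i)"
  let ?H = "\<lambda>i. hyperplane_lebesgue (?v i) (?c i)"
  \<comment> \<open>The point \<open>(1 - \<tau>) p + \<tau> z\<close>, for \<open>z\<close> on the \<open>i\<close>-th facet, is at level \<open>(1 - \<tau>) h i\<close>.\<close>
  define h where "h i = l i p" for i
  have h: "0 < h i" if "i \<in> {1..d}" for i using polytD[OF p that] by (simp add: h_def)
  have "\<exists>K>0. \<forall>F :: real ^ 'n \<Rightarrow> ennreal. F \<in> borel_measurable borel \<longrightarrow>
      (\<integral>\<^sup>+x. F x \<partial>lborel) \<le> ennreal K * (\<integral>\<^sup>+s. \<integral>\<^sup>+x. F x \<partial>hyperplane_lebesgue (?v i) s \<partial>lborel)"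
    if "i \<in> {1..d}" for i
    using nn_integral_lborel_le_slices[OF normal_nonzero[OF that]] by metis
  then obtain K where K: "\<And>i. i \<in> {1..d} \<Longrightarrow> K i > (0::real)"
    "\<And>i F. i \<in> {1..d} \<Longrightarrow> F \<in> borel_measurable borel \<Longrightarrow> (\<integral>\<^sup>+x. F x \<partial>lborel)
      \<le> ennreal (K i) * (\<integral>\<^sup>+s. \<integral>\<^sup>+x. F x \<partial>hyperplane_lebesgue (?v i) s \<partial>lborel)"
    by metis
  define C where "C = 1 + (\<Sum>i\<in>{1..d}. K i * h i * norm (?v i))"
  have Cnn: "0 \<le> K i * h i * norm (?v i)" if "i \<in> {1..d}" for i
    using K(1)[OF that] h[OF that] by simp
  have C: "C > 0" "\<And>i. i \<in> {1..d} \<Longrightarrow> K i * h i * norm (?v i) \<le> C"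
  proof -
    show "C > 0" unfolding C_def by (intro add_pos_nonneg sum_nonneg Cnn) auto
    show "K i * h i * norm (?v i) \<le> C" if "i \<in> {1..d}" for i
      using member_le_sum[OF that Cnn] unfolding C_def by force
  qed
  show thesis
  proof (rule that[OF C(1)])
    fix \<delta> :: real and g :: "real ^ 'n \<Rightarrow> ennreal"
    assume \<delta>: "0 < \<delta>" "\<delta> \<le> 1" and layer: "layer_function p \<delta> g"
    have g[measurable]: "g \<in> borel_measurable borel"
      using layer by (simp add: layer_function_def)
    have mono: "g ((1 - \<tau>) *\<^sub>R p + \<tau> *\<^sub>R z) \<le> (if 1 - \<delta> < \<tau> then g z else 0)"
      if "i \<in> {1..d}" "z \<in> rfct i" "0 < \<tau>" "\<tau> < 1" for i z \<tau>
      using layer that unfolding layer_function_def by blast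
    define T where "T i x = 1 - l i x / h i" for i x
    define cone where "cone i = {x. 0 < T i x \<and> T i x < 1 \<and> p + (1 / T i x) *\<^sub>R (x - p) \<in> fct i}" for i
    have T[measurable]: "T i \<in> borel_measurable borel" for i unfolding T_def[abs_def] by measurable
    have cone[measurable]: "cone i \<in> sets borel" for i
    proof -
      have "(\<lambda>x. p + (1 / T i x) *\<^sub>R (x - p)) \<in> borel_measurable borel" by measurable
      then show ?thesis unfolding cone_def by measurable
    qed
    have T_ray: "T i ((1 - \<tau>) *\<^sub>R p + \<tau> *\<^sub>R z) = \<tau>" if "i \<in> {1..d}" "l i z = 0" for i z \<tau>
      using h[OF that(1)] that(2) unfolding T_def by (subst lfun_combine) (auto simp: h_def)
    have ray_end: "p + (1 / \<tau>) *\<^sub>R (((1 - \<tau>) *\<^sub>R p + \<tau> *\<^sub>R z) - p) = z" if "\<tau> \<noteq> 0" for z and \<tau> :: real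
      using that by (simp add: scaleR_add_right scaleR_diff_left scaleR_diff_right)
    have slice: "(\<integral>\<^sup>+x\<in>cone i. g x \<partial>lborel) \<le> ennreal (C * \<delta>) * (\<integral>\<^sup>+z\<in>rfct i. g z \<partial>\<sigma> i)"
      if i: "i \<in> {1..d}" for i
    proof -
      note v = normal_nonzero[OF i]
      define G where "G = (\<integral>\<^sup>+z\<in>rfct i. g z \<partial>?H i)"
      define F where "F x = g x * indicator (cone i) x" for x
      have F[measurable]: "F \<in> borel_measurable borel" unfolding F_def by measurable
      have le: "(\<integral>\<^sup>+x. F x \<partial>hyperplane_lebesgue (?v i) s)
          \<le> G * indicator {?c i<..<?c i + \<delta> * h i} s" for s
      proof -
        define \<tau> where "\<tau> = 1 - (s - ?c i) / h i"
        have s: "s = ((1 - \<tau>) *\<^sub>R p) \<bullet> ?v i + \<tau> * ?c i"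
        proof -
          have "p \<bullet> ?v i = h i + ?c i" by (simp add: h_def lfun_def)
          then show ?thesis using h[OF i] by (simp add: \<tau>_def field_simps)
        qed
        show ?thesis
        proof (cases "0 < \<tau> \<and> \<tau> < 1")
          case False
          have "AE x in hyperplane_lebesgue (?v i) s. F x = 0"
            using AE_hyperplane_level[OF v, of s]
          proof eventually_elim
            fix x assume "x \<bullet> ?v i = s"
            then have "T i x = \<tau>" by (simp add: T_def \<tau>_def lfun_def)
            then show "F x = 0" using False by (auto simp: F_def cone_def)
          qed
          then have "(\<integral>\<^sup>+x. F x \<partial>hyperplane_lebesgue (?v i) s) = 0"
            by (subst nn_integral_0_iff_AE) auto
          then show ?thesis by simp
        next
          case True
          have "(\<integral>\<^sup>+x. F x \<partial>hyperplane_lebesgue (?v i) s) =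
              ennreal (\<bar>\<tau>\<bar> ^ card (hyperplane_basis (?v i))) *
                (\<integral>\<^sup>+z. F ((1 - \<tau>) *\<^sub>R p + \<tau> *\<^sub>R z) \<partial>?H i)"
            unfolding s by (rule nn_integral_hyperplane_affine) (use v True in auto)
          also have "\<dots> \<le> 1 * (\<integral>\<^sup>+z. F ((1 - \<tau>) *\<^sub>R p + \<tau> *\<^sub>R z) \<partial>?H i)"
            using True by (intro mult_right_mono) (auto simp: power_le_one)
          also have "\<dots> \<le> 1 * (\<integral>\<^sup>+z. (g z * indicator (rfct i) z) * indicator {1 - \<delta><..} \<tau> \<partial>?H i)"
          proof (intro mult_left_mono nn_integral_mono_AE)
            have "AE z in ?H i. z \<notin> fct i - rfct i"
              using null_relative_boundary[OF i] by (intro AE_not_in) (auto simp: null_sets_def)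
            with AE_hyperplane_level[OF v, of "?c i"]
            show "AE z in ?H i. F ((1 - \<tau>) *\<^sub>R p + \<tau> *\<^sub>R z)
                \<le> (g z * indicator (rfct i) z) * indicator {1 - \<delta><..} \<tau>"
            proof eventually_elim
              fix z assume z: "z \<bullet> ?v i = ?c i" "z \<notin> fct i - rfct i"
              then have "T i ((1 - \<tau>) *\<^sub>R p + \<tau> *\<^sub>R z) = \<tau>"
                by (intro T_ray i) (simp add: lfun_def)
              then have "(1 - \<tau>) *\<^sub>R p + \<tau> *\<^sub>R z \<in> cone i \<longleftrightarrow> z \<in> fct i"
                using True ray_end[of \<tau> z] by (simp add: cone_def)
              then show "F ((1 - \<tau>) *\<^sub>R p + \<tau> *\<^sub>R z)
                  \<le> (g z * indicator (rfct i) z) * indicator {1 - \<delta><..} \<tau>"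
                using mono[OF i, of z \<tau>] True z(2) by (auto simp: F_def indicator_def split: if_splits)
            qed
          qed simp
          also have "\<dots> = G * indicator {1 - \<delta><..} \<tau>"
            by (simp add: nn_integral_multc G_def)
          also have "indicator {1 - \<delta><..} \<tau> = (indicator {?c i<..<?c i + \<delta> * h i} s :: ennreal)"
            using True h[OF i] by (auto simp: \<tau>_def indicator_def field_simps)
          finally show ?thesis .
        qed
      qed
      have "(\<integral>\<^sup>+x\<in>cone i. g x \<partial>lborel)
          \<le> ennreal (K i) * (\<integral>\<^sup>+s. \<integral>\<^sup>+x. F x \<partial>hyperplane_lebesgue (?v i) s \<partial>lborel)"
        using K(2)[OF i F] by (simp add: F_def)
      also have "\<dots> \<le> ennreal (K i) * (\<integral>\<^sup>+s. G * indicator {?c i<..<?c i + \<delta> * h i} s \<partial>lborel)"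
        by (intro mult_left_mono nn_integral_mono le) simp
      also have "\<dots> = ennreal (K i) * (G * ennreal (\<delta> * h i))"
        using \<delta> h[OF i] by (simp add: nn_integral_cmult)
      also have "G = ennreal (norm (?v i)) * (\<integral>\<^sup>+z\<in>rfct i. g z \<partial>\<sigma> i)"
        using v by (simp add: nn_integral_facet_measure G_def flip: mult.assoc ennreal_mult')
      also have "ennreal (K i) * (ennreal (norm (?v i)) * (\<integral>\<^sup>+z\<in>rfct i. g z \<partial>\<sigma> i) * ennreal (\<delta> * h i))
          = ennreal (K i * h i * norm (?v i) * \<delta>) * (\<integral>\<^sup>+z\<in>rfct i. g z \<partial>\<sigma> i)"
        using K(1)[OF i] h[OF i] \<delta> by (simp add: ennreal_mult mult_ac)
      also have "\<dots> \<le> ennreal (C * \<delta>) * (\<integral>\<^sup>+z\<in>rfct i. g z \<partial>\<sigma> i)"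
        using C(2)[OF i] \<delta> by (intro mult_right_mono ennreal_leI) auto
      finally show ?thesis .
    qed
    have "(\<integral>\<^sup>+x\<in>\<Delta>. g x \<partial>lborel) \<le> (\<integral>\<^sup>+x. (\<Sum>i\<in>{1..d}. g x * indicator (cone i) x) \<partial>lborel)"
    proof (rule nn_integral_mono_AE)
      show "AE x in lborel. g x * indicator \<Delta> x \<le> (\<Sum>i\<in>{1..d}. g x * indicator (cone i) x)"
        using AE_lborel_singleton[of p]
      proof eventually_elim
        fix x assume "x \<noteq> p"
        show "g x * indicator \<Delta> x \<le> (\<Sum>i\<in>{1..d}. g x * indicator (cone i) x)"
        proof (cases "x \<in> \<Delta>")
          case True
          from exists_boundary_point[OF p True \<open>x \<noteq> p\<close>] obtain i z \<tau>
            where *: "i \<in> {1..d}" "z \<in> fct i" "0 < \<tau>" "\<tau> < 1" "x = (1 - \<tau>) *\<^sub>R p + \<tau> *\<^sub>R z" .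
          then have "T i x = \<tau>" using T_ray facet_level by simp
          then have "x \<in> cone i" using * ray_end[of \<tau> z] by (simp add: cone_def)
          then have "g x * indicator \<Delta> x = g x * indicator (cone i) x" using True by simp
          also have "\<dots> \<le> (\<Sum>i\<in>{1..d}. g x * indicator (cone i) x)"
            using *(1) by (intro member_le_sum) auto
          finally show ?thesis .
        qed simp
      qed
    qed
    also have "\<dots> = (\<Sum>i\<in>{1..d}. \<integral>\<^sup>+x\<in>cone i. g x \<partial>lborel)"
      by (rule nn_integral_sum) measurable
    also have "\<dots> \<le> (\<Sum>i\<in>{1..d}. ennreal (C * \<delta>) * (\<integral>\<^sup>+z\<in>rfct i. g z \<partial>\<sigma> i))"
      by (intro sum_mono slice)
    also have "\<dots> = ennreal (C * \<delta>) * (\<Sum>i\<in>{1..d}. \<integral>\<^sup>+z\<in>rfct i. g z \<partial>\<sigma> i)"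
      by (simp add: sum_distrib_left)
    finally show "(\<integral>\<^sup>+x\<in>\<Delta>. g x \<partial>lborel)
        \<le> ennreal (C * \<delta>) * (\<Sum>i\<in>{1..d}. \<integral>\<^sup>+z\<in>rfct i. g z \<partial>\<sigma> i)" .
  qed
qed

section \<open>The functionals\<close>

abbreviation Vol where "Vol \<equiv> polyt_volume d a lam"
abbreviation BVol where "BVol \<equiv> boundary_volume d a lam"
abbreviation I where "I \<equiv> polyt_integral d a lam"
abbreviation B where "B \<equiv> boundary_integral d a lam"

text \<open>The functions on which all integrals make sense; convexity is not required.\<close>

definition square_integrable :: "(real ^ 'n \<Rightarrow> real) \<Rightarrow> bool"
  where "square_integrable u \<longleftrightarrow> boundary_integrable d a lam u \<and> u \<in> L2_functions d a lam"

text \<open>The square of the seminorm, and the bilinear form that it comes from.\<close>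

definition covar :: "(real ^ 'n \<Rightarrow> real) \<Rightarrow> (real ^ 'n \<Rightarrow> real) \<Rightarrow> real"
  where "covar u v = I (\<lambda>x. u x * v x) - I u * I v / Vol"

definition Q :: "(real ^ 'n \<Rightarrow> real) \<Rightarrow> real"
  where "Q u = covar u u"

text \<open>
  Along a ray \<open>s u\<close> with \<open>L u < 0\<close>, the minimum of \<open>s L u + s\<^sup>2 \<parallel>u\<parallel>\<^sup>2 / 2\<close> is \<open>- (W u)\<^sup>2 / 2\<close>.  So minimizing
  \<open>W\<close> amounts to minimizing this functional, which is strictly convex modulo constants.
\<close>

definition energy :: "(real ^ 'n \<Rightarrow> real) \<Rightarrow> real"
  where "energy u = L_fun d a lam u + Q u / 2"

lemma polyt_emeasure_finite: "emeasure lborel \<Delta> < \<infinity>"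
  using emeasure_bounded_finite[OF bounded_polyt] .

lemma Vol_pos: "0 < Vol"
proof -
  have "emeasure lborel \<Delta> \<noteq> 0"
  proof
    assume "emeasure lborel \<Delta> = 0"
    then have "\<Delta> \<in> null_sets lborel" by auto
    then have "negligible \<Delta>" by (simp add: negligible_iff_null_sets null_sets_completionI)
    then show False using open_not_negligible[OF open_polyt nonempty] by simp
  qed
  then show ?thesis
    using polyt_emeasure_finite by (simp add: polyt_volume_def measure_def enn2real_positive_iff zero_less_iff_neq_zero)
qed

lemma BVol_eq: "BVol = (\<Sum>i\<in>{1..d}. measure (\<sigma> i) (rfct i))"
  unfolding boundary_volume_def by (intro sum.cong) (simp_all add: measure_rfct)

lemma BVol_nonneg: "0 \<le> BVol"
  unfolding boundary_volume_def by (intro sum_nonneg) simp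

lemma emeasure_rfct_finite: "i \<in> {1..d} \<Longrightarrow> emeasure (\<sigma> i) (rfct i) < \<infinity>"
  by (rule le_less_trans[OF emeasure_mono emeasure_facet_finite]) (auto simp: rfct_subset)

lemma square_integrableD:
  assumes "square_integrable u"
  shows "i \<in> {1..d} \<Longrightarrow> set_integrable (\<sigma> i) (rfct i) u"
    and "set_borel_measurable lborel \<Delta> u"
    and "set_integrable lborel \<Delta> (\<lambda>x. (u x)\<^sup>2)"
  using assms by (auto simp: square_integrable_def boundary_integrable_def L2_functions_def)

lemma square_integrable_mult:
  assumes "square_integrable u" "square_integrable v"
  shows "set_integrable lborel \<Delta> (\<lambda>x. u x * v x)"
proof -
  have "set_integrable lborel \<Delta> (\<lambda>x. (u x)\<^sup>2 + (v x)\<^sup>2)"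
    using square_integrableD(3)[OF assms(1)] square_integrableD(3)[OF assms(2)] by (rule set_integral_add)
  then show ?thesis
    unfolding set_integrable_def
  proof (rule Bochner_Integration.integrable_bound)
    have "(\<lambda>x. (indicator \<Delta> x *\<^sub>R u x) * (indicator \<Delta> x *\<^sub>R v x)) \<in> borel_measurable lborel"
      using square_integrableD(2)[OF assms(1)] square_integrableD(2)[OF assms(2)]
      unfolding set_borel_measurable_def by (rule borel_measurable_times)
    also have "(\<lambda>x. (indicator \<Delta> x *\<^sub>R u x) * (indicator \<Delta> x *\<^sub>R v x)) = (\<lambda>x. indicator \<Delta> x *\<^sub>R (u x * v x))"
      by (auto simp: indicator_def)
    finally show "(\<lambda>x. indicator \<Delta> x *\<^sub>R (u x * v x)) \<in> borel_measurable lborel" .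
    have "\<bar>s * t\<bar> \<le> s\<^sup>2 + t\<^sup>2" for s t :: real
    proof -
      have "2 * (\<bar>s\<bar> * \<bar>t\<bar>) \<le> s\<^sup>2 + t\<^sup>2" using sum_squares_bound[of "\<bar>s\<bar>" "\<bar>t\<bar>"] by simp
      moreover have "0 \<le> \<bar>s\<bar> * \<bar>t\<bar>" by simp
      ultimately show ?thesis unfolding abs_mult by linarith
    qed
    then show "AE x in lborel. norm (indicator \<Delta> x *\<^sub>R (u x * v x))
        \<le> norm (indicator \<Delta> x *\<^sub>R ((u x)\<^sup>2 + (v x)\<^sup>2))"
      by (auto simp: indicator_def)
  qed
qed

lemma square_integrable_const: "square_integrable (\<lambda>_. c)"
  unfolding square_integrable_def boundary_integrable_def L2_functions_def
    set_integrable_def set_borel_measurable_def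
  using polyt_emeasure_finite emeasure_rfct_finite
  by (auto intro!: integrable_real_mult_indicator)

lemma square_integrable_integrable:
  assumes "square_integrable u"
  shows "set_integrable lborel \<Delta> u"
  using square_integrable_mult[OF assms square_integrable_const[of 1]] by simp

lemma square_integrable_lin:
  assumes u: "square_integrable u" and v: "square_integrable v"
  shows "square_integrable (\<lambda>x. r * u x + s * v x)"
    and "I (\<lambda>x. r * u x + s * v x) = r * I u + s * I v"
    and "B (\<lambda>x. r * u x + s * v x) = r * B u + s * B v"
proof -
  have b: "set_integrable (\<sigma> i) (rfct i) (\<lambda>x. r * u x)" "set_integrable (\<sigma> i) (rfct i) (\<lambda>x. s * v x)"
    if "i \<in> {1..d}" for i
    using square_integrableD(1)[OF u that] square_integrableD(1)[OF v that] by auto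
  have m: "set_borel_measurable lborel \<Delta> (\<lambda>x. r * u x + s * v x)"
  proof -
    have "(\<lambda>x. r * (indicator \<Delta> x *\<^sub>R u x) + s * (indicator \<Delta> x *\<^sub>R v x)) \<in> borel_measurable lborel"
      using square_integrableD(2)[OF u] square_integrableD(2)[OF v]
      unfolding set_borel_measurable_def by (intro borel_measurable_add borel_measurable_times) auto
    also have "(\<lambda>x. r * (indicator \<Delta> x *\<^sub>R u x) + s * (indicator \<Delta> x *\<^sub>R v x))
        = (\<lambda>x. indicator \<Delta> x *\<^sub>R (r * u x + s * v x))"
      by (auto simp: indicator_def)
    finally show ?thesis by (simp add: set_borel_measurable_def)
  qed
  have "set_integrable lborel \<Delta> (\<lambda>x. r\<^sup>2 * (u x * u x) + (2 * r * s * (u x * v x) + s\<^sup>2 * (v x * v x)))"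
    using square_integrable_mult[OF u u] square_integrable_mult[OF u v] square_integrable_mult[OF v v]
    by (intro set_integral_add(1) set_integrable_mult_right) auto
  also have "(\<lambda>x. r\<^sup>2 * (u x * u x) + (2 * r * s * (u x * v x) + s\<^sup>2 * (v x * v x)))
      = (\<lambda>x. (r * u x + s * v x)\<^sup>2)"
    by (auto simp: power2_eq_square algebra_simps)
  finally show "square_integrable (\<lambda>x. r * u x + s * v x)"
    unfolding square_integrable_def boundary_integrable_def L2_functions_def
    using m set_integral_add(1)[OF b] by auto
  show "I (\<lambda>x. r * u x + s * v x) = r * I u + s * I v"
    unfolding polyt_integral_def
    using square_integrable_integrable[OF u] square_integrable_integrable[OF v]
    by (subst set_integral_add(2)) auto
  show "B (\<lambda>x. r * u x + s * v x) = r * B u + s * B v"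
    unfolding boundary_integral_def sum_distrib_left sum.distrib[symmetric]
    by (intro sum.cong refl) (subst set_integral_add(2)[OF b], auto)
qed

lemma
  shows I_const: "I (\<lambda>_. c) = c * Vol"
    and B_const: "B (\<lambda>_. c) = c * BVol"
  unfolding polyt_integral_def boundary_integral_def BVol_eq polyt_volume_def sum_distrib_left
    set_lebesgue_integral_def
  by (auto intro!: sum.cong simp: mult.commute)

lemma I_mono:
  assumes "set_integrable lborel \<Delta> u" "set_integrable lborel \<Delta> v" "\<And>x. x \<in> \<Delta> \<Longrightarrow> u x \<le> v x"
  shows "I u \<le> I v"
  unfolding polyt_integral_def using assms by (rule set_integral_mono)

lemma B_mono:
  assumes "square_integrable u" "square_integrable v"
    and "\<And>i x. i \<in> {1..d} \<Longrightarrow> x \<in> rfct i \<Longrightarrow> u x \<le> v x"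
  shows "B u \<le> B v"
  unfolding boundary_integral_def
  by (intro sum_mono set_integral_mono square_integrableD(1) assms)

lemma Q_lin:
  assumes "square_integrable u" "square_integrable v"
  shows "Q (\<lambda>x. r * u x + s * v x) = r\<^sup>2 * Q u + 2 * r * s * covar u v + s\<^sup>2 * Q v"
proof -
  have "I (\<lambda>x. (r * u x + s * v x) * (r * u x + s * v x))
      = I (\<lambda>x. r\<^sup>2 * (u x * u x) + (2 * r * s * (u x * v x) + s\<^sup>2 * (v x * v x)))"
    by (rule arg_cong[where f = I]) (auto simp: power2_eq_square algebra_simps)
  also have "\<dots> = r\<^sup>2 * I (\<lambda>x. u x * u x) + (2 * r * s * I (\<lambda>x. u x * v x) + s\<^sup>2 * I (\<lambda>x. v x * v x))"
    unfolding polyt_integral_def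
    using square_integrable_mult[OF assms(1,1)] square_integrable_mult[OF assms] square_integrable_mult[OF assms(2,2)]
    by (subst set_integral_add(2), simp, intro set_integral_add(1), simp, simp,
        subst set_integral_add(2), auto)
  finally have *: "I (\<lambda>x. (r * u x + s * v x) * (r * u x + s * v x)) = \<dots>" .
  show ?thesis
    unfolding Q_def covar_def * square_integrable_lin(2)[OF assms]
    using Vol_pos by (simp add: field_simps power2_eq_square)
qed

lemma Q_const: "Q (\<lambda>_. c) = 0"
  using Vol_pos by (simp add: Q_def covar_def I_const)

lemma covar_const:
  "covar u (\<lambda>_. c) = 0"
proof -
  have "I (\<lambda>x. u x * c) = I u * c" by (simp add: polyt_integral_def)
  then show ?thesis using Vol_pos by (simp add: covar_def I_const)
qed

lemma Q_add_const:
  assumes "square_integrable u"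
  shows "Q (\<lambda>x. u x + c) = Q u"
  using Q_lin[OF assms square_integrable_const[of c], of 1 1] by (simp add: Q_const covar_const)

lemma Q_nonneg:
  assumes "square_integrable u"
  shows "0 \<le> Q u"
proof -
  let ?c = "- I u / Vol"
  let ?v = "\<lambda>x. u x + ?c"
  have v: "square_integrable ?v"
    using square_integrable_lin(1)[OF assms square_integrable_const[of ?c], of 1 1] by simp
  have "I ?v = 0"
    using square_integrable_lin(2)[OF assms square_integrable_const[of ?c], of 1 1] Vol_pos
    by (simp add: I_const)
  then have "Q ?v = I (\<lambda>x. ?v x * ?v x)" by (simp add: Q_def covar_def)
  also have "\<dots> \<ge> I (\<lambda>_. 0)"
    by (rule I_mono[OF square_integrable_integrable[OF square_integrable_const] square_integrable_mult[OF v v]]) simp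
  finally show ?thesis using Q_add_const[OF assms, of ?c] I_const[of 0] by simp
qed

lemma polyt_norm_eq: "polyt_norm d a lam u = sqrt (Q u)"
  by (simp add: polyt_norm_def Q_def covar_def power2_eq_square)

lemma L_fun_eq: "L_fun d a lam u = B u - BVol / Vol * I u"
  by (simp add: L_fun_def)

lemma L_lin:
  assumes "square_integrable u" "square_integrable v"
  shows "L_fun d a lam (\<lambda>x. r * u x + s * v x) = r * L_fun d a lam u + s * L_fun d a lam v"
  unfolding L_fun_eq square_integrable_lin(2,3)[OF assms] by (simp add: algebra_simps)

lemma L_const: "L_fun d a lam (\<lambda>_. c) = 0"
  using Vol_pos by (simp add: L_fun_eq I_const B_const)

lemma L_add_const:
  assumes "square_integrable u"
  shows "L_fun d a lam (\<lambda>x. u x + c) = L_fun d a lam u"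
  using L_lin[OF assms square_integrable_const[of c], of 1 1] by (simp add: L_const)

lemma square_integrable_add_const:
  assumes "square_integrable u"
  shows "square_integrable (\<lambda>x. u x + c)" "I (\<lambda>x. u x + c) = I u + c * Vol"
  using square_integrable_lin(1,2)[OF assms square_integrable_const[of c], of 1 1] by (simp_all add: I_const)

lemma energy_midpoint:
  assumes "square_integrable u" "square_integrable v"
  shows "energy (\<lambda>x. 1/2 * u x + 1/2 * v x)
    = energy u / 2 + energy v / 2 - Q (\<lambda>x. u x - v x) / 8"
proof -
  have "Q (\<lambda>x. u x - v x) = Q u - 2 * covar u v + Q v"
    using Q_lin[OF assms, of 1 "-1"] by simp
  then show ?thesis
    unfolding energy_def Q_lin[OF assms] L_lin[OF assms]
    by (simp add: power2_eq_square field_simps)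
qed

lemma energy_scale:
  assumes "square_integrable u"
  shows "energy (\<lambda>x. s * u x) = s * L_fun d a lam u + s\<^sup>2 * Q u / 2"
  using Q_lin[OF assms assms, of s 0] L_lin[OF assms assms, of s 0] by (simp add: energy_def)

lemma energy_add_const:
  assumes "square_integrable u"
  shows "energy (\<lambda>x. u x + c) = energy u"
  using assms by (simp add: energy_def L_add_const Q_add_const)

lemma square_integrable_continuous:
  assumes "continuous_on (closure \<Delta>) u"
  shows "square_integrable u"
proof -
  have "bounded (u ` closure \<Delta>)"
    by (intro compact_imp_bounded compact_continuous_image assms compact_closure_polyt)
  then obtain K where K: "\<And>x. x \<in> closure \<Delta> \<Longrightarrow> \<bar>u x\<bar> \<le> K" by (auto simp: bounded_iff)
  have \<Delta>: "\<And>x. x \<in> \<Delta> \<Longrightarrow> x \<in> closure \<Delta>" using closure_subset by auto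
  have rf: "\<And>i x. x \<in> rfct i \<Longrightarrow> x \<in> closure \<Delta>" using rfct_subset facet_subset by blast
  have meas: "(\<lambda>x. indicator S x *\<^sub>R u x) \<in> borel_measurable borel"
    if "S \<in> sets borel" "S \<subseteq> closure \<Delta>" for S
    using borel_measurable_continuous_on_indicator[OF that(1) continuous_on_subset[OF assms that(2)]] .
  have m\<Delta>: "set_borel_measurable lborel \<Delta> u"
    using meas[OF borel_sets(1) closure_subset] by (simp add: set_borel_measurable_def)
  have "set_integrable (\<sigma> i) (rfct i) u" if i: "i \<in> {1..d}" for i
    unfolding set_integrable_def
  proof (rule Bochner_Integration.integrable_bound)
    show "integrable (\<sigma> i) (\<lambda>x. K * indicator (rfct i) x)"
      using emeasure_rfct_finite[OF i] by (intro integrable_mult_right integrable_real_indicator) auto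
    show "(\<lambda>x. indicator (rfct i) x *\<^sub>R u x) \<in> borel_measurable (\<sigma> i)"
      using meas[of "rfct i"] rf by (subst measurable_cong_sets[OF sets_facet_measure refl]) auto
    show "AE x in \<sigma> i. norm (indicator (rfct i) x *\<^sub>R u x) \<le> norm (K * indicator (rfct i) x)"
      using K rf by (intro AE_I2) (force simp: indicator_def)
  qed
  moreover have "set_integrable lborel \<Delta> (\<lambda>x. (u x)\<^sup>2)"
    unfolding set_integrable_def
  proof (rule Bochner_Integration.integrable_bound)
    show "integrable lborel (\<lambda>x. K\<^sup>2 * indicator \<Delta> x)"
      using polyt_emeasure_finite by (intro integrable_mult_right integrable_real_indicator) auto
    have "(\<lambda>x. (indicator \<Delta> x *\<^sub>R u x)\<^sup>2) \<in> borel_measurable lborel"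
      using m\<Delta> unfolding set_borel_measurable_def by (rule borel_measurable_power)
    also have "(\<lambda>x. (indicator \<Delta> x *\<^sub>R u x)\<^sup>2) = (\<lambda>x. indicator \<Delta> x *\<^sub>R (u x)\<^sup>2)"
      by (auto simp: indicator_def)
    finally show "(\<lambda>x. indicator \<Delta> x *\<^sub>R (u x)\<^sup>2) \<in> borel_measurable lborel" .
    have "(u x)\<^sup>2 \<le> K\<^sup>2" if "x \<in> \<Delta>" for x
      using K[OF \<Delta>[OF that]] by (simp add: abs_le_square_iff[symmetric])
    then show "AE x in lborel. norm (indicator \<Delta> x *\<^sub>R (u x)\<^sup>2) \<le> norm (K\<^sup>2 * indicator \<Delta> x)"
      by (intro AE_I2) (auto simp: indicator_def)
  qed
  ultimately show ?thesis
    using m\<Delta> by (auto simp: square_integrable_def boundary_integrable_def L2_functions_def)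
qed

text \<open>The convex cone over which \<open>W\<close> is minimized, with the functions of norm zero included.\<close>

definition convex_class :: "(real ^ 'n \<Rightarrow> real) set"
  where "convex_class = C1_functions d a lam \<inter> L2_functions d a lam"

lemma convex_class_iff:
  "u \<in> convex_class \<longleftrightarrow> continuous_on \<Delta>s u \<and> convex_on \<Delta>s u \<and> square_integrable u"
  by (auto simp: convex_class_def C1_functions_def square_integrable_def)

lemma convex_class_closure:
  assumes "continuous_on (closure \<Delta>) u" "convex_on (closure \<Delta>) u"
  shows "u \<in> convex_class"
  unfolding convex_class_iff
  using assms square_integrable_continuous star_subset_closure
  by (auto intro: continuous_on_subset convex_on_subset[OF _ _ convex_star])

lemma convex_class_UNIV:
  assumes "convex_on UNIV u"
  shows "u \<in> convex_class" "continuous_on UNIV u"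
proof -
  show "continuous_on UNIV u" by (rule convex_on_continuous[OF open_UNIV assms])
  then show "u \<in> convex_class"
    using assms convex_closure_polyt
    by (intro convex_class_closure) (auto intro: continuous_on_subset convex_on_subset)
qed

lemma convex_class_lin:
  assumes "u \<in> convex_class" "v \<in> convex_class" "0 \<le> r" "0 \<le> s"
  shows "(\<lambda>x. r * u x + s * v x) \<in> convex_class"
  using assms square_integrable_lin(1) unfolding convex_class_iff
  by (auto intro!: continuous_intros convex_on_add convex_on_cmul)

lemma convex_class_add_const:
  assumes "u \<in> convex_class"
  shows "(\<lambda>x. u x + c) \<in> convex_class"
  using assms square_integrable_add_const(1) convex_star unfolding convex_class_iff
  by (auto intro!: continuous_intros convex_on_add simp: convex_on_const)

end

section \<open>Pointwise bounds for convex functions\<close>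

lemma
  fixes f :: "'a :: euclidean_space \<Rightarrow> real"
  assumes f: "integrable lborel f" and c: "c \<noteq> 0"
  shows integrable_lborel_affine: "integrable lborel (\<lambda>x. f (t + c *\<^sub>R x))"
    and integral_lborel_affine: "integral\<^sup>L lborel f = \<bar>c\<bar> ^ DIM('a) * (\<integral>x. f (t + c *\<^sub>R x) \<partial>lborel)"
proof -
  let ?T = "\<lambda>x. t + c *\<^sub>R x"
  let ?D = "distr lborel borel ?T :: 'a measure"
  have eq: "lborel = density ?D (\<lambda>_. ennreal (\<bar>c\<bar> ^ DIM('a)))"
    using lborel_affine[OF c, of t] by (simp add: ennreal_power)
  have [measurable]: "f \<in> borel_measurable borel" using f by auto
  have "integrable (density ?D (\<lambda>_. ennreal (\<bar>c\<bar> ^ DIM('a)))) f" using f eq by simp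
  then have "integrable ?D (\<lambda>x. \<bar>c\<bar> ^ DIM('a) * f x)"
    by (subst (asm) integrable_density) auto
  then have "integrable ?D f" using c by simp
  then show "integrable lborel (\<lambda>x. f (?T x))" by (subst (asm) integrable_distr_eq) auto
  have "integral\<^sup>L lborel f = integral\<^sup>L (density ?D (\<lambda>_. ennreal (\<bar>c\<bar> ^ DIM('a)))) f"
    using eq by simp
  also have "\<dots> = \<bar>c\<bar> ^ DIM('a) * integral\<^sup>L ?D f"
    by (subst integral_density) auto
  also have "integral\<^sup>L ?D f = (\<integral>x. f (?T x) \<partial>lborel)"
    by (rule integral_distr) auto
  finally show "integral\<^sup>L lborel f = \<bar>c\<bar> ^ DIM('a) * (\<integral>x. f (?T x) \<partial>lborel)" .
qed

context lattice_polytope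
begin

lemma combine_ball_in_polyt:
  assumes p: "ball p r \<subseteq> \<Delta>" and z: "z \<in> closure \<Delta>" and \<tau>: "0 \<le> \<tau>" "\<tau> < 1"
  shows "ball ((1 - \<tau>) *\<^sub>R p + \<tau> *\<^sub>R z) ((1 - \<tau>) * r) \<subseteq> \<Delta>"
proof
  fix y assume y: "y \<in> ball ((1 - \<tau>) *\<^sub>R p + \<tau> *\<^sub>R z) ((1 - \<tau>) * r)"
  define e where "e = y - ((1 - \<tau>) *\<^sub>R p + \<tau> *\<^sub>R z)"
  define h where "h = (1 / (1 - \<tau>)) *\<^sub>R e"
  have "norm e < (1 - \<tau>) * r"
    using y unfolding e_def by (simp add: dist_norm norm_minus_commute)
  then have "norm h < r" using \<tau> by (simp add: h_def field_simps)
  then have "p + h \<in> \<Delta>" using p by (auto simp: dist_norm subset_iff)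
  then have "(1 - \<tau>) *\<^sub>R (p + h) + \<tau> *\<^sub>R z \<in> \<Delta>"
    using z \<tau> by (intro combine_in_polyt) auto
  moreover have "(1 - \<tau>) *\<^sub>R h = e" using \<tau> by (simp add: h_def)
  then have "(1 - \<tau>) *\<^sub>R (p + h) + \<tau> *\<^sub>R z = y" by (simp add: scaleR_add_right e_def)
  ultimately show "y \<in> \<Delta>" by simp
qed

lemma abs_integral_le:
  assumes u: "set_integrable lborel \<Delta> u" and A: "A \<subseteq> \<Delta>" "A \<in> sets borel"
  shows "\<bar>\<integral>x. indicator A x * u x \<partial>lborel\<bar> \<le> I (\<lambda>x. \<bar>u x\<bar>)"
    and "integrable lborel (\<lambda>x. indicator A x * u x)"
proof -
  have "set_integrable lborel A u" using u A by (intro set_integrable_subset[OF u]) auto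
  then show int: "integrable lborel (\<lambda>x. indicator A x * u x)"
    by (simp add: set_integrable_def)
  have "\<bar>\<integral>x. indicator A x * u x \<partial>lborel\<bar> \<le> (\<integral>x. \<bar>indicator A x * u x\<bar> \<partial>lborel)"
    by (rule integral_abs_bound)
  also have "\<dots> \<le> (\<integral>x. indicator \<Delta> x *\<^sub>R \<bar>u x\<bar> \<partial>lborel)"
    using set_integrable_abs[OF u] A(1)
    by (intro integral_mono integrable_abs int) (auto simp: set_integrable_def indicator_def)
  finally show "\<bar>\<integral>x. indicator A x * u x \<partial>lborel\<bar> \<le> I (\<lambda>x. \<bar>u x\<bar>)"
    by (simp add: polyt_integral_def set_lebesgue_integral_def)
qed

text \<open>The value of a convex function at the centre of a ball is at most its mean over the ball.\<close>

lemma convex_upper_bound: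
  assumes u: "convex_on \<Delta> u" "set_integrable lborel \<Delta> u" and x: "ball x \<rho> \<subseteq> \<Delta>" "0 < \<rho>"
  shows "u x * measure lborel (ball (0 :: real ^ 'n) \<rho>) \<le> I (\<lambda>x. \<bar>u x\<bar>)"
proof -
  let ?f = "\<lambda>y. indicator (ball x \<rho>) y * u y"
  have int: "integrable lborel ?f" by (rule abs_integral_le(2)[OF u(2) x(1)]) simp
  have "integrable lborel (\<lambda>y. ?f (2 *\<^sub>R x + (-1) *\<^sub>R y))"
    and eq: "integral\<^sup>L lborel ?f = (\<integral>y. ?f (2 *\<^sub>R x + (-1) *\<^sub>R y) \<partial>lborel)"
    using integrable_lborel_affine[OF int, of "-1"] integral_lborel_affine[OF int, of "-1"] by simp_all
  then have int': "integrable lborel (\<lambda>y. ?f y + ?f (2 *\<^sub>R x + (-1) *\<^sub>R y))" using int by simp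
  have "(\<integral>y. 2 * u x * indicator (ball x \<rho>) y \<partial>lborel)
      \<le> (\<integral>y. ?f y + ?f (2 *\<^sub>R x + (-1) *\<^sub>R y) \<partial>lborel)"
  proof (rule integral_mono[OF _ int'])
    show "integrable lborel (\<lambda>y. 2 * u x * indicator (ball x \<rho>) y)"
      using emeasure_bounded_finite[OF bounded_ball[of x \<rho>]]
      by (intro integrable_mult_right integrable_real_indicator) auto
    fix y :: "real ^ 'n"
    let ?y = "2 *\<^sub>R x + (-1) *\<^sub>R y"
    have d: "dist x ?y = dist x y"
      by (simp add: dist_norm norm_minus_commute scaleR_2 algebra_simps)
    show "2 * u x * indicator (ball x \<rho>) y \<le> ?f y + ?f ?y"
    proof (cases "y \<in> ball x \<rho>")
      case True
      then have y': "?y \<in> ball x \<rho>" using d by simp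
      have "u ((1/2) *\<^sub>R y + (1/2) *\<^sub>R ?y) \<le> (1/2) * u y + (1/2) * u ?y"
        using convex_onD[OF u(1), of "1/2" y ?y] subsetD[OF x(1) True] subsetD[OF x(1) y'] by simp
      also have "(1/2) *\<^sub>R y + (1/2) *\<^sub>R ?y = x" by (simp add: scaleR_right_diff_distrib)
      finally show ?thesis using True y' by simp
    next
      case False
      then show ?thesis using d by simp
    qed
  qed
  also have "\<dots> = integral\<^sup>L lborel ?f + integral\<^sup>L lborel ?f"
    using int int' eq
    by (subst Bochner_Integration.integral_add) (simp_all add: integrable_lborel_affine[OF int, of "-1", simplified])
  also have "\<dots> \<le> 2 * I (\<lambda>x. \<bar>u x\<bar>)"
    using abs_integral_le(1)[OF u(2) x(1)] by simp
  finally have "u x * measure lborel (ball x \<rho>) \<le> I (\<lambda>x. \<bar>u x\<bar>)" by simp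
  then show ?thesis using x(2) by (simp add: content_ball)
qed

text \<open>
  If a convex function is very negative at \<open>x\<close>, then for each \<open>y\<close> in a fixed ball it is large at
  \<open>y\<close> or very negative at the midpoint of \<open>x\<close> and \<open>y\<close>.
\<close>

lemma convex_lower_bound:
  assumes u: "convex_on \<Delta>s u" "set_integrable lborel \<Delta> u"
    and p: "ball p r \<subseteq> \<Delta>" "0 < r" and x: "x \<in> \<Delta>s"
  shows "- (2 * 2 ^ CARD('n) + 1) * I (\<lambda>x. \<bar>u x\<bar>) \<le> u x * measure lborel (ball p r)"
proof -
  let ?N = "I (\<lambda>x. \<bar>u x\<bar>)"
  define A where "A = ball ((1/2) *\<^sub>R x + (1/2) *\<^sub>R p) (r / 2)"
  have "x \<in> closure \<Delta>" using x star_subset_closure by auto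
  then have A: "A \<subseteq> \<Delta>"
    using combine_ball_in_polyt[OF p(1), of x "1/2"] by (simp add: A_def add.commute)
  let ?f = "\<lambda>y. indicator A y * u y"
  let ?g = "\<lambda>y. indicator (ball p r) y * u y"
  let ?m = "\<lambda>y. (1/2) *\<^sub>R x + (1/2) *\<^sub>R y"
  have f: "integrable lborel ?f" by (rule abs_integral_le(2)[OF u(2) A]) (simp add: A_def)
  have g: "integrable lborel ?g" by (rule abs_integral_le(2)[OF u(2) p(1)]) simp
  have fm: "integrable lborel (\<lambda>y. ?f (?m y))"
    and fm_eq: "(\<integral>y. ?f (?m y) \<partial>lborel) = 2 ^ CARD('n) * integral\<^sup>L lborel ?f"
    using integrable_lborel_affine[OF f, of "1/2" "(1/2) *\<^sub>R x"]
      integral_lborel_affine[OF f, of "1/2" "(1/2) *\<^sub>R x"] by (simp_all add: power_one_over)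
  have "(\<integral>y. 2 * ?f (?m y) - ?g y \<partial>lborel) \<le> (\<integral>y. u x * indicator (ball p r) y \<partial>lborel)"
  proof (rule integral_mono)
    show "integrable lborel (\<lambda>y. 2 * ?f (?m y) - ?g y)" using fm g by simp
    show "integrable lborel (\<lambda>y. u x * indicator (ball p r) y)"
      using emeasure_bounded_finite[OF bounded_ball[of p r]]
      by (intro integrable_mult_right integrable_real_indicator) auto
    fix y :: "real ^ 'n"
    have "((1/2) *\<^sub>R x + (1/2) *\<^sub>R p) - ?m y = (1/2) *\<^sub>R (p - y)" by (simp add: scaleR_diff_right)
    then have d: "dist ((1/2) *\<^sub>R x + (1/2) *\<^sub>R p) (?m y) = dist p y / 2" by (simp add: dist_norm)
    then have iff: "?m y \<in> A \<longleftrightarrow> y \<in> ball p r" unfolding A_def mem_ball by auto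
    show "2 * ?f (?m y) - ?g y \<le> u x * indicator (ball p r) y"
    proof (cases "y \<in> ball p r")
      case True
      then have "y \<in> \<Delta>s" using p(1) polyt_subset_star by auto
      then have "u (?m y) \<le> (1/2) * u x + (1/2) * u y"
        using convex_onD[OF u(1), of "1/2" x y] x by simp
      then show ?thesis using True iff by simp
    qed (use iff in simp)
  qed
  also have "\<dots> = u x * measure lborel (ball p r)" by simp
  finally have "2 * (2 ^ CARD('n) * integral\<^sup>L lborel ?f) - integral\<^sup>L lborel ?g
      \<le> u x * measure lborel (ball p r)"
    using fm g fm_eq by simp
  moreover have "- ?N \<le> integral\<^sup>L lborel ?f" "integral\<^sup>L lborel ?g \<le> ?N"
    using abs_integral_le(1)[OF u(2) A] abs_integral_le(1)[OF u(2) p(1)] by (auto simp: A_def)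
  moreover have "2 ^ CARD('n) * (- ?N) \<le> 2 ^ CARD('n) * integral\<^sup>L lborel ?f"
    using calculation(2) by (intro mult_left_mono) auto
  ultimately show ?thesis by (simp add: algebra_simps)
qed

text \<open>The Cauchy-Schwarz inequality, as nonnegativity of the variance of \<open>\<bar>u\<bar>\<close>.\<close>

lemma mean_abs_bound:
  assumes u: "square_integrable u"
  shows "(I (\<lambda>x. \<bar>u x\<bar>))\<^sup>2 \<le> Vol * I (\<lambda>x. u x * u x)"
proof -
  have "(\<lambda>x. \<bar>indicator \<Delta> x *\<^sub>R u x\<bar>) \<in> borel_measurable lborel"
    using square_integrableD(2)[OF u] unfolding set_borel_measurable_def by (rule borel_measurable_abs)
  also have "(\<lambda>x. \<bar>indicator \<Delta> x *\<^sub>R u x\<bar>) = (\<lambda>x. indicator \<Delta> x *\<^sub>R \<bar>u x\<bar>)"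
    by (simp add: abs_mult)
  finally have "square_integrable (\<lambda>x. \<bar>u x\<bar>)"
    using square_integrableD(3)[OF u] set_integrable_abs[OF square_integrableD(1)[OF u]]
    by (simp add: square_integrable_def boundary_integrable_def L2_functions_def set_borel_measurable_def)
  then have "0 \<le> I (\<lambda>x. u x * u x) - (I (\<lambda>x. \<bar>u x\<bar>))\<^sup>2 / Vol"
    using Q_nonneg[of "\<lambda>x. \<bar>u x\<bar>"] by (simp add: Q_def covar_def power2_eq_square)
  then show ?thesis using Vol_pos by (simp add: field_simps)
qed

section \<open>Truncation of a convex function\<close>

text \<open>
  The infimum of the dilations \<open>s (u + j) - j\<close> of \<open>u\<close> about the point \<open>p\<close>, for \<open>s \<ge> 1\<close>.  Up to closure,
  its epigraph is the union of the rays that start on the epigraph of \<open>u\<close> and point away from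
  \<open>(p, - j)\<close>: on each ray from \<open>p\<close>, it continues \<open>u\<close> linearly from the place on where the tangent of
  \<open>u\<close> passes through \<open>(p, - j)\<close>.  When \<open>\<Delta>\<close> contains a ball about \<open>p\<close>, large \<open>s\<close> are allowed at every
  \<open>x\<close>, so that the infimum is over a nonempty set on all of the space.
\<close>

definition trunc :: "real ^ 'n \<Rightarrow> real \<Rightarrow> (real ^ 'n \<Rightarrow> real) \<Rightarrow> real ^ 'n \<Rightarrow> real"
  where "trunc p j u x =
    (INF s \<in> {s. 1 \<le> s \<and> p + (1 / s) *\<^sub>R (x - p) \<in> \<Delta>s}. s * u (p + (1 / s) *\<^sub>R (x - p)) + (s - 1) * j)"

context
  fixes p r j m and u :: "real ^ 'n \<Rightarrow> real"
  assumes p: "ball p r \<subseteq> \<Delta>" "0 < r"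
    and u: "convex_on \<Delta>s u" "\<And>x. x \<in> \<Delta>s \<Longrightarrow> m \<le> u x"
    and j: "0 \<le> m + j"
begin

lemma convex_u:
  assumes "x \<in> \<Delta>s" "y \<in> \<Delta>s" "0 \<le> \<alpha>" "0 \<le> \<beta>" "\<alpha> + \<beta> = 1"
  shows "u (\<alpha> *\<^sub>R x + \<beta> *\<^sub>R y) \<le> \<alpha> * u x + \<beta> * u y"
  using u(1) assms unfolding convex_on_def by blast

lemma trunc_dom:
  assumes "norm (x - p) \<le> R" "0 \<le> R"
  shows "p + (1 / (1 + 2 * R / r)) *\<^sub>R (x - p) \<in> cball p (r / 2)"
    and "p + (1 / (1 + 2 * R / r)) *\<^sub>R (x - p) \<in> \<Delta>s"
proof -
  have pos: "0 < 1 + 2 * R / r" using assms(2) p(2) by (simp add: add_pos_nonneg)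
  have "(r / 2) * (1 + 2 * R / r) = r / 2 + R" using p(2) by (simp add: field_simps)
  then have "norm (x - p) \<le> (r / 2) * (1 + 2 * R / r)" using assms p(2) by linarith
  then have "norm (x - p) / (1 + 2 * R / r) \<le> r / 2" using pos by (simp add: pos_divide_le_eq)
  then show *: "p + (1 / (1 + 2 * R / r)) *\<^sub>R (x - p) \<in> cball p (r / 2)"
    using pos by (simp add: dist_norm)
  have "cball p (r / 2) \<subseteq> ball p r" using p(2) by auto
  then show "p + (1 / (1 + 2 * R / r)) *\<^sub>R (x - p) \<in> \<Delta>s"
    using * p(1) polyt_subset_star by blast
qed

lemma trunc_value_ge:
  assumes "1 \<le> s" "y \<in> \<Delta>s"
  shows "m \<le> s * u y + (s - 1) * j"
proof -
  have "0 \<le> (s - 1) * (m + j)" using assms j by simp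
  moreover have "s * m \<le> s * u y" using assms u(2) by (intro mult_left_mono) auto
  ultimately show ?thesis by (simp add: algebra_simps)
qed

lemma trunc_bdd_below:
  "bdd_below ((\<lambda>s. s * u (p + (1 / s) *\<^sub>R (x - p)) + (s - 1) * j) `
    {s. 1 \<le> s \<and> p + (1 / s) *\<^sub>R (x - p) \<in> \<Delta>s})"
  by (rule bdd_belowI2[where m = m]) (auto intro: trunc_value_ge)

lemma trunc_le:
  assumes "1 \<le> s" "p + (1 / s) *\<^sub>R (x - p) \<in> \<Delta>s"
  shows "trunc p j u x \<le> s * u (p + (1 / s) *\<^sub>R (x - p)) + (s - 1) * j"
  unfolding trunc_def by (rule cINF_lower[OF trunc_bdd_below]) (use assms in auto)

lemma trunc_greatest:
  assumes "\<And>s. 1 \<le> s \<Longrightarrow> p + (1 / s) *\<^sub>R (x - p) \<in> \<Delta>s \<Longrightarrow>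
    b \<le> s * u (p + (1 / s) *\<^sub>R (x - p)) + (s - 1) * j"
  shows "b \<le> trunc p j u x"
  unfolding trunc_def
proof (rule cINF_greatest)
  have "1 \<le> 1 + 2 * norm (x - p) / r" using p(2) by simp
  then have "1 + 2 * norm (x - p) / r \<in> {s. 1 \<le> s \<and> p + (1 / s) *\<^sub>R (x - p) \<in> \<Delta>s}"
    using trunc_dom(2)[of x "norm (x - p)"] by simp
  then show "{s. 1 \<le> s \<and> p + (1 / s) *\<^sub>R (x - p) \<in> \<Delta>s} \<noteq> {}" by blast
qed (use assms in auto)

lemma trunc_ge: "m \<le> trunc p j u x"
  by (intro trunc_greatest trunc_value_ge)

lemma trunc_le_self: "x \<in> \<Delta>s \<Longrightarrow> trunc p j u x \<le> u x"
  using trunc_le[of 1 x] by simp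

lemma trunc_bounded:
  assumes "norm (x - p) \<le> R" "0 \<le> R" and M: "\<And>y. y \<in> cball p (r / 2) \<Longrightarrow> u y \<le> M"
  shows "trunc p j u x \<le> (1 + 2 * R / r) * M + (2 * R / r) * j"
proof -
  let ?s = "1 + 2 * R / r"
  have s: "1 \<le> ?s" using p(2) assms(2) by simp
  have "trunc p j u x \<le> ?s * u (p + (1 / ?s) *\<^sub>R (x - p)) + (?s - 1) * j"
    using s trunc_dom(2)[OF assms(1,2)] by (rule trunc_le)
  also have "\<dots> \<le> ?s * M + (?s - 1) * j"
    using s M[OF trunc_dom(1)[OF assms(1,2)]] by (intro add_right_mono mult_left_mono) auto
  finally show ?thesis by simp
qed

text \<open>
  The function \<open>s u (p + (x - p) / s)\<close> is jointly convex in \<open>s\<close> and \<open>x\<close>, being a perspective of \<open>u\<close>,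
  and a partial infimum of a jointly convex function is convex.
\<close>

lemma convex_trunc: "convex_on UNIV (trunc p j u)"
  unfolding convex_on_alt
proof (intro conjI ballI allI impI)
  fix x y and \<alpha> :: real
  assume \<alpha>: "0 \<le> \<alpha> \<and> \<alpha> \<le> 1"
  define \<beta> where "\<beta> = 1 - \<alpha>"
  have \<beta>: "0 \<le> \<beta>" "\<alpha> + \<beta> = 1" using \<alpha> by (simp_all add: \<beta>_def)
  let ?val = "\<lambda>s x. s * u (p + (1 / s) *\<^sub>R (x - p)) + (s - 1) * j"
  have main: "trunc p j u (\<alpha> *\<^sub>R x + \<beta> *\<^sub>R y) \<le> \<alpha> * ?val s x + \<beta> * ?val t y"
    if s: "1 \<le> s" "p + (1 / s) *\<^sub>R (x - p) \<in> \<Delta>s" and t: "1 \<le> t" "p + (1 / t) *\<^sub>R (y - p) \<in> \<Delta>s" for s t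
  proof -
    let ?x = "p + (1 / s) *\<^sub>R (x - p)" and ?y = "p + (1 / t) *\<^sub>R (y - p)"
    define q where "q = \<alpha> * s + \<beta> * t"
    have "\<alpha> * 1 + \<beta> * 1 \<le> q" unfolding q_def using \<alpha> \<beta> s(1) t(1) by (intro add_mono mult_left_mono) auto
    then have q: "1 \<le> q" using \<beta> by simp
    have w: "0 \<le> \<alpha> * s / q" "0 \<le> \<beta> * t / q" "\<alpha> * s / q + \<beta> * t / q = 1"
      using \<alpha> \<beta> s(1) t(1) q by (auto simp: q_def simp flip: add_divide_distrib)
    have "q *\<^sub>R (p + (1 / q) *\<^sub>R ((\<alpha> *\<^sub>R x + \<beta> *\<^sub>R y) - p))
        = q *\<^sub>R p + (\<alpha> *\<^sub>R x + \<beta> *\<^sub>R y) - p"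
      using q by (simp add: scaleR_add_right)
    also have "\<dots> = (\<alpha> * s) *\<^sub>R ?x + (\<beta> * t) *\<^sub>R ?y"
    proof -
      have 1: "(\<alpha> * s) *\<^sub>R ?x = (\<alpha> * s) *\<^sub>R p + (\<alpha> *\<^sub>R x - \<alpha> *\<^sub>R p)"
        using s(1) by (simp add: scaleR_add_right scaleR_diff_right)
      have 2: "(\<beta> * t) *\<^sub>R ?y = (\<beta> * t) *\<^sub>R p + (\<beta> *\<^sub>R y - \<beta> *\<^sub>R p)"
        using t(1) by (simp add: scaleR_add_right scaleR_diff_right)
      have 3: "\<alpha> *\<^sub>R p + \<beta> *\<^sub>R p = p" unfolding scaleR_add_left[symmetric] \<beta>(2) by simp
      have "(\<alpha> * s) *\<^sub>R ?x + (\<beta> * t) *\<^sub>R ?y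
          = ((\<alpha> * s) *\<^sub>R p + (\<beta> * t) *\<^sub>R p) + (\<alpha> *\<^sub>R x + \<beta> *\<^sub>R y) - (\<alpha> *\<^sub>R p + \<beta> *\<^sub>R p)"
        unfolding 1 2 by simp
      then show ?thesis unfolding 3 by (simp add: q_def scaleR_add_left)
    qed
    also have "\<dots> = q *\<^sub>R ((\<alpha> * s / q) *\<^sub>R ?x + (\<beta> * t / q) *\<^sub>R ?y)"
      using q by (simp add: scaleR_add_right)
    finally have eq: "p + (1 / q) *\<^sub>R ((\<alpha> *\<^sub>R x + \<beta> *\<^sub>R y) - p) = (\<alpha> * s / q) *\<^sub>R ?x + (\<beta> * t / q) *\<^sub>R ?y"
      using q by simp
    have "(\<alpha> * s / q) *\<^sub>R ?x + (\<beta> * t / q) *\<^sub>R ?y \<in> \<Delta>s"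
      using w s(2) t(2) by (intro convexD[OF convex_star])
    then have "trunc p j u (\<alpha> *\<^sub>R x + \<beta> *\<^sub>R y)
        \<le> q * u ((\<alpha> * s / q) *\<^sub>R ?x + (\<beta> * t / q) *\<^sub>R ?y) + (q - 1) * j"
      using trunc_le[OF q, of "\<alpha> *\<^sub>R x + \<beta> *\<^sub>R y"] by (simp only: eq)
    also have "\<dots> \<le> q * ((\<alpha> * s / q) * u ?x + (\<beta> * t / q) * u ?y) + (q - 1) * j"
      using w s(2) t(2) q by (intro add_right_mono mult_left_mono convex_u) simp_all
    also have "\<dots> = \<alpha> * (s * u ?x) + \<beta> * (t * u ?y) + (q - 1) * j"
      using q by (simp add: field_simps)
    also have "(q - 1) * j = \<alpha> * ((s - 1) * j) + \<beta> * ((t - 1) * j)"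
    proof -
      have "q - 1 = \<alpha> * (s - 1) + \<beta> * (t - 1)" using \<beta>(2) by (simp add: q_def algebra_simps)
      show ?thesis unfolding \<open>q - 1 = _\<close> by (simp add: algebra_simps)
    qed
    finally show ?thesis by (simp add: algebra_simps)
  qed
  have half: "trunc p j u (\<alpha> *\<^sub>R x + \<beta> *\<^sub>R y) \<le> \<alpha> * trunc p j u x + \<beta> * ?val t y"
    if t: "1 \<le> t" "p + (1 / t) *\<^sub>R (y - p) \<in> \<Delta>s" for t
  proof (cases "\<alpha> = 0")
    case True
    have "1 \<le> 1 + 2 * norm (x - p) / r" using p(2) by simp
    from main[OF this trunc_dom(2) t, of ] True show ?thesis by simp
  next
    case False
    then have a: "0 < \<alpha>" using \<alpha> by simp
    have "(trunc p j u (\<alpha> *\<^sub>R x + \<beta> *\<^sub>R y) - \<beta> * ?val t y) / \<alpha> \<le> trunc p j u x"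
    proof (rule trunc_greatest)
      fix s assume "1 \<le> s" "p + (1 / s) *\<^sub>R (x - p) \<in> \<Delta>s"
      from main[OF this t] show "(trunc p j u (\<alpha> *\<^sub>R x + \<beta> *\<^sub>R y) - \<beta> * ?val t y) / \<alpha> \<le> ?val s x"
        using a by (simp add: pos_divide_le_eq mult.commute[of _ \<alpha>])
    qed
    then show ?thesis using a by (simp add: pos_divide_le_eq mult.commute[of _ \<alpha>])
  qed
  have "trunc p j u (\<alpha> *\<^sub>R x + \<beta> *\<^sub>R y) \<le> \<alpha> * trunc p j u x + \<beta> * trunc p j u y"
  proof (cases "\<beta> = 0")
    case True
    have "1 \<le> 1 + 2 * norm (y - p) / r" using p(2) by simp
    from half[OF this trunc_dom(2)] True show ?thesis by simp
  next
    case False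
    then have b: "0 < \<beta>" using \<beta> by simp
    have "(trunc p j u (\<alpha> *\<^sub>R x + \<beta> *\<^sub>R y) - \<alpha> * trunc p j u x) / \<beta> \<le> trunc p j u y"
    proof (rule trunc_greatest)
      fix t assume "1 \<le> t" "p + (1 / t) *\<^sub>R (y - p) \<in> \<Delta>s"
      from half[OF this] show "(trunc p j u (\<alpha> *\<^sub>R x + \<beta> *\<^sub>R y) - \<alpha> * trunc p j u x) / \<beta> \<le> ?val t y"
        using b by (simp add: pos_divide_le_eq mult.commute[of _ \<beta>])
    qed
    then show ?thesis using b by (simp add: pos_divide_le_eq mult.commute[of _ \<beta>])
  qed
  then show "trunc p j u (\<alpha> *\<^sub>R x + (1 - \<alpha>) *\<^sub>R y) \<le> \<alpha> * trunc p j u x + (1 - \<alpha>) * trunc p j u y"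
    by (simp add: \<beta>_def)
qed simp

lemma ray_dilate:
  fixes z :: "real ^ 'n"
  shows "p + (1 / s) *\<^sub>R (((1 - \<tau>) *\<^sub>R p + \<tau> *\<^sub>R z) - p) = (1 - \<tau> / s) *\<^sub>R p + (\<tau> / s) *\<^sub>R z"
  by (simp add: scaleR_diff_left scaleR_add_right scaleR_diff_right)

lemma ray_in_star: "z \<in> \<Delta>s \<Longrightarrow> 0 \<le> \<tau> \<Longrightarrow> \<tau> \<le> 1 \<Longrightarrow> (1 - \<tau>) *\<^sub>R p + \<tau> *\<^sub>R z \<in> \<Delta>s"
proof -
  have "p \<in> \<Delta>s" using p polyt_subset_star by (meson centre_in_ball subsetD)
  then show "z \<in> \<Delta>s \<Longrightarrow> 0 \<le> \<tau> \<Longrightarrow> \<tau> \<le> 1 \<Longrightarrow> (1 - \<tau>) *\<^sub>R p + \<tau> *\<^sub>R z \<in> \<Delta>s"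
    by (intro convexD_alt[OF convex_star]) auto
qed

lemma convex_ray:
  assumes "z \<in> \<Delta>s" "0 \<le> \<rho>" "\<rho> \<le> \<tau>" "\<tau> \<le> \<tau>'" "\<tau>' \<le> 1" "\<rho> < \<tau>'"
  shows "u ((1 - \<tau>) *\<^sub>R p + \<tau> *\<^sub>R z) * (\<tau>' - \<rho>) \<le>
    u ((1 - \<rho>) *\<^sub>R p + \<rho> *\<^sub>R z) * (\<tau>' - \<tau>) + u ((1 - \<tau>') *\<^sub>R p + \<tau>' *\<^sub>R z) * (\<tau> - \<rho>)"
proof -
  define D where "D = \<tau>' - \<rho>"
  define \<alpha> where "\<alpha> = (\<tau>' - \<tau>) / D"
  define \<beta> where "\<beta> = (\<tau> - \<rho>) / D"
  let ?x = "(1 - \<rho>) *\<^sub>R p + \<rho> *\<^sub>R z" and ?y = "(1 - \<tau>') *\<^sub>R p + \<tau>' *\<^sub>R z"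
  have D: "0 < D" using assms(6) by (simp add: D_def)
  have aD: "\<alpha> * D = \<tau>' - \<tau>" and bD: "\<beta> * D = \<tau> - \<rho>" using D by (simp_all add: \<alpha>_def \<beta>_def)
  have w: "0 \<le> \<alpha>" "0 \<le> \<beta>" using assms D by (simp_all add: \<alpha>_def \<beta>_def)
  have "(\<alpha> + \<beta>) * D = 1 * D" unfolding distrib_right aD bD by (simp add: D_def)
  then have sum: "\<alpha> + \<beta> = 1" using D by simp
  have "(\<alpha> * \<rho> + \<beta> * \<tau>') * D = (\<alpha> * D) * \<rho> + (\<beta> * D) * \<tau>'" by (simp add: algebra_simps)
  also have "\<dots> = \<tau> * D" unfolding aD bD by (simp add: D_def algebra_simps)
  finally have c: "\<alpha> * \<rho> + \<beta> * \<tau>' = \<tau>" using D by simp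
  have "\<alpha> *\<^sub>R ?x + \<beta> *\<^sub>R ?y = ((\<alpha> + \<beta>) - (\<alpha> * \<rho> + \<beta> * \<tau>')) *\<^sub>R p + (\<alpha> * \<rho> + \<beta> * \<tau>') *\<^sub>R z"
    by (simp add: scaleR_add_right scaleR_diff_right scaleR_add_left scaleR_diff_left)
  then have eq: "\<alpha> *\<^sub>R ?x + \<beta> *\<^sub>R ?y = (1 - \<tau>) *\<^sub>R p + \<tau> *\<^sub>R z" unfolding c sum .
  have "u (\<alpha> *\<^sub>R ?x + \<beta> *\<^sub>R ?y) \<le> \<alpha> * u ?x + \<beta> * u ?y"
    using assms by (intro convex_u w sum ray_in_star) auto
  then have "u ((1 - \<tau>) *\<^sub>R p + \<tau> *\<^sub>R z) * D \<le> (\<alpha> * u ?x + \<beta> * u ?y) * D"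
    unfolding eq using D by (intro mult_right_mono) auto
  also have "\<dots> = u ?x * (\<alpha> * D) + u ?y * (\<beta> * D)" by (simp only: distrib_right mult_ac) (simp only: distrib_left mult_ac)
  finally show ?thesis unfolding aD bD by (simp add: D_def)
qed

text \<open>
  Well inside the polytope, the slopes of \<open>u\<close> along the rays from \<open>p\<close> are at most
  \<open>2 (M - m) / \<delta>\<close>, so for large \<open>j\<close> the truncation has no effect there.
\<close>

lemma trunc_inner:
  assumes z: "z \<in> \<Delta>s" and \<tau>: "0 \<le> \<tau>" "\<tau> \<le> 1 - \<delta>" and \<delta>: "0 < \<delta>"
    and M: "u ((1 - (\<tau> + \<delta> / 2)) *\<^sub>R p + (\<tau> + \<delta> / 2) *\<^sub>R z) \<le> M"
    and j': "2 * (M - m) / \<delta> \<le> m + j"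
  shows "trunc p j u ((1 - \<tau>) *\<^sub>R p + \<tau> *\<^sub>R z) = u ((1 - \<tau>) *\<^sub>R p + \<tau> *\<^sub>R z)"
proof (rule antisym)
  define f where "f t = u ((1 - t) *\<^sub>R p + t *\<^sub>R z)" for t
  have x: "(1 - \<tau>) *\<^sub>R p + \<tau> *\<^sub>R z \<in> \<Delta>s" using z \<tau> \<delta> by (intro ray_in_star) auto
  then show "trunc p j u ((1 - \<tau>) *\<^sub>R p + \<tau> *\<^sub>R z) \<le> u ((1 - \<tau>) *\<^sub>R p + \<tau> *\<^sub>R z)"
    by (rule trunc_le_self)
  define K where "K = 2 * (M - m) / \<delta>"
  have fm: "m \<le> f \<tau>" using u(2)[OF x] by (simp add: f_def)
  show "u ((1 - \<tau>) *\<^sub>R p + \<tau> *\<^sub>R z) \<le> trunc p j u ((1 - \<tau>) *\<^sub>R p + \<tau> *\<^sub>R z)"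
  proof (rule trunc_greatest)
    fix s :: real assume s: "1 \<le> s"
    define \<rho> where "\<rho> = \<tau> / s"
    have \<rho>: "0 \<le> \<rho>" "\<rho> \<le> \<tau>" "s * \<rho> = \<tau>"
      using s \<tau> mult_left_mono[of 1 s \<tau>] by (auto simp: \<rho>_def pos_divide_le_eq)
    have "f \<tau> * (\<tau> + \<delta> / 2 - \<rho>) \<le> f \<rho> * (\<delta> / 2) + f (\<tau> + \<delta> / 2) * (\<tau> - \<rho>)"
      using convex_ray[OF z \<rho>(1,2), of "\<tau> + \<delta> / 2"] \<tau> \<delta> \<rho> by (simp add: f_def)
    also have "\<dots> \<le> f \<rho> * (\<delta> / 2) + M * (\<tau> - \<rho>)"
      using M \<rho> by (intro add_left_mono mult_right_mono) (auto simp: f_def)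
    finally have "f \<tau> * (\<delta> / 2) \<le> f \<rho> * (\<delta> / 2) + (M - f \<tau>) * (\<tau> - \<rho>)"
      by (simp add: algebra_simps)
    also have "\<dots> \<le> f \<rho> * (\<delta> / 2) + (M - m) * (\<tau> - \<rho>)"
      using fm \<rho> by (intro add_left_mono mult_right_mono) auto
    also have "(M - m) * (\<tau> - \<rho>) = K * (\<tau> - \<rho>) * (\<delta> / 2)" using \<delta> by (simp add: K_def)
    finally have "f \<tau> * (\<delta> / 2) \<le> (f \<rho> + K * (\<tau> - \<rho>)) * (\<delta> / 2)" by (simp add: algebra_simps)
    then have 1: "f \<tau> \<le> f \<rho> + K * (\<tau> - \<rho>)" using \<delta> by simp
    have "f \<tau> + (s - 1) * (K * \<tau>) \<le> f \<tau> + (s - 1) * (f \<tau> + j)"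
    proof -
      have 0: "0 \<le> K"
      proof -
        have "(1 - (\<tau> + \<delta> / 2)) *\<^sub>R p + (\<tau> + \<delta> / 2) *\<^sub>R z \<in> \<Delta>s" using z \<tau> \<delta> by (intro ray_in_star) auto
        then have "m \<le> M" using u(2) M by force
        then show ?thesis using \<delta> by (simp add: K_def)
      qed
      have "K * \<tau> \<le> K * 1" using 0 \<tau> \<delta> by (intro mult_left_mono) auto
      then have "K * \<tau> \<le> f \<tau> + j" using j' fm by (simp add: K_def)
      then show ?thesis using s by (intro add_left_mono mult_left_mono) auto
    qed
    also have "\<dots> = s * f \<tau> + (s - 1) * j" by (simp add: algebra_simps)
    also have "\<dots> \<le> s * (f \<rho> + K * (\<tau> - \<rho>)) + (s - 1) * j"
      using 1 s by (intro add_right_mono mult_left_mono) auto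
    also have "\<dots> = s * f \<rho> + (s - 1) * j + K * (s * \<tau> - s * \<rho>)" by (simp add: algebra_simps)
    also have "\<dots> = s * f \<rho> + (s - 1) * j + (s - 1) * (K * \<tau>)"
      unfolding \<rho>(3) by (simp add: algebra_simps)
    finally have "f \<tau> \<le> s * f \<rho> + (s - 1) * j" by simp
    then show "u ((1 - \<tau>) *\<^sub>R p + \<tau> *\<^sub>R z) \<le> s * u (p + (1 / s) *\<^sub>R ((1 - \<tau>) *\<^sub>R p + \<tau> *\<^sub>R z - p)) + (s - 1) * j"
      unfolding ray_dilate by (simp add: f_def \<rho>_def)
  qed
qed

text \<open>
  Where the truncation differs from \<open>u\<close>, it is linear on the rays from \<open>p\<close>; hence the difference
  is convex there and increases towards the boundary.
\<close>

lemma trunc_diff_mono: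
  assumes z: "z \<in> \<Delta>s" and \<tau>: "0 < \<tau>" "\<tau> \<le> 1"
  shows "u ((1 - \<tau>) *\<^sub>R p + \<tau> *\<^sub>R z) - trunc p j u ((1 - \<tau>) *\<^sub>R p + \<tau> *\<^sub>R z) \<le> u z - trunc p j u z"
proof -
  define f where "f t = u ((1 - t) *\<^sub>R p + t *\<^sub>R z)" for t
  have f1: "f 1 = u z" by (simp add: f_def)
  have "f \<tau> - (f 1 - trunc p j u z) \<le> trunc p j u ((1 - \<tau>) *\<^sub>R p + \<tau> *\<^sub>R z)"
  proof (rule trunc_greatest)
    fix s :: real assume s: "1 \<le> s"
    define \<rho> where "\<rho> = \<tau> / s"
    have \<rho>: "0 < \<rho>" "\<rho> \<le> \<tau>" "s * \<rho> = \<tau>" "s = \<tau> / \<rho>"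
      using s \<tau> mult_left_mono[of 1 s \<tau>] by (auto simp: \<rho>_def pos_divide_le_eq)
    define q where "q = (f \<rho> + j) / \<rho>"
    have q: "q * \<rho> = f \<rho> + j" using \<rho>(1) by (simp add: q_def)
    have "trunc p j u z \<le> (1 / \<rho>) * u (p + (1 / (1 / \<rho>)) *\<^sub>R (z - p)) + (1 / \<rho> - 1) * j"
    proof (rule trunc_le)
      show "1 \<le> 1 / \<rho>" using \<rho> \<tau> by simp
      show "p + (1 / (1 / \<rho>)) *\<^sub>R (z - p) \<in> \<Delta>s"
        using ray_in_star[OF z, of \<rho>] \<rho> \<tau> by (simp add: algebra_simps)
    qed
    also have "p + (1 / (1 / \<rho>)) *\<^sub>R (z - p) = (1 - \<rho>) *\<^sub>R p + \<rho> *\<^sub>R z" by (simp add: algebra_simps)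
    also have "(1 / \<rho>) * u ((1 - \<rho>) *\<^sub>R p + \<rho> *\<^sub>R z) + (1 / \<rho> - 1) * j = q - j"
      using \<rho>(1) by (simp add: q_def f_def field_simps)
    finally have 1: "trunc p j u z \<le> q - j" .
    have 2: "s * f \<rho> + (s - 1) * j = \<tau> * q - j"
      unfolding \<rho>(4) using \<rho>(1) by (simp add: q_def field_simps)
    have 3: "trunc p j u z \<le> f 1" using trunc_le_self[OF z] by (simp add: f1)
    have "f \<tau> - (f 1 - trunc p j u z) \<le> \<tau> * q - j"
    proof (cases "\<rho> < 1")
      case False
      then have "\<tau> = 1" using \<rho> \<tau> by simp
      then show ?thesis using 1 by simp
    next
      case True
      have cr: "f \<tau> * (1 - \<rho>) \<le> f \<rho> * (1 - \<tau>) + f 1 * (\<tau> - \<rho>)"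
        using convex_ray[OF z, of \<rho> \<tau> 1] \<rho> \<tau> True by (simp add: f_def)
      have fr: "f \<rho> = q * \<rho> - j" using q by simp
      have "(f \<tau> - \<tau> * q + j) * (1 - \<rho>) \<le> (f 1 - q + j) * (\<tau> - \<rho>)"
        using cr unfolding fr by (simp add: algebra_simps)
      also have "\<dots> \<le> (f 1 - trunc p j u z) * (\<tau> - \<rho>)"
        using 1 \<rho> by (intro mult_right_mono) auto
      also have "\<dots> \<le> (f 1 - trunc p j u z) * (1 - \<rho>)"
        using 3 \<tau> by (intro mult_left_mono) auto
      finally show ?thesis using True by simp
    qed
    then show "f \<tau> - (f 1 - trunc p j u z)
        \<le> s * u (p + (1 / s) *\<^sub>R ((1 - \<tau>) *\<^sub>R p + \<tau> *\<^sub>R z - p)) + (s - 1) * j"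
      using 2 unfolding ray_dilate by (simp add: f_def \<rho>_def)
  qed
  then show ?thesis by (simp add: f_def)
qed

end

section \<open>Truncation decreases the energy\<close>

text \<open>The boundary layer estimate for the difference between a function and its truncation.\<close>

lemma trunc_diff_integral:
  assumes p: "ball p r \<subseteq> \<Delta>" "0 < r"
    and u: "u \<in> convex_class" "\<And>x. x \<in> \<Delta>s \<Longrightarrow> m \<le> u x" and j: "0 \<le> m + j"
    and \<delta>: "0 < \<delta>" "\<delta> \<le> 1" "2 * (M - m) / \<delta> \<le> m + j"
    and M: "\<And>x. ball x (\<delta> / 2 * r) \<subseteq> \<Delta> \<Longrightarrow> u x \<le> M"
    and C: "C > 0" and layer: "\<And>g. layer_function p \<delta> g \<Longrightarrow>
      (\<integral>\<^sup>+x\<in>\<Delta>. g x \<partial>lborel) \<le> ennreal (C * \<delta>) * (\<Sum>i\<in>{1..d}. \<integral>\<^sup>+z\<in>rfct i. g z \<partial>\<sigma> i)"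
  shows "I (\<lambda>x. u x - trunc p j u x) \<le> C * \<delta> * B (\<lambda>x. u x - trunc p j u x)"
proof -
  define w where "w = trunc p j u"
  have uc: "convex_on \<Delta>s u" "continuous_on \<Delta>s u" "square_integrable u"
    using u(1) by (auto simp: convex_class_iff)
  note T = p uc(1) u(2) j
  have wc: "convex_on UNIV w" unfolding w_def by (rule convex_trunc[OF T])
  have w: "w \<in> convex_class" "continuous_on UNIV w" using convex_class_UNIV[OF wc] by auto
  define g where "g x = u x - w x" for x
  have sg: "square_integrable g"
    unfolding g_def using square_integrable_lin(1)[OF uc(3), of w 1 "-1"] w by (simp add: convex_class_iff)
  have g0: "0 \<le> g x" if "x \<in> \<Delta>s" for x
    using trunc_le_self[OF T that] by (simp add: g_def w_def)
  define G where "G x = ennreal (indicator \<Delta>s x *\<^sub>R g x)" for x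
  have "continuous_on \<Delta>s g"
    unfolding g_def using uc(2) continuous_on_subset[OF w(2)] by (intro continuous_on_diff) auto
  then have "(\<lambda>x. indicator \<Delta>s x *\<^sub>R g x) \<in> borel_measurable borel"
    by (rule borel_measurable_continuous_on_indicator[OF borel_sets(4)])
  then have Gm: "G \<in> borel_measurable borel" unfolding G_def by measurable
  have "layer_function p \<delta> G"
    unfolding layer_function_def
  proof (intro conjI Gm ballI allI impI)
    fix i z and \<tau> :: real
    assume i: "i \<in> {1..d}" and z: "z \<in> rfct i" and \<tau>: "0 < \<tau>" "\<tau> < 1"
    let ?x = "(1 - \<tau>) *\<^sub>R p + \<tau> *\<^sub>R z"
    have zs: "z \<in> \<Delta>s" using rfct_subset_star[OF i] z by blast
    have xs: "?x \<in> \<Delta>s" using ray_in_star[OF T zs] \<tau> by simp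
    show "G ?x \<le> (if 1 - \<delta> < \<tau> then G z else 0)"
    proof (cases "1 - \<delta> < \<tau>")
      case True
      have "g ?x \<le> g z"
        using trunc_diff_mono[OF T zs] \<tau> by (simp add: g_def w_def)
      then show ?thesis using True zs xs by (simp add: G_def ennreal_leI)
    next
      case False
      define \<tau>' where "\<tau>' = \<tau> + \<delta> / 2"
      have \<tau>': "0 \<le> \<tau>'" "\<tau>' < 1" "\<delta> / 2 \<le> 1 - \<tau>'" using False \<tau> \<delta> by (auto simp: \<tau>'_def)
      have "ball ((1 - \<tau>') *\<^sub>R p + \<tau>' *\<^sub>R z) (\<delta> / 2 * r) \<subseteq> ball ((1 - \<tau>') *\<^sub>R p + \<tau>' *\<^sub>R z) ((1 - \<tau>') * r)"
        using \<tau>'(3) p(2) by (intro subset_ball mult_right_mono) auto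
      also have "\<dots> \<subseteq> \<Delta>"
        using combine_ball_in_polyt[OF p(1) _ \<tau>'(1,2)] zs star_subset_closure by blast
      finally have "u ((1 - \<tau>') *\<^sub>R p + \<tau>' *\<^sub>R z) \<le> M" by (rule M)
      then have "trunc p j u ?x = u ?x"
        using False \<tau> \<delta> by (intro trunc_inner[OF T zs, where \<delta> = \<delta> and M = M]) (auto simp: \<tau>'_def)
      then show ?thesis using False by (simp add: G_def g_def w_def)
    qed
  qed
  then have "(\<integral>\<^sup>+x\<in>\<Delta>. G x \<partial>lborel) \<le> ennreal (C * \<delta>) * (\<Sum>i\<in>{1..d}. \<integral>\<^sup>+z\<in>rfct i. G z \<partial>\<sigma> i)"
    by (rule layer)
  also have "(\<integral>\<^sup>+x\<in>\<Delta>. G x \<partial>lborel) = (\<integral>\<^sup>+x. ennreal (indicator \<Delta> x *\<^sub>R g x) \<partial>lborel)"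
    using polyt_subset_star by (intro nn_integral_cong) (auto simp: G_def indicator_def)
  also have "\<dots> = ennreal (I g)"
    unfolding polyt_integral_def set_lebesgue_integral_def
    using square_integrable_integrable[OF sg] g0 polyt_subset_star
    by (intro nn_integral_eq_integral) (auto simp: set_integrable_def indicator_def)
  also have "(\<Sum>i\<in>{1..d}. \<integral>\<^sup>+z\<in>rfct i. G z \<partial>\<sigma> i)
      = (\<Sum>i\<in>{1..d}. ennreal (LINT x:rfct i|\<sigma> i. g x))"
  proof (rule sum.cong[OF refl])
    fix i assume i: "i \<in> {1..d}"
    have "(\<integral>\<^sup>+z\<in>rfct i. G z \<partial>\<sigma> i) = (\<integral>\<^sup>+x. ennreal (indicator (rfct i) x *\<^sub>R g x) \<partial>\<sigma> i)"
      using rfct_subset_star[OF i] by (intro nn_integral_cong) (auto simp: G_def indicator_def)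
    also have "\<dots> = ennreal (LINT x:rfct i|\<sigma> i. g x)"
      unfolding set_lebesgue_integral_def
      using square_integrableD(1)[OF sg i] g0 rfct_subset_star[OF i]
      by (intro nn_integral_eq_integral) (auto simp: set_integrable_def indicator_def)
    finally show "(\<integral>\<^sup>+z\<in>rfct i. G z \<partial>\<sigma> i) = ennreal (LINT x:rfct i|\<sigma> i. g x)" .
  qed
  also have "\<dots> = ennreal (B g)"
    unfolding boundary_integral_def
  proof (rule sum_ennreal)
    fix i assume i: "i \<in> {1..d}"
    show "0 \<le> (LINT x:rfct i|\<sigma> i. g x)"
      unfolding set_lebesgue_integral_def
      using g0 rfct_subset_star[OF i] by (intro Bochner_Integration.integral_nonneg) (auto simp: indicator_def)
  qed
  finally have "ennreal (I g) \<le> ennreal (C * \<delta> * B g)"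
    using C \<delta> by (simp add: ennreal_mult')
  moreover have "B (\<lambda>_. 0) \<le> B g"
    by (rule B_mono[OF square_integrable_const sg]) (rule g0[OF rfct_in_star])
  then have "0 \<le> B g" by (simp add: B_const)
  ultimately have "I g \<le> C * \<delta> * B g" using C \<delta> by (subst (asm) ennreal_le_iff) auto
  then show ?thesis by (simp add: g_def[abs_def] w_def)
qed

text \<open>
  The squared norm can decrease by truncation, but by no more than a constant times the integral
  of the difference, which the boundary integral of the difference controls.
\<close>

lemma energy_le_of_layer:
  assumes u: "square_integrable u" "I u = 0" and w: "square_integrable w"
    and m: "m \<le> 0" "\<And>x. x \<in> \<Delta>s \<Longrightarrow> m \<le> w x" "\<And>x. x \<in> \<Delta>s \<Longrightarrow> w x \<le> u x"
    and layer: "I (\<lambda>x. u x - w x) \<le> c * B (\<lambda>x. u x - w x)" "c * (BVol / Vol - m) \<le> 1"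
  shows "energy w \<le> energy u"
proof -
  define g where "g x = u x - w x" for x
  have sg: "square_integrable g" and Ig: "I g = I u - I w" and Bg: "B g = B u - B w"
    using square_integrable_lin[OF u(1) w, of 1 "-1"] by (simp_all add: g_def[abs_def])
  have "B (\<lambda>_. 0) \<le> B g"
    by (rule B_mono[OF square_integrable_const sg]) (simp add: g_def m(3)[OF rfct_in_star])
  then have B0: "0 \<le> B g" by (simp add: B_const)
  have "2 * m * I g = I (\<lambda>x. 2 * m * g x)" by (simp add: polyt_integral_def)
  also have "\<dots> \<le> I (\<lambda>x. u x * u x - w x * w x)"
  proof (rule I_mono)
    show "set_integrable lborel \<Delta> (\<lambda>x. 2 * m * g x)"
      using square_integrable_integrable[OF sg] by simp
    show "set_integrable lborel \<Delta> (\<lambda>x. u x * u x - w x * w x)"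
      using square_integrable_mult[OF u(1) u(1)] square_integrable_mult[OF w w] by (rule set_integral_diff)
    fix x assume "x \<in> \<Delta>"
    then have x: "x \<in> \<Delta>s" using polyt_subset_star by auto
    have "(2 * m) * (u x - w x) \<le> (u x + w x) * (u x - w x)"
      using m(2,3)[OF x] by (intro mult_right_mono) auto
    then show "2 * m * g x \<le> u x * u x - w x * w x" by (simp add: g_def algebra_simps)
  qed
  also have "\<dots> = I (\<lambda>x. u x * u x) - I (\<lambda>x. w x * w x)"
    unfolding polyt_integral_def
    using square_integrable_mult[OF u(1) u(1)] square_integrable_mult[OF w w] by (rule set_integral_diff)
  also have "\<dots> \<le> Q u - Q w" using Vol_pos by (simp add: Q_def covar_def u(2))
  finally have q: "2 * m * I g \<le> Q u - Q w" .
  have nn: "0 \<le> BVol / Vol - m" using divide_nonneg_pos[OF BVol_nonneg Vol_pos] m(1) by linarith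
  have "(BVol / Vol - m) * I g \<le> (BVol / Vol - m) * (c * B g)"
    using layer(1) nn by (intro mult_left_mono) (simp_all add: g_def[abs_def])
  also have "\<dots> = (c * (BVol / Vol - m)) * B g" by simp
  also have "\<dots> \<le> 1 * B g" using layer(2) B0 by (rule mult_right_mono)
  finally have "BVol / Vol * I g - m * I g \<le> B g" by (simp add: left_diff_distrib)
  moreover have "BVol / Vol * I g = BVol / Vol * I u - BVol / Vol * I w" by (simp add: Ig right_diff_distrib)
  ultimately show ?thesis using q unfolding energy_def L_fun_eq Bg by linarith
qed

text \<open>
  Functions of mean zero and nonpositive energy are bounded uniformly, from below on \<open>\<Delta>s\<close> and
  from above on compact parts of \<open>\<Delta>\<close>.  So one truncation parameter works for all of them.
\<close>

lemma uniform_truncation: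
  obtains K :: real where
    "\<And>u. u \<in> convex_class \<Longrightarrow> I u = 0 \<Longrightarrow> energy u \<le> 0 \<Longrightarrow>
      \<exists>w. convex_on UNIV w \<and> energy w \<le> energy u \<and>
        (\<forall>x y. y \<in> closure \<Delta> \<longrightarrow> dist x y \<le> 1 \<longrightarrow> \<bar>w x\<bar> \<le> K)"
proof -
  obtain p where p\<Delta>: "p \<in> \<Delta>" using nonempty by auto
  obtain r where p: "ball p r \<subseteq> \<Delta>" "0 < r" using openE[OF open_polyt p\<Delta>] by auto
  obtain C where C: "C > 0" and layer: "\<And>\<delta> g. 0 < \<delta> \<Longrightarrow> \<delta> \<le> 1 \<Longrightarrow> layer_function p \<delta> g \<Longrightarrow>
      (\<integral>\<^sup>+x\<in>\<Delta>. g x \<partial>lborel) \<le> ennreal (C * \<delta>) * (\<Sum>i\<in>{1..d}. \<integral>\<^sup>+z\<in>rfct i. g z \<partial>\<sigma> i)"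
    using boundary_layer_estimate[OF p\<Delta>] by blast
  let ?vol = "\<lambda>\<rho>. measure lborel (ball (0 :: real ^ 'n) \<rho>)"
  have vol: "0 < ?vol \<rho>" if "0 < \<rho>" for \<rho> using that by (simp add: content_ball)
  have volp: "measure lborel (ball p r) = ?vol r" using p(2) by (simp add: content_ball)
  \<comment> \<open>For the functions \<open>u\<close> in question, \<open>N0\<close> bounds the integral of \<open>\<bar>u\<bar>\<close> over \<open>\<Delta>\<close>, \<open>m\<close> bounds \<open>u\<close> from below,
    and \<open>M\<close> and \<open>M1\<close> bound \<open>u\<close> from above at the centres of balls in \<open>\<Delta>\<close> of radius \<open>\<delta> r / 2\<close> and \<open>r / 2\<close>.\<close>
  define c where "c = (2 * 2 ^ CARD('n) + 1) / ?vol r"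
  define N0 where "N0 = 2 * Vol * c * BVol"
  define m where "m = - (c * N0)"
  have c: "0 < c" unfolding c_def using vol[OF p(2)] by (intro divide_pos_pos) (auto intro: add_pos_pos)
  have N0: "0 \<le> N0" using Vol_pos c BVol_nonneg by (simp add: N0_def)
  have m: "m \<le> 0" using c N0 by (simp add: m_def)
  define A where "A = BVol / Vol - m"
  have A: "0 \<le> A" unfolding A_def using divide_nonneg_pos[OF BVol_nonneg Vol_pos] m by linarith
  define \<delta> where "\<delta> = 1 / (C * A + 1)"
  have \<delta>: "0 < \<delta>" "\<delta> \<le> 1" "C * \<delta> * A \<le> 1"
    using C A by (auto simp: \<delta>_def add_nonneg_pos pos_divide_le_eq)
  define M where "M = N0 / ?vol (\<delta> / 2 * r)"
  define M1 where "M1 = N0 / ?vol (r / 2)"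
  define j where "j = max 0 (2 * (M - m) / \<delta>) - m"
  have j: "0 \<le> m + j" "2 * (M - m) / \<delta> \<le> m + j" by (simp_all add: j_def)
  obtain R where R: "0 \<le> R" "\<And>y. y \<in> closure \<Delta> \<Longrightarrow> norm (y - p) \<le> R"
  proof -
    obtain R where R: "\<And>y. y \<in> closure \<Delta> \<Longrightarrow> norm y \<le> R"
      using compact_imp_bounded[OF compact_closure_polyt] by (auto simp: bounded_iff)
    have "norm (y - p) \<le> \<bar>R\<bar> + norm p" if "y \<in> closure \<Delta>" for y
      using norm_triangle_ineq4[of y p] R[OF that] by linarith
    then show ?thesis using that[of "\<bar>R\<bar> + norm p"] by auto
  qed
  define K where "K = \<bar>m\<bar> + \<bar>(1 + 2 * (R + 1) / r) * M1 + (2 * (R + 1) / r) * j\<bar>"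
  show thesis
  proof (rule that[of K])
    fix u assume u: "u \<in> convex_class" "I u = 0" "energy u \<le> 0"
    have uc: "convex_on \<Delta>s u" "square_integrable u" using u(1) by (auto simp: convex_class_iff)
    have u\<Delta>: "convex_on \<Delta> u" using convex_on_subset[OF uc(1) polyt_subset_star convex_polyt] .
    note int = square_integrable_integrable[OF uc(2)]
    define N where "N = I (\<lambda>x. \<bar>u x\<bar>)"
    have Nnn: "0 \<le> N"
      using I_mono[OF square_integrable_integrable[OF square_integrable_const[of 0]] set_integrable_abs[OF int]]
      by (simp add: N_def I_const)
    have lower: "- (c * N) \<le> u x" if "x \<in> \<Delta>s" for x
    proof -
      have "- (2 * 2 ^ CARD('n) + 1) * N \<le> u x * ?vol r"
        using convex_lower_bound[OF uc(1) int p that] by (simp add: N_def volp)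
      then have "- (2 * 2 ^ CARD('n) + 1) * N / ?vol r \<le> u x"
        using vol[OF p(2)] by (simp only: pos_divide_le_eq)
      moreover have "- (c * N) = - (2 * 2 ^ CARD('n) + 1) * N / ?vol r"
        by (simp only: c_def times_divide_eq_left mult_minus_left minus_divide_left)
      ultimately show ?thesis by simp
    qed
    have "B (\<lambda>_. - (c * N)) \<le> B u"
      by (rule B_mono[OF square_integrable_const uc(2)]) (rule lower[OF rfct_in_star])
    then have "- (c * N) * BVol \<le> B u" by (simp only: B_const)
    then have "Q u \<le> 2 * c * BVol * N"
      using u(3) by (simp add: energy_def L_fun_eq u(2) algebra_simps)
    then have "Vol * Q u \<le> Vol * (2 * c * BVol * N)" using Vol_pos by (intro mult_left_mono) auto
    moreover have "N\<^sup>2 \<le> Vol * Q u"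
      using mean_abs_bound[OF uc(2)] by (simp add: N_def Q_def covar_def u(2))
    ultimately have "N * N \<le> N0 * N" by (simp add: N0_def power2_eq_square algebra_simps)
    then have N: "N \<le> N0" using Nnn N0 by (cases "N = 0") auto
    have ml: "m \<le> u x" if "x \<in> \<Delta>s" for x
    proof -
      have "c * N \<le> c * N0" using N c by (intro mult_left_mono) auto
      then show ?thesis using lower[OF that] by (simp add: m_def)
    qed
    have upper: "u x \<le> N0 / ?vol \<rho>" if "ball x \<rho> \<subseteq> \<Delta>" "0 < \<rho>" for x \<rho>
      using convex_upper_bound[OF u\<Delta> int that] N vol[OF that(2)] by (simp add: N_def pos_le_divide_eq)
    note T = p uc(1) ml j(1)
    define w where "w = trunc p j u"
    have wc: "convex_on UNIV w" unfolding w_def by (rule convex_trunc[OF T])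
    have sw: "square_integrable w" using convex_class_UNIV(1)[OF wc] by (simp add: convex_class_iff)
    have "I (\<lambda>x. u x - w x) \<le> C * \<delta> * B (\<lambda>x. u x - w x)"
      unfolding w_def
    proof (rule trunc_diff_integral[OF p u(1) ml j(1) \<delta>(1,2) j(2) _ C layer[OF \<delta>(1,2)]])
      show "u x \<le> M" if "ball x (\<delta> / 2 * r) \<subseteq> \<Delta>" for x
        using upper[OF that] \<delta>(1) p(2) by (simp add: M_def)
    qed
    then have "energy w \<le> energy u"
      using \<delta>(3) trunc_ge[OF T] trunc_le_self[OF T] m
      by (intro energy_le_of_layer[OF uc(2) u(2) sw, where m = m and c = "C * \<delta>"]) (auto simp: A_def w_def)
    moreover have "\<bar>w x\<bar> \<le> K" if "y \<in> closure \<Delta>" "dist x y \<le> 1" for x y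
    proof -
      have "norm (x - p) \<le> norm (x - y) + norm (y - p)" using norm_triangle_ineq[of "x - y" "y - p"] by simp
      then have x: "norm (x - p) \<le> R + 1" using R(2)[OF that(1)] that(2) by (simp add: dist_norm)
      have M1: "u y \<le> M1" if "y \<in> cball p (r / 2)" for y
      proof -
        have "ball y (r / 2) \<subseteq> ball p r"
        proof
          fix z assume "z \<in> ball y (r / 2)"
          then show "z \<in> ball p r" using that dist_triangle[of p z y] by auto
        qed
        then show ?thesis using upper[of y "r / 2"] p by (auto simp: M1_def)
      qed
      have "w x \<le> (1 + 2 * (R + 1) / r) * M1 + (2 * (R + 1) / r) * j"
        unfolding w_def using R(1) M1 by (intro trunc_bounded[OF T x]) auto
      moreover have "m \<le> w x" unfolding w_def by (rule trunc_ge[OF T])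
      ultimately show ?thesis unfolding K_def by linarith
    qed
    ultimately show "\<exists>w. convex_on UNIV w \<and> energy w \<le> energy u \<and>
        (\<forall>x y. y \<in> closure \<Delta> \<longrightarrow> dist x y \<le> 1 \<longrightarrow> \<bar>w x\<bar> \<le> K)"
      using wc by blast
  qed
qed

end

section \<open>Existence of a minimizer\<close>

text \<open>A bound on the neighbourhood of radius \<open>1\<close> of a set gives a Lipschitz bound on the set.\<close>

lemma convex_lipschitz_of_bound:
  fixes w :: "'a :: euclidean_space \<Rightarrow> real"
  assumes w: "convex_on UNIV w" and K: "\<And>x y. y \<in> S \<Longrightarrow> dist x y \<le> 1 \<Longrightarrow> \<bar>w x\<bar> \<le> K"
    and xy: "x \<in> S" "y \<in> S"
  shows "\<bar>w x - w y\<bar> \<le> 2 * K * norm (x - y)"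
proof -
  have main: "w y - w x \<le> 2 * K * norm (x - y)" if xy: "x \<in> S" "y \<in> S" for x y
  proof (cases "x = y")
    case False
    define D where "D = norm (y - x)"
    have D: "0 < D" using False by (simp add: D_def)
    \<comment> \<open>The segment from \<open>x\<close> to \<open>y\<close>, continued by length \<open>1\<close>.\<close>
    define y' where "y' = y + (1 / D) *\<^sub>R (y - x)"
    have "dist y' y \<le> 1" using D by (simp add: y'_def dist_norm D_def)
    then have b: "\<bar>w y'\<bar> \<le> K" "\<bar>w x\<bar> \<le> K" using K xy by auto
    define t where "t = D / (1 + D)"
    have eq: "(1 - t) *\<^sub>R x + t *\<^sub>R y' = y"
    proof -
      have "t *\<^sub>R y' = t *\<^sub>R y + (t * (1 / D)) *\<^sub>R (y - x)" by (simp add: y'_def scaleR_add_right)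
      also have "t * (1 / D) = 1 - t" using D by (simp add: t_def field_simps)
      finally show ?thesis by (simp add: scaleR_diff_right scaleR_diff_left)
    qed
    have t: "0 \<le> t" "t \<le> 1" "t \<le> D"
      using D by (auto simp: t_def pos_divide_le_eq)
    have "w y \<le> (1 - t) * w x + t * w y'"
      using convex_onD[OF w, of t x y'] t by (simp only: eq UNIV_I)
    then have "w y - w x \<le> t * (w y' - w x)" by (simp add: algebra_simps)
    also have "\<dots> \<le> t * (2 * K)" using b t by (intro mult_left_mono) auto
    also have "\<dots> \<le> D * (2 * K)" using b t by (intro mult_right_mono) auto
    finally show ?thesis by (simp add: D_def norm_minus_commute mult_ac)
  qed simp
  show ?thesis using main[OF xy] main[OF xy(2,1)] by (simp add: norm_minus_commute abs_le_iff)
qed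

context lattice_polytope
begin

lemma energy_tendsto:
  assumes w: "\<And>n. continuous_on (closure \<Delta>) (w n)" and g: "continuous_on (closure \<Delta>) g"
    and K: "\<And>n x. x \<in> closure \<Delta> \<Longrightarrow> \<bar>w n x\<bar> \<le> K"
    and lim: "\<And>x. x \<in> closure \<Delta> \<Longrightarrow> (\<lambda>n. w n x) \<longlonglongrightarrow> g x"
  shows "(\<lambda>n. energy (w n)) \<longlonglongrightarrow> energy g"
proof -
  have si: "square_integrable (w n)" "square_integrable g" for n
    using square_integrable_continuous w g by auto
  have \<Delta>c: "\<And>x. x \<in> \<Delta> \<Longrightarrow> x \<in> closure \<Delta>" using closure_subset by auto
  have rc: "\<And>i x. x \<in> rfct i \<Longrightarrow> x \<in> closure \<Delta>" using rfct_subset facet_subset by blast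
  have dom: "(\<lambda>n. LINT x:A|M. f n x) \<longlonglongrightarrow> (LINT x:A|M. h x)"
    if "emeasure M A < \<infinity>" "A \<in> sets M" "set_integrable M A h" "\<And>n. set_integrable M A (f n)"
      "\<And>n x. x \<in> A \<Longrightarrow> \<bar>f n x\<bar> \<le> L" "\<And>x. x \<in> A \<Longrightarrow> (\<lambda>n. f n x) \<longlonglongrightarrow> h x"
    for A :: "(real ^ 'n) set" and M f h and L :: real
    unfolding set_lebesgue_integral_def
  proof (rule integral_dominated_convergence)
    show "integrable M (\<lambda>x. L * indicator A x)"
      using that(1,2) by (intro integrable_mult_right integrable_real_indicator)
    show "(\<lambda>x. indicator A x *\<^sub>R h x) \<in> borel_measurable M"
      "\<And>n. (\<lambda>x. indicator A x *\<^sub>R f n x) \<in> borel_measurable M"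
      using that(3,4) by (auto simp: set_integrable_def)
    show "AE x in M. (\<lambda>n. indicator A x *\<^sub>R f n x) \<longlonglongrightarrow> indicator A x *\<^sub>R h x"
      using that(6) by (intro AE_I2) (auto simp: indicator_def)
    show "AE x in M. norm (indicator A x *\<^sub>R f n x) \<le> L * indicator A x" for n
      using that(5) by (intro AE_I2) (auto simp: indicator_def)
  qed
  have I1: "(\<lambda>n. I (w n)) \<longlonglongrightarrow> I g"
    unfolding polyt_integral_def
    by (rule dom[OF polyt_emeasure_finite _ square_integrable_integrable[OF si(2)]
          square_integrable_integrable[OF si(1)], where L = K]) (auto intro: K lim \<Delta>c)
  have I2: "(\<lambda>n. I (\<lambda>x. w n x * w n x)) \<longlonglongrightarrow> I (\<lambda>x. g x * g x)"
    unfolding polyt_integral_def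
  proof (rule dom[OF polyt_emeasure_finite _ square_integrable_mult[OF si(2) si(2)]
          square_integrable_mult[OF si(1) si(1)], where L = "K * K"])
    fix n x assume x: "x \<in> \<Delta>"
    show "\<bar>w n x * w n x\<bar> \<le> K * K"
      unfolding abs_mult using K[OF \<Delta>c[OF x]] order_trans[OF abs_ge_zero K[OF \<Delta>c[OF x]]]
      by (intro mult_mono) auto
    show "(\<lambda>n. w n x * w n x) \<longlonglongrightarrow> g x * g x" by (intro tendsto_mult lim \<Delta>c x)
  qed simp
  have B1: "(\<lambda>n. B (w n)) \<longlonglongrightarrow> B g"
    unfolding boundary_integral_def
  proof (rule tendsto_sum)
    fix i assume i: "i \<in> {1..d}"
    show "(\<lambda>n. LINT x:rfct i|\<sigma> i. w n x) \<longlonglongrightarrow> (LINT x:rfct i|\<sigma> i. g x)"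
      by (rule dom[OF emeasure_rfct_finite[OF i] _ square_integrableD(1)[OF si(2) i]
            square_integrableD(1)[OF si(1) i], where L = K]) (auto intro: K lim rc)
  qed
  show ?thesis
    unfolding energy_def L_fun_eq Q_def covar_def
    using Vol_pos by (intro tendsto_intros I1 I2 B1) auto
qed

theorem exists_energy_minimizer:
  assumes neg: "u0 \<in> convex_class" "energy u0 < 0"
  obtains g where "continuous_on (closure \<Delta>) g" "convex_on (closure \<Delta>) g" "I g = 0"
    "\<And>u. u \<in> convex_class \<Longrightarrow> energy g \<le> energy u"
proof -
  obtain K where K: "\<And>u. u \<in> convex_class \<Longrightarrow> I u = 0 \<Longrightarrow> energy u \<le> 0 \<Longrightarrow>
      \<exists>w. convex_on UNIV w \<and> energy w \<le> energy u \<and>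
        (\<forall>x y. y \<in> closure \<Delta> \<longrightarrow> dist x y \<le> 1 \<longrightarrow> \<bar>w x\<bar> \<le> K)"
    using uniform_truncation by blast
  define E where "E = energy ` {w. convex_on UNIV w \<and>
    (\<forall>x y. y \<in> closure \<Delta> \<longrightarrow> dist x y \<le> 1 \<longrightarrow> \<bar>w x\<bar> \<le> K)}"
  have normalize: "\<exists>w. convex_on UNIV w \<and> energy w \<le> energy u \<and>
      (\<forall>x y. y \<in> closure \<Delta> \<longrightarrow> dist x y \<le> 1 \<longrightarrow> \<bar>w x\<bar> \<le> K)"
    if u: "u \<in> convex_class" "energy u \<le> 0" for u
  proof -
    have si: "square_integrable u" using u(1) by (simp add: convex_class_iff)
    have "I (\<lambda>x. u x + - I u / Vol) = 0"
      unfolding square_integrable_add_const(2)[OF si] using Vol_pos by simp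
    moreover have "energy (\<lambda>x. u x + - I u / Vol) = energy u" by (rule energy_add_const[OF si])
    ultimately show ?thesis
      using K[OF convex_class_add_const[OF u(1), of "- I u / Vol"]] u(2) by simp
  qed
  have lower: "- (K * BVol) + - (BVol / Vol * (K * Vol)) \<le> e" if "e \<in> E" for e
  proof -
    from that obtain w where w: "convex_on UNIV w" "e = energy w"
      and wK: "\<And>x y. y \<in> closure \<Delta> \<Longrightarrow> dist x y \<le> 1 \<Longrightarrow> \<bar>w x\<bar> \<le> K" by (auto simp: E_def)
    have si: "square_integrable w" using convex_class_UNIV(1)[OF w(1)] by (simp add: convex_class_iff)
    have b: "\<bar>w x\<bar> \<le> K" if "x \<in> closure \<Delta>" for x using wK[OF that, of x] by simp
    have "B (\<lambda>_. - K) \<le> B w"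
    proof (rule B_mono[OF square_integrable_const si])
      fix i x assume "i \<in> {1..d}" "x \<in> rfct i"
      then have "x \<in> closure \<Delta>" using rfct_in_star star_subset_closure by blast
      then show "- K \<le> w x" using b by force
    qed
    moreover have "I w \<le> I (\<lambda>_. K)"
    proof (rule I_mono[OF square_integrable_integrable[OF si] square_integrable_integrable[OF square_integrable_const]])
      fix x assume "x \<in> \<Delta>"
      then have "x \<in> closure \<Delta>" using closure_subset by blast
      then show "w x \<le> K" using b by force
    qed
    then have "BVol / Vol * I w \<le> BVol / Vol * (K * Vol)"
      unfolding I_const using BVol_nonneg Vol_pos by (intro mult_left_mono) auto
    ultimately show ?thesis using Q_nonneg[OF si] by (simp only: w(2) energy_def L_fun_eq B_const)
  qed
  have bdd: "bdd_below E" by (rule bdd_belowI[OF lower])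
  have ne: "E \<noteq> {}" using normalize[OF neg(1)] neg(2) by (auto simp: E_def)
  have "\<exists>w. energy w < Inf E + 1 / (real n + 1) \<and> convex_on UNIV w \<and>
      (\<forall>x y. y \<in> closure \<Delta> \<longrightarrow> dist x y \<le> 1 \<longrightarrow> \<bar>w x\<bar> \<le> K)" for n
  proof -
    have "Inf E < Inf E + 1 / (real n + 1)" by simp
    then obtain e where "e \<in> E" "e < Inf E + 1 / (real n + 1)"
      using cInf_less_iff[OF ne bdd] by blast
    then show ?thesis by (auto simp: E_def)
  qed
  then obtain w where w: "\<And>n. energy (w n) < Inf E + 1 / (real n + 1)" "\<And>n. convex_on UNIV (w n)"
    "\<And>n x y. y \<in> closure \<Delta> \<Longrightarrow> dist x y \<le> 1 \<Longrightarrow> \<bar>w n x\<bar> \<le> K"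
    by metis
  have wK: "norm (w n x) \<le> K" if "x \<in> closure \<Delta>" for n x using w(3)[OF that, of x] by simp
  obtain x0 where "x0 \<in> \<Delta>" using nonempty by auto
  then have "norm (w 0 x0) \<le> K" using wK closure_subset by blast
  then have K0: "0 \<le> K" by (rule order_trans[OF norm_ge_zero])
  have lip: "\<bar>w n x - w n y\<bar> \<le> 2 * K * norm (x - y)" if "x \<in> closure \<Delta>" "y \<in> closure \<Delta>" for n x y
    by (rule convex_lipschitz_of_bound[OF w(2) w(3) that])
  have equi: "\<exists>\<eta>>0. \<forall>n y. y \<in> closure \<Delta> \<and> norm (x - y) < \<eta> \<longrightarrow> norm (w n x - w n y) < e"
    if x: "x \<in> closure \<Delta>" and e: "0 < e" for x and e :: real
  proof -
    define \<eta> where "\<eta> = e / (2 * K + 1)"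
    have "0 < \<eta>" using e K0 by (simp add: \<eta>_def)
    moreover have "norm (w n x - w n y) < e" if y: "y \<in> closure \<Delta>" "norm (x - y) < \<eta>" for n y
    proof -
      have "norm (w n x - w n y) \<le> 2 * K * norm (x - y)" using lip[OF x y(1)] by simp
      also have "\<dots> \<le> 2 * K * \<eta>" using y(2) K0 by (intro mult_left_mono) auto
      also have "\<dots> < (2 * K + 1) * \<eta>" using \<open>0 < \<eta>\<close> by (simp add: distrib_right)
      also have "\<dots> = e" using K0 by (simp add: \<eta>_def)
      finally show ?thesis .
    qed
    ultimately show ?thesis by blast
  qed
  obtain g k where g: "continuous_on (closure \<Delta>) g" and k: "strict_mono (k :: nat \<Rightarrow> nat)"
    and unif: "\<And>e. 0 < e \<Longrightarrow> \<exists>N. \<forall>n x. n \<ge> N \<and> x \<in> closure \<Delta> \<longrightarrow> norm (w (k n) x - g x) < e"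
    using Arzela_Ascoli[OF compact_closure_polyt wK equi] by blast
  have lim: "(\<lambda>n. w (k n) x) \<longlonglongrightarrow> g x" if "x \<in> closure \<Delta>" for x
    unfolding LIMSEQ_iff using unif that by blast
  have cont: "continuous_on (closure \<Delta>) (w n)" for n
    using convex_class_UNIV(2)[OF w(2)] continuous_on_subset by blast
  have Elim: "(\<lambda>n. energy (w (k n))) \<longlonglongrightarrow> energy g"
    using wK by (intro energy_tendsto[OF cont g _ lim, where K = K]) auto
  have "energy g \<le> Inf E"
  proof (rule LIMSEQ_le[OF Elim])
    have "(\<lambda>n. Inf E + 1 / (real (k n) + 1)) \<longlonglongrightarrow> Inf E + 0"
    proof (intro tendsto_add tendsto_const)
      have "(\<lambda>n. 1 / (real n + 1)) \<longlonglongrightarrow> 0"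
        using LIMSEQ_inverse_real_of_nat by (simp add: inverse_eq_divide add.commute)
      from LIMSEQ_subseq_LIMSEQ[OF this k] show "(\<lambda>n. 1 / (real (k n) + 1)) \<longlonglongrightarrow> 0"
        by (simp add: o_def)
    qed
    then show "(\<lambda>n. Inf E + 1 / (real (k n) + 1)) \<longlonglongrightarrow> Inf E" by simp
    show "\<exists>N. \<forall>n\<ge>N. energy (w (k n)) \<le> Inf E + 1 / (real (k n) + 1)"
      using w(1) less_imp_le by blast
  qed
  have gmin: "energy g \<le> energy u" if u: "u \<in> convex_class" for u
  proof -
    have *: "energy g \<le> energy v" if v: "v \<in> convex_class" "energy v \<le> 0" for v
    proof -
      from normalize[OF v] obtain w' where w': "energy w' \<in> E" "energy w' \<le> energy v" by (auto simp: E_def)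
      have "Inf E \<le> energy w'" by (rule cInf_lower[OF w'(1) bdd])
      then show ?thesis using w'(2) \<open>energy g \<le> Inf E\<close> by linarith
    qed
    show ?thesis
    proof (cases "energy u \<le> 0")
      case False
      then show ?thesis using *[OF neg(1)] neg(2) by linarith
    qed (use * u in auto)
  qed
  have gconv: "convex_on (closure \<Delta>) g"
    unfolding convex_on_alt
  proof (intro conjI ballI allI impI convex_closure_polyt)
    fix x y and \<mu> :: real assume xy: "x \<in> closure \<Delta>" "y \<in> closure \<Delta>" and \<mu>: "0 \<le> \<mu> \<and> \<mu> \<le> 1"
    have z: "\<mu> *\<^sub>R x + (1 - \<mu>) *\<^sub>R y \<in> closure \<Delta>"
      using \<mu> xy by (intro convexD[OF convex_closure_polyt]) auto
    show "g (\<mu> *\<^sub>R x + (1 - \<mu>) *\<^sub>R y) \<le> \<mu> * g x + (1 - \<mu>) * g y"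
    proof (rule LIMSEQ_le[OF lim[OF z]])
      show "(\<lambda>n. \<mu> * w (k n) x + (1 - \<mu>) * w (k n) y) \<longlonglongrightarrow> \<mu> * g x + (1 - \<mu>) * g y"
        by (intro tendsto_intros lim xy)
      show "\<exists>N. \<forall>n\<ge>N. w (k n) (\<mu> *\<^sub>R x + (1 - \<mu>) *\<^sub>R y) \<le> \<mu> * w (k n) x + (1 - \<mu>) * w (k n) y"
        using w(2) \<mu> unfolding convex_on_alt by blast
    qed
  qed
  define c where "c = - I g / Vol"
  have si: "square_integrable g" by (rule square_integrable_continuous[OF g])
  show thesis
  proof (rule that[of "\<lambda>x. g x + c"])
    show "continuous_on (closure \<Delta>) (\<lambda>x. g x + c)" by (intro continuous_intros g)
    show "convex_on (closure \<Delta>) (\<lambda>x. g x + c)"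
      by (intro convex_on_add gconv) (simp add: convex_on_const convex_closure_polyt)
    show "I (\<lambda>x. g x + c) = 0"
      unfolding square_integrable_add_const(2)[OF si] using Vol_pos by (simp add: c_def)
    show "energy (\<lambda>x. g x + c) \<le> energy u" if "u \<in> convex_class" for u
      using gmin[OF that] energy_add_const[OF si] by simp
  qed
qed

section \<open>Minimizers of the energy and of the quotient\<close>

lemma W_eq: "W_fun d a lam u = L_fun d a lam u / sqrt (Q u)"
  by (simp add: W_fun_def polyt_norm_eq)

lemma admissible_iff: "u \<in> W_admissible d a lam \<longleftrightarrow> u \<in> convex_class \<and> Q u \<noteq> 0"
  by (auto simp: W_admissible_def convex_class_def polyt_norm_eq)

text \<open>The factor \<open>- L u / Q u\<close> minimizes the energy on the line spanned by \<open>u\<close>.\<close>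

lemma energy_ge_W:
  assumes "u \<in> convex_class" "Q u \<noteq> 0"
  shows "- (W_fun d a lam u)\<^sup>2 / 2 \<le> energy u"
    and "energy (\<lambda>x. (- L_fun d a lam u / Q u) * u x) = - (W_fun d a lam u)\<^sup>2 / 2"
proof -
  have si: "square_integrable u" using assms by (simp add: convex_class_iff)
  have Q: "0 < Q u" using Q_nonneg[OF si] assms(2) by simp
  let ?L = "L_fun d a lam u"
  have W2: "(W_fun d a lam u)\<^sup>2 = ?L\<^sup>2 / Q u" using Q by (simp add: W_eq power_divide)
  have "0 \<le> (?L + Q u)\<^sup>2 / (2 * Q u)" using Q by simp
  also have "\<dots> = ?L\<^sup>2 / Q u / 2 + energy u"
    using Q by (simp add: energy_def power2_eq_square field_simps)
  finally show "- (W_fun d a lam u)\<^sup>2 / 2 \<le> energy u" by (simp add: W2)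
  show "energy (\<lambda>x. (- ?L / Q u) * u x) = - (W_fun d a lam u)\<^sup>2 / 2"
    unfolding energy_scale[OF si] W2 using Q by (simp add: power2_eq_square field_simps)
qed

lemma AE_zero_imp_zero:
  assumes u: "continuous_on \<Delta>s u" "square_integrable u" and 0: "I (\<lambda>x. u x * u x) = 0"
    and x: "x \<in> \<Delta>s"
  shows "u x = 0"
proof -
  have int: "integrable lborel (\<lambda>x. indicator \<Delta> x *\<^sub>R (u x * u x))"
    using square_integrable_mult[OF u(2,2)] by (simp add: set_integrable_def)
  have "AE x in lborel. indicator \<Delta> x *\<^sub>R (u x * u x) = 0"
    using 0 int unfolding polyt_integral_def set_lebesgue_integral_def
    by (subst (asm) integral_nonneg_eq_0_iff_AE) auto
  then have ae: "AE x in lborel. x \<in> \<Delta> \<longrightarrow> u x = 0"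
    by eventually_elim (auto simp: indicator_def)
  define O1 where "O1 = {x \<in> \<Delta>. u x \<noteq> 0}"
  have "open O1"
  proof -
    have "continuous_on \<Delta> u" using continuous_on_subset[OF u(1) polyt_subset_star] .
    then have "open (u -` (- {0}) \<inter> \<Delta>)"
      using open_polyt by (subst (asm) continuous_on_open_vimage) (auto simp: open_Compl)
    also have "u -` (- {0}) \<inter> \<Delta> = O1" by (auto simp: O1_def)
    finally show ?thesis .
  qed
  have "O1 = {}"
  proof (rule ccontr)
    assume "O1 \<noteq> {}"
    have "AE x in lborel. x \<notin> O1" using ae by eventually_elim (auto simp: O1_def)
    then have "O1 \<in> null_sets lborel"
      using \<open>open O1\<close> by (subst AE_iff_null_sets) auto
    then have "negligible O1" by (simp add: negligible_iff_null_sets null_sets_completionI)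
    then show False using open_not_negligible[OF \<open>open O1\<close> \<open>O1 \<noteq> {}\<close>] by simp
  qed
  then have z: "\<And>y. y \<in> \<Delta> \<Longrightarrow> u y = 0" by (auto simp: O1_def)
  obtain p where p: "p \<in> \<Delta>" using nonempty by auto
  \<comment> \<open>By continuity along the segment from an interior point, \<open>u\<close> also vanishes on the facets.\<close>
  define \<gamma> where "\<gamma> n = (1 / (real n + 1)) *\<^sub>R p + (1 - 1 / (real n + 1)) *\<^sub>R x" for n
  have "x \<in> closure \<Delta>" using x star_subset_closure by auto
  then have \<gamma>: "\<gamma> n \<in> \<Delta>" for n
    unfolding \<gamma>_def by (intro combine_in_polyt p) auto
  have "(\<lambda>n. 1 / (real n + 1)) \<longlonglongrightarrow> 0"
    using LIMSEQ_inverse_real_of_nat by (simp add: inverse_eq_divide add.commute)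
  then have "\<gamma> \<longlonglongrightarrow> 0 *\<^sub>R p + (1 - 0) *\<^sub>R x"
    unfolding \<gamma>_def by (intro tendsto_intros)
  then have "(\<lambda>n. u (\<gamma> n)) \<longlonglongrightarrow> u x"
    using subsetD[OF polyt_subset_star \<gamma>]
    by (intro continuous_on_tendsto_compose[OF u(1) _ x]) (auto intro: always_eventually)
  moreover have "(\<lambda>n. u (\<gamma> n)) = (\<lambda>_. 0)" using z \<gamma> by auto
  ultimately show "u x = 0" using LIMSEQ_unique[OF tendsto_const] by metis
qed

text \<open>By the midpoint identity, two minimizers of the energy are at distance zero.\<close>

lemma energy_minimizer_unique:
  assumes min: "\<And>w. w \<in> convex_class \<Longrightarrow> energy u \<le> energy w"
    and u: "u \<in> convex_class" "I u = 0" and v: "v \<in> convex_class" "I v = 0" "energy v = energy u"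
    and x: "x \<in> \<Delta>s"
  shows "v x = u x"
proof -
  have si: "square_integrable u" "square_integrable v" using u v by (auto simp: convex_class_iff)
  let ?g = "\<lambda>x. u x - v x"
  have sg: "square_integrable ?g" and Ig: "I ?g = 0"
    using square_integrable_lin[OF si, of 1 "-1"] u v by simp_all
  have "energy u \<le> energy (\<lambda>x. 1/2 * u x + 1/2 * v x)"
    by (intro min convex_class_lin u v) auto
  also have "\<dots> = energy u - Q ?g / 8" unfolding energy_midpoint[OF si] v(3) by simp
  finally have "Q ?g = 0" using Q_nonneg[OF sg] by simp
  then have "I (\<lambda>x. ?g x * ?g x) = 0" by (simp add: Q_def covar_def Ig)
  then have "?g x = 0"
    using u(1) v(1) by (intro AE_zero_imp_zero[OF _ sg _ x] continuous_on_diff) (auto simp: convex_class_iff)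
  then show ?thesis by simp
qed

lemma energy_minimizer_imp_W:
  assumes min: "\<And>w. w \<in> convex_class \<Longrightarrow> energy u \<le> energy w" and neg: "energy u < 0"
    and u: "u \<in> convex_class" "I u = 0"
  shows "W_minimizer d a lam u"
    and "\<And>v. W_minimizer d a lam v \<Longrightarrow> I v = 0 \<Longrightarrow> \<exists>r>0. \<forall>x\<in>\<Delta>s. v x = r * u x"
proof -
  have si: "square_integrable u" using u by (simp add: convex_class_iff)
  have L: "L_fun d a lam u < 0" using neg Q_nonneg[OF si] by (simp add: energy_def)
  have Q: "Q u \<noteq> 0"
  proof
    \<comment> \<open>Otherwise the energy is linear on the ray through \<open>u\<close>, hence unbounded below.\<close>
    assume "Q u = 0"
    then have "energy (\<lambda>x. 2 * u x) = 2 * energy u"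
      unfolding energy_scale[OF si] by (simp add: energy_def)
    moreover have "(\<lambda>x. 2 * u x) \<in> convex_class" using convex_class_lin[OF u(1) u(1), of 2 0] by simp
    ultimately show False using min neg by force
  qed
  then have Qpos: "0 < Q u" using Q_nonneg[OF si] by simp
  have Wneg: "W_fun d a lam u < 0" using L Qpos by (simp add: W_eq divide_neg_pos)
  have scaled: "(\<lambda>x. (- L_fun d a lam v / Q v) * v x) \<in> convex_class"
    if "v \<in> convex_class" "L_fun d a lam v < 0" "Q v \<noteq> 0" for v
  proof -
    have "0 \<le> Q v" using that by (intro Q_nonneg) (simp add: convex_class_iff)
    then have "0 \<le> - L_fun d a lam v / Q v" using that by (intro divide_nonneg_nonneg) auto
    from convex_class_lin[OF that(1) that(1) this, of 0] show ?thesis by simp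
  qed
  have Wu: "- (W_fun d a lam u)\<^sup>2 / 2 = energy u"
    using energy_ge_W(1)[OF u(1) Q] energy_ge_W(2)[OF u(1) Q] min[OF scaled[OF u(1) L Q]] by linarith
  have le: "W_fun d a lam u \<le> W_fun d a lam v" if v: "v \<in> convex_class" "Q v \<noteq> 0" for v
  proof (cases "L_fun d a lam v < 0")
    case True
    have "energy u \<le> - (W_fun d a lam v)\<^sup>2 / 2"
      using min[OF scaled[OF v(1) True v(2)]] energy_ge_W(2)[OF v] by simp
    then have "(W_fun d a lam v)\<^sup>2 \<le> (W_fun d a lam u)\<^sup>2" using Wu by linarith
    then have "\<bar>W_fun d a lam v\<bar> \<le> \<bar>W_fun d a lam u\<bar>" by (simp add: abs_le_square_iff)
    then show ?thesis using Wneg by linarith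
  next
    case False
    have "0 \<le> Q v" using v by (intro Q_nonneg) (simp add: convex_class_iff)
    then have "0 \<le> W_fun d a lam v" using False by (simp add: W_eq)
    then show ?thesis using Wneg by linarith
  qed
  show "W_minimizer d a lam u"
    using u Q le by (auto simp: W_minimizer_def admissible_iff)
  fix v assume v: "W_minimizer d a lam v" "I v = 0"
  have vc: "v \<in> convex_class" "Q v \<noteq> 0" using v(1) by (auto simp: W_minimizer_def admissible_iff)
  have siv: "square_integrable v" using vc by (simp add: convex_class_iff)
  have "W_fun d a lam v \<le> W_fun d a lam u"
    using v(1) u(1) Q by (auto simp: W_minimizer_def admissible_iff)
  then have W: "W_fun d a lam v = W_fun d a lam u" using le[OF vc] by linarith
  have Qv: "0 < Q v" using vc Q_nonneg[OF siv] by simp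
  have Lv: "L_fun d a lam v < 0"
  proof (rule ccontr)
    assume "\<not> L_fun d a lam v < 0"
    then have "0 \<le> W_fun d a lam v" using Qv by (simp add: W_eq)
    then show False using W Wneg by simp
  qed
  define s where "s = - L_fun d a lam v / Q v"
  have s: "0 < s" using Lv Qv by (simp add: s_def divide_neg_pos)
  let ?v = "\<lambda>x. s * v x"
  have "energy ?v = energy u" using energy_ge_W(2)[OF vc] W Wu by (simp add: s_def)
  moreover have "?v \<in> convex_class" using scaled[OF vc(1) Lv vc(2)] by (simp add: s_def)
  moreover have "I ?v = 0" using v(2) by (simp add: polyt_integral_def)
  ultimately have "s * v x = u x" if "x \<in> \<Delta>s" for x
    using energy_minimizer_unique[OF min u] that by blast
  then have "\<forall>x\<in>\<Delta>s. v x = (1 / s) * u x" using s by (simp add: field_simps)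
  then show "\<exists>r>0. \<forall>x\<in>\<Delta>s. v x = r * u x" using s by (intro exI[of _ "1 / s"]) simp
qed

lemma convex_on_Max_affine:
  fixes A :: "('a :: euclidean_space \<times> real) set"
  assumes "finite A" "A \<noteq> {}"
  shows "convex_on UNIV (\<lambda>x. Max ((\<lambda>(p, q). p \<bullet> x + q) ` A))"
  unfolding convex_on_alt
proof (intro conjI ballI allI impI convex_UNIV)
  fix x y :: 'a and \<mu> :: real assume \<mu>: "0 \<le> \<mu> \<and> \<mu> \<le> 1"
  let ?M = "\<lambda>x. Max ((\<lambda>(p, q). p \<bullet> x + q) ` A)"
  show "?M (\<mu> *\<^sub>R x + (1 - \<mu>) *\<^sub>R y) \<le> \<mu> * ?M x + (1 - \<mu>) * ?M y"
  proof (rule Max.boundedI)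
    fix t assume "t \<in> (\<lambda>(p, q). p \<bullet> (\<mu> *\<^sub>R x + (1 - \<mu>) *\<^sub>R y) + q) ` A"
    then obtain p q where pq: "(p, q) \<in> A" "t = p \<bullet> (\<mu> *\<^sub>R x + (1 - \<mu>) *\<^sub>R y) + q" by auto
    have "t = \<mu> * (p \<bullet> x + q) + (1 - \<mu>) * (p \<bullet> y + q)"
      unfolding pq(2) by (simp add: inner_add_right algebra_simps)
    also have "\<dots> \<le> \<mu> * ?M x + (1 - \<mu>) * ?M y"
      using assms \<mu> pq(1) by (intro add_mono mult_left_mono Max_ge) force+
    finally show "t \<le> \<mu> * ?M x + (1 - \<mu>) * ?M y" .
  qed (use assms in auto)
qed

lemma unstable_imp_negative_energy:
  assumes "unstable d a lam"
  obtains u0 where "u0 \<in> convex_class" "energy u0 < 0"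
proof -
  obtain u where u: "rational_pl_convex_on (closure \<Delta>) u" "L_fun d a lam u < 0"
    using assms by (auto simp: unstable_def)
  then obtain A :: "((real ^ 'n) \<times> real) set" where A: "finite A" "A \<noteq> {}"
    and eq: "\<And>x. x \<in> closure \<Delta> \<Longrightarrow> u x = Max ((\<lambda>(p, q). p \<bullet> x + q) ` A)"
    by (auto simp: rational_pl_convex_on_def)
  let ?M = "\<lambda>x. Max ((\<lambda>(p, q). p \<bullet> x + q) ` A)"
  note c = convex_on_Max_affine[OF A]
  have "continuous_on (closure \<Delta>) ?M" "convex_on (closure \<Delta>) ?M"
    using continuous_on_subset[OF convex_class_UNIV(2)[OF c]] convex_on_subset[OF c _ convex_closure_polyt] by auto
  moreover have "continuous_on (closure \<Delta>) u \<longleftrightarrow> continuous_on (closure \<Delta>) ?M"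
    by (rule continuous_on_cong) (auto simp: eq)
  moreover have "convex_on (closure \<Delta>) u \<longleftrightarrow> convex_on (closure \<Delta>) ?M"
    unfolding convex_on_def by (simp add: eq convexD[OF convex_closure_polyt] cong: ball_cong)
  ultimately have uc: "u \<in> convex_class" by (intro convex_class_closure) auto
  then have si: "square_integrable u" by (simp add: convex_class_iff)
  \<comment> \<open>Every sufficiently small positive multiple of \<open>u\<close> has negative energy; the denominator \<open>Q u + 1\<close> is never zero.\<close>
  define s where "s = - L_fun d a lam u / (Q u + 1)"
  have Q: "0 \<le> Q u" by (rule Q_nonneg[OF si])
  have s: "0 < s" using u(2) Q by (simp add: s_def divide_neg_pos)
  have "s * (Q u + 1) = - L_fun d a lam u" using Q by (simp add: s_def)
  then have "L_fun d a lam u + s * Q u / 2 < 0" using s mult_nonneg_nonneg[of s "Q u"] Q u(2)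
    by (simp add: distrib_left)
  then have "s * (L_fun d a lam u + s * Q u / 2) < 0" using s by (rule mult_pos_neg[rotated])
  then have "energy (\<lambda>x. s * u x) < 0"
    unfolding energy_scale[OF si] by (simp add: power2_eq_square algebra_simps)
  moreover have "(\<lambda>x. s * u x) \<in> convex_class" using convex_class_lin[OF uc uc, of s 0] s by simp
  ultimately show thesis using that by blast
qed

end

section \<open>The filtration of a convex function\<close>

lemma scalar_mult_mult_left: "scalar_mult c f * g = scalar_mult c (f * g)"
  and scalar_mult_mult_right: "f * scalar_mult c g = scalar_mult c (f * g)"
  by (simp_all add: scalar_mult_def mult.assoc mult.left_commute)

lemma span_mult:
  fixes S T U :: "'n::finite section_ring set"
  assumes ST: "\<And>s t. s \<in> S \<Longrightarrow> t \<in> T \<Longrightarrow> s * t \<in> section_space.span U"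
    and f: "f \<in> section_space.span S" and g: "g \<in> section_space.span T"
  shows "f * g \<in> section_space.span U"
proof -
  have 1: "s * g \<in> section_space.span U" if s: "s \<in> S" for s
    using g
  proof (induction rule: section_space.span_induct_alt)
    case base
    show ?case by (simp add: section_space.span_zero)
  next
    case (step c t y)
    then show ?case
      using ST[OF s step(1)]
      by (simp add: distrib_left scalar_mult_mult_right section_space.span_add section_space.span_scale)
  qed
  show ?thesis
    using f
  proof (induction rule: section_space.span_induct_alt)
    case base
    show ?case by (simp add: section_space.span_zero)
  next
    case (step c s y)
    then show ?case
      using 1[OF step(1)]
      by (simp add: distrib_right scalar_mult_mult_left section_space.span_add section_space.span_scale)
  qed
qed

lemma monom_section_mult: "monom_section k m * monom_section k' m' = monom_section (k + k') (m + m')"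
  by (simp add: monom_section_def mult_single)

lemma monom_section_zero: "monom_section 0 0 = 1"
  by (simp add: monom_section_def zero_prod_def[symmetric])

lemma real_vec_add: "real_vec (m + m') = real_vec m + real_vec m'"
  by (simp add: real_vec_def vec_eq_iff)

lemma real_vec_eq_0: "real_vec m = 0 \<longleftrightarrow> m = 0"
  by (simp add: real_vec_def vec_eq_iff)

context lattice_polytope
begin

abbreviation latt where "latt \<equiv> lattice_points d a lam"

lemma lattice_points_0: "latt 0 = {0}"
  using nonempty closure_subset[of \<Delta>] by (auto simp: lattice_points_def real_vec_eq_0)

lemma lattice_points_point:
  assumes "m \<in> latt k" "0 < k"
  shows "(1 / real k) *\<^sub>R real_vec m \<in> closure \<Delta>"
  using assms by (auto simp: lattice_points_def)

text \<open>The product of two sections lies over a weighted mean of their points.\<close>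

lemma lattice_points_add:
  assumes u: "convex_on (closure \<Delta>) u"
    and m: "m \<in> latt k" "m' \<in> latt k'"
  shows "m + m' \<in> latt (k + k')"
    and "real (k + k') * u ((1 / real (k + k')) *\<^sub>R real_vec (m + m'))
      \<le> real k * u ((1 / real k) *\<^sub>R real_vec m) + real k' * u ((1 / real k') *\<^sub>R real_vec m')"
proof -
  have "m + m' \<in> latt (k + k') \<and> real (k + k') * u ((1 / real (k + k')) *\<^sub>R real_vec (m + m'))
      \<le> real k * u ((1 / real k) *\<^sub>R real_vec m) + real k' * u ((1 / real k') *\<^sub>R real_vec m')"
  proof -
    consider "k = 0" "m = 0" | "k' = 0" "m' = 0" | "0 < k" "0 < k'"
      using m lattice_points_0 by (cases "k = 0"; cases "k' = 0") simp_all
    then show ?thesis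
    proof cases
      case 1
      then show ?thesis using m(2) by simp
    next
      case 2
      then show ?thesis using m(1) by simp
    next
      case k: 3
      let ?x = "(1 / real k) *\<^sub>R real_vec m" and ?y = "(1 / real k') *\<^sub>R real_vec m'"
      let ?s = "real k / real (k + k')" and ?t = "real k' / real (k + k')"
      have x: "?x \<in> closure \<Delta>" and y: "?y \<in> closure \<Delta>"
        using lattice_points_point m k by auto
      have st: "0 \<le> ?s" "0 \<le> ?t" "?s + ?t = 1"
        using k by (auto simp flip: add_divide_distrib)
      have z: "(1 / real (k + k')) *\<^sub>R real_vec (m + m') = ?s *\<^sub>R ?x + ?t *\<^sub>R ?y"
        using k by (simp add: real_vec_add scaleR_add_right)
      have zc: "?s *\<^sub>R ?x + ?t *\<^sub>R ?y \<in> closure \<Delta>"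
        using convexD[OF convex_closure_polyt x y st] .
      have "real_vec (m + m') = real (k + k') *\<^sub>R ((1 / real (k + k')) *\<^sub>R real_vec (m + m'))"
        using k by simp
      then have "m + m' \<in> latt (k + k')"
        unfolding lattice_points_def by (intro CollectI bexI[OF _ zc[folded z]])
      moreover have "u (?s *\<^sub>R ?x + ?t *\<^sub>R ?y) \<le> ?s * u ?x + ?t * u ?y"
        using u x y st unfolding convex_on_def by blast
      then have "real (k + k') * u (?s *\<^sub>R ?x + ?t *\<^sub>R ?y) \<le> real (k + k') * (?s * u ?x + ?t * u ?y)"
        by (intro mult_left_mono) auto
      then have "real (k + k') * u (?s *\<^sub>R ?x + ?t *\<^sub>R ?y) \<le> real k * u ?x + real k' * u ?y"
        using k by (simp add: distrib_left)
      ultimately show ?thesis unfolding z by blast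
    qed
  qed
  then show "m + m' \<in> latt (k + k')"
    and "real (k + k') * u ((1 / real (k + k')) *\<^sub>R real_vec (m + m'))
      \<le> real k * u ((1 / real k) *\<^sub>R real_vec m) + real k' * u ((1 / real k') *\<^sub>R real_vec m')" by blast+
qed

text \<open>
  Positivity of \<open>u\<close> is needed for the first step of the filtration to consist of the constants
  only.
\<close>

lemma ring_filtration_chi:
  assumes u: "convex_on (closure \<Delta>) u" and pos: "\<And>x. x \<in> closure \<Delta> \<Longrightarrow> 0 < u x"
  shows "ring_filtration d a lam (chi_filtration d a lam u)"
proof -
  define S :: "nat \<Rightarrow> 'n section_ring set" where "S i = {monom_section k m | k m. m \<in> latt k \<and>
    real k * u ((1 / real k) *\<^sub>R real_vec m) \<le> real i}" for i
  define F where "F = chi_filtration d a lam u"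
  have F: "F i = section_space.span (S i)" for i by (simp add: F_def chi_filtration_def S_def)
  have S_mono: "S i \<subseteq> S j" if "i \<le> j" for i j
  proof -
    have "real i \<le> real j" using that by simp
    then show ?thesis unfolding S_def by (blast intro: order_trans)
  qed
  have F_mono: "F i \<subseteq> F j" if "i \<le> j" for i j
    unfolding F by (intro section_space.span_mono S_mono that)
  have S_graded: "S i \<subseteq> (\<Union>k. F i \<inter> graded_part d a lam k)" for i
  proof
    fix s assume s: "s \<in> S i"
    then obtain k m where "s = monom_section k m" "m \<in> latt k" by (auto simp: S_def)
    then have "s \<in> graded_part d a lam k" unfolding graded_part_def by (intro section_space.span_base) auto
    moreover have "s \<in> F i" unfolding F by (rule section_space.span_base[OF s])
    ultimately show "s \<in> (\<Union>k. F i \<inter> graded_part d a lam k)" by blast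
  qed
  have F_ring: "F i \<subseteq> coord_ring d a lam" for i
    unfolding coord_ring_def F using S_graded[of i] by (intro section_space.span_mono) blast
  have "S 0 = {1}"
  proof -
    have k0: "k = 0" if "m \<in> latt k" "real k * u ((1 / real k) *\<^sub>R real_vec m) \<le> 0" for k m
    proof (rule ccontr)
      assume "k \<noteq> 0"
      then have "0 < real k * u ((1 / real k) *\<^sub>R real_vec m)"
        using pos[OF lattice_points_point[OF that(1)]] by simp
      then show False using that(2) by simp
    qed
    have "s = monom_section 0 0" if s: "s \<in> S 0" for s
    proof -
      obtain k m where "s = monom_section k m" "m \<in> latt k" "real k * u ((1 / real k) *\<^sub>R real_vec m) \<le> 0"
        using s by (auto simp: S_def)
      with k0[of m k] show ?thesis by (simp add: lattice_points_0)
    qed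
    moreover have "monom_section 0 0 \<in> S 0"
      unfolding S_def by (rule CollectI, intro exI[of _ 0]) (simp add: lattice_points_0)
    ultimately have "S 0 = {monom_section 0 0}" by blast
    then show ?thesis by (simp add: monom_section_zero)
  qed
  then have F0: "F 0 = range (\<lambda>c. scalar_mult c 1)"
    unfolding F by (simp add: section_space.span_singleton)
  have F_mult: "f * g \<in> F (i + j)" if "f \<in> F i" "g \<in> F j" for f g i j
    using that unfolding F
  proof (rule span_mult[rotated])
    fix s t assume s: "s \<in> S i" and t: "t \<in> S j"
    obtain k m where s': "s = monom_section k m" "m \<in> latt k"
      "real k * u ((1 / real k) *\<^sub>R real_vec m) \<le> real i" using s by (auto simp: S_def)
    obtain k' m' where t': "t = monom_section k' m'" "m' \<in> latt k'"
      "real k' * u ((1 / real k') *\<^sub>R real_vec m') \<le> real j" using t by (auto simp: S_def)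
    have "real (k + k') * u ((1 / real (k + k')) *\<^sub>R real_vec (m + m')) \<le> real (i + j)"
      using lattice_points_add(2)[OF u s'(2) t'(2)] s'(3) t'(3) by simp
    then have "s * t \<in> S (i + j)"
      unfolding S_def s'(1) t'(1) monom_section_mult using lattice_points_add(1)[OF u s'(2) t'(2)] by blast
    then show "s * t \<in> section_space.span (S (i + j))" by (rule section_space.span_base)
  qed
  have F_graded: "F i = section_space.span (\<Union>k. F i \<inter> graded_part d a lam k)" for i
  proof
    show "F i \<subseteq> section_space.span (\<Union>k. F i \<inter> graded_part d a lam k)"
      using section_space.span_mono[OF S_graded] by (simp add: F)
    have "(\<Union>k. F i \<inter> graded_part d a lam k) \<subseteq> F i" by blast
    from section_space.span_mono[OF this]
    show "section_space.span (\<Union>k. F i \<inter> graded_part d a lam k) \<subseteq> F i"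
      by (simp add: F section_space.span_span)
  qed
  have F_add: "section_space.subspace (\<Union>i. F i)"
  proof (rule section_space.subspaceI)
    show "0 \<in> (\<Union>i. F i)" by (auto simp: F section_space.span_zero)
    show "x + y \<in> (\<Union>i. F i)" if xy: "x \<in> (\<Union>i. F i)" "y \<in> (\<Union>i. F i)" for x y
    proof -
      obtain i j where "x \<in> F i" "y \<in> F j" using xy by blast
      then have "x \<in> F (max i j)" "y \<in> F (max i j)"
        using F_mono[of i "max i j"] F_mono[of j "max i j"] by auto
      then have "x + y \<in> F (max i j)" unfolding F by (rule section_space.span_add)
      then show ?thesis by blast
    qed
    show "scalar_mult c x \<in> (\<Union>i. F i)" if x: "x \<in> (\<Union>i. F i)" for c x
    proof -
      obtain i where "x \<in> F i" using x by blast
      then have "scalar_mult c x \<in> F i" unfolding F by (rule section_space.span_scale)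
      then show ?thesis by blast
    qed
  qed
  have "graded_part d a lam k \<subseteq> (\<Union>i. F i)" for k
    unfolding graded_part_def
  proof (rule section_space.span_minimal[OF _ F_add])
    show "monom_section k ` latt k \<subseteq> (\<Union>i. F i)"
    proof
      fix s :: "'n section_ring" assume "s \<in> monom_section k ` latt k"
      then obtain m where m: "s = monom_section k m" "m \<in> latt k" by auto
      obtain i :: nat where "real k * u ((1 / real k) *\<^sub>R real_vec m) \<le> real i"
        using real_arch_simple by blast
      then have "s \<in> S i" using m by (auto simp: S_def)
      then have "s \<in> F i" unfolding F by (rule section_space.span_base)
      then show "s \<in> (\<Union>i. F i)" by blast
    qed
  qed
  then have "coord_ring d a lam \<subseteq> (\<Union>i. F i)"
    unfolding coord_ring_def by (intro section_space.span_minimal[OF _ F_add]) blast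
  then have "coord_ring d a lam = (\<Union>i. F i)" using F_ring by blast
  then show ?thesis
    unfolding ring_filtration_def F_def[symmetric]
  proof (intro conjI allI ballI)
    show "section_space.subspace (F i)" for i
      unfolding F by (rule section_space.subspace_span)
    show "F i \<subseteq> F (Suc i)" for i by (rule F_mono) simp
    show "F i \<subseteq> coord_ring d a lam" for i by (rule F_ring)
    show "F 0 = range (\<lambda>c. scalar_mult c 1)" by (rule F0)
    show "f * g \<in> F (i + j)" if "f \<in> F i" "g \<in> F j" for i j f g
      using that by (rule F_mult)
    show "F i = section_space.span (\<Union>k. F i \<inter> graded_part d a lam k)" for i by (rule F_graded)
    show "coord_ring d a lam = (\<Union>i. F i)" by fact
  qed
qed

end

section \<open>The optimal destabilizer\<close>

lemma delzant_imp_lattice_polytope: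
  assumes "delzant_polytope d a lam"
  shows "lattice_polytope d a lam"
proof
  fix i assume "i \<in> {1..d}"
  then have *: "primitive_vec (a i)" "facet d a lam i facet_of closure (polyt d a lam)"
    using assms by (auto simp: delzant_polytope_def)
  show "facet d a lam i facet_of closure (polyt d a lam)" by (rule *(2))
  show "real_vec (a i) \<noteq> 0"
    using *(1) by (auto simp: real_vec_eq_0 primitive_vec_def)
qed (use assms in \<open>auto simp: delzant_polytope_def\<close>)

theorem theorem6p2:
  fixes d :: nat and a :: "nat \<Rightarrow> int ^ 'n" and lam :: "nat \<Rightarrow> int"
  assumes "delzant_polytope d a lam"
    and "unstable d a lam"
  shows "\<exists>u :: real ^ 'n \<Rightarrow> real.
    convex_on (closure (polyt d a lam)) u \<and>
    bounded (u ` closure (polyt d a lam)) \<and>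
    polyt_integral d a lam u = 0 \<and>
    W_minimizer d a lam u \<and>
    (\<exists>c. \<forall>x\<in>closure (polyt d a lam). 0 < u x + c) \<and>
    (\<forall>c. (\<forall>x\<in>closure (polyt d a lam). 0 < u x + c) \<longrightarrow>
      ring_filtration d a lam (chi_filtration d a lam (\<lambda>x. u x + c))) \<and>
    (\<forall>v. W_minimizer d a lam v \<and> polyt_integral d a lam v = 0 \<longrightarrow>
      (\<exists>r>0. \<forall>x\<in>polyt_star d a lam. v x = r * u x))"
proof -
  interpret lattice_polytope d a lam by (rule delzant_imp_lattice_polytope[OF assms(1)])
  obtain u0 where u0: "u0 \<in> convex_class" "energy u0 < 0"
    using unstable_imp_negative_energy[OF assms(2)] by blast
  obtain u where u: "continuous_on (closure \<Delta>) u" "convex_on (closure \<Delta>) u" "I u = 0"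
    and min: "\<And>v. v \<in> convex_class \<Longrightarrow> energy u \<le> energy v"
    using exists_energy_minimizer[OF u0] by blast
  have uc: "u \<in> convex_class" by (rule convex_class_closure[OF u(1,2)])
  have neg: "energy u < 0" using min[OF u0(1)] u0(2) by linarith
  have bdd: "bounded (u ` closure \<Delta>)"
    by (intro compact_imp_bounded compact_continuous_image u(1) compact_closure_polyt)
  then obtain K where K: "\<And>x. x \<in> closure \<Delta> \<Longrightarrow> \<bar>u x\<bar> \<le> K" by (auto simp: bounded_iff)
  have "0 < u x + (K + 1)" if "x \<in> closure \<Delta>" for x using K[OF that] by linarith
  then have pos: "\<exists>c. \<forall>x\<in>closure \<Delta>. 0 < u x + c" by blast
  have filt: "ring_filtration d a lam (chi_filtration d a lam (\<lambda>x. u x + c))"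
    if "\<forall>x\<in>closure \<Delta>. 0 < u x + c" for c
    using that u(2) convex_closure_polyt
    by (intro ring_filtration_chi convex_on_add) (auto simp: convex_on_const)
  show ?thesis
    by (intro exI[of _ u] conjI allI impI u(2,3) bdd pos filt
        energy_minimizer_imp_W[OF min neg uc u(3)]) auto
qed

end
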